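(* Let $X$ be an infinite dimensional separable complex Fréchet space, with a fundamental system of seminorms $(\rho_n)_{n\in\mathbb N}$. Then there exist an integer $m\ge 2$ and a continuous $m$-homogeneous polynomial $Q:X\to X$ such that, at the same time: (1) $Q$ is weakly hypercyclic; (2) $Q$ is $d$-hypercyclic for some sequence $d=(d_n)_{n\in\mathbb N}$ of positive numbers; (3) $Q$ is $\Gamma$-supercyclic for every $\Gamma\subset\mathbb C$ which is unbounded or has $0$ as an accumulation point.
   Context: A map $P:X\to X$ is an $m$-homogeneous polynomial if there is an $m$-linear map $A:X^m\to X$ with $P(x)=A(x,\dots,x)$; polynomials are assumed continuous. The orbit of $x$ is $Orb_P(x)=\{P^n(x):n\in\mathbb N_0\}$ (iterates). $P$ is weakly hypercyclic if some orbit $Orb_P(x)$ is dense in $X$ for the weak topology. For a fundamental system of seminorms $(\rho_n)_n$ of $X$ and a sequence $d=(d_n)_n$ of positive numbers, a set $A\subseteq X$ is $d$-dense if for every $x\in X$ and every $n$ there is $a\in A$ with $\rho_n(x-a)<d_n$; $P$ is $d$-hypercyclic if some orbit $Orb_P(x)$ is $d$-dense. For $\Gamma\subseteq\mathbb C$, $P$ is $\Gamma$-supercyclic if there is $x\in X$ such that $\Gamma\cdot Orb_P(x)=\{\gamma P^n(x):\gamma\in\Gamma,\ n\in\mathbb N_0\}$ is dense in $X$. *)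

theory Defs
  imports "HOL-Analysis.Analysis"
begin

text \<open>HOL-Analysis has no type class of complex topological vector spaces.  A complex vector space
  is given here by an additive group type together with an explicit scalar multiplication
  satisfying the locale \<open>vector_space\<close>; its topology is the one of the type class.\<close>

locale complex_frechet_space = vector_space smul
  for smul :: "complex \<Rightarrow> 'a::{topological_ab_group_add, t2_space} \<Rightarrow> 'a" +
  assumes continuous_scale: "continuous_on UNIV (\<lambda>(c, x). smul c x)"
    and locally_convex:
      "\<And>U. open U \<Longrightarrow> 0 \<in> U \<Longrightarrow>
        \<exists>V. open V \<and> 0 \<in> V \<and> V \<subseteq> U \<and>
          (\<forall>x\<in>V. \<forall>y\<in>V. \<forall>t::real. 0 \<le> t \<and> t \<le> 1 \<longrightarrow>
             smul (of_real (1 - t)) x + smul (of_real t) y \<in> V)"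
    and metrizable: "metrizable_space (euclidean :: 'a topology)"
    \<comment> \<open>Sequential completeness with respect to the group uniformity; this is completeness because
      the space is metrizable.\<close>
    and complete:
      "\<And>s::nat \<Rightarrow> 'a.
        (\<And>U. open U \<Longrightarrow> 0 \<in> U \<Longrightarrow> \<exists>N. \<forall>i\<ge>N. \<forall>j\<ge>N. s i - s j \<in> U) \<Longrightarrow> \<exists>l. s \<longlonglongrightarrow> l"

definition seminorm :: "(complex \<Rightarrow> 'a::ab_group_add \<Rightarrow> 'a) \<Rightarrow> ('a \<Rightarrow> real) \<Rightarrow> bool" where
  "seminorm smul p \<longleftrightarrow>
     (\<forall>x. 0 \<le> p x) \<and> (\<forall>x y. p (x + y) \<le> p x + p y) \<and> (\<forall>c x. p (smul c x) = cmod c * p x)"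

text \<open>The multiples of the unit balls of the \<open>\<rho> n\<close> form a base of neighbourhoods of 0.  The
  sequence is not required to be increasing; increasing generating sequences are a special case.\<close>

definition fundamental_seminorms ::
    "(complex \<Rightarrow> 'a::{ab_group_add, topological_space} \<Rightarrow> 'a) \<Rightarrow> (nat \<Rightarrow> 'a \<Rightarrow> real) \<Rightarrow> bool" where
  "fundamental_seminorms smul \<rho> \<longleftrightarrow>
     (\<forall>n. seminorm smul (\<rho> n) \<and> continuous_on UNIV (\<rho> n)) \<and>
     (\<forall>U. open U \<and> 0 \<in> U \<longrightarrow> (\<exists>n. \<exists>e>0. {x. \<rho> n x < e} \<subseteq> U))"

definition multilinear ::
    "(complex \<Rightarrow> 'a::ab_group_add \<Rightarrow> 'a) \<Rightarrow> nat \<Rightarrow> ('a list \<Rightarrow> 'a) \<Rightarrow> bool" where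
  "multilinear smul m A \<longleftrightarrow>
     (\<forall>xs. length xs = m \<longrightarrow>
        (\<forall>i<m. Vector_Spaces.linear smul smul (\<lambda>y. A (xs[i := y]))))"

definition homogeneous_polynomial ::
    "(complex \<Rightarrow> 'a::ab_group_add \<Rightarrow> 'a) \<Rightarrow> nat \<Rightarrow> ('a \<Rightarrow> 'a) \<Rightarrow> bool" where
  "homogeneous_polynomial smul m P \<longleftrightarrow>
     (\<exists>A. multilinear smul m A \<and> (\<forall>x. P x = A (replicate m x)))"

definition Orb :: "('a \<Rightarrow> 'a) \<Rightarrow> 'a \<Rightarrow> 'a set" where
  "Orb P x = {(P ^^ n) x | n. True}"

text \<open>The weak topology is the coarsest topology making all continuous linear functionals
  continuous.\<close>

definition weak_topology ::
    "(complex \<Rightarrow> 'a::{ab_group_add, topological_space} \<Rightarrow> 'a) \<Rightarrow> 'a topology" where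
  "weak_topology smul =
     topology_generated_by
       {f -` U | (f :: 'a \<Rightarrow> complex) U.
          Vector_Spaces.linear smul (*) f \<and> continuous_on UNIV f \<and> open U}"

definition weakly_hypercyclic ::
    "(complex \<Rightarrow> 'a::{ab_group_add, topological_space} \<Rightarrow> 'a) \<Rightarrow> ('a \<Rightarrow> 'a) \<Rightarrow> bool" where
  "weakly_hypercyclic smul P \<longleftrightarrow> (\<exists>x. weak_topology smul closure_of Orb P x = UNIV)"

definition d_dense ::
    "(nat \<Rightarrow> 'a::ab_group_add \<Rightarrow> real) \<Rightarrow> (nat \<Rightarrow> real) \<Rightarrow> 'a set \<Rightarrow> bool" where
  "d_dense \<rho> d A \<longleftrightarrow> (\<forall>x. \<forall>n. \<exists>a\<in>A. \<rho> n (x - a) < d n)"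

definition d_hypercyclic ::
    "(nat \<Rightarrow> 'a::ab_group_add \<Rightarrow> real) \<Rightarrow> (nat \<Rightarrow> real) \<Rightarrow> ('a \<Rightarrow> 'a) \<Rightarrow> bool" where
  "d_hypercyclic \<rho> d P \<longleftrightarrow> (\<exists>x. d_dense \<rho> d (Orb P x))"

definition supercyclic ::
    "(complex \<Rightarrow> 'a::topological_space \<Rightarrow> 'a) \<Rightarrow> complex set \<Rightarrow> ('a \<Rightarrow> 'a) \<Rightarrow> bool" where
  "supercyclic smul \<Gamma> P \<longleftrightarrow>
     (\<exists>x. closure {smul \<gamma> y | \<gamma> y. \<gamma> \<in> \<Gamma> \<and> y \<in> Orb P x} = UNIV)"

end

theory Submission
  imports Defs "HOL-Complex_Analysis.Complex_Analysis" "HOL-Real_Asymp.Real_Asymp"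
begin

text \<open>
  The polynomial is \<open>Q x = smul (\<alpha> x) (T x)\<close>, where \<open>T\<close> is the identity plus a backward shift
  \<open>e (Suc n) \<mapsto> e n\<close> along the vectors of a biorthogonal system with dense span and \<open>\<alpha>\<close> is the
  coordinate functional of \<open>e 0\<close>.  Identifying \<open>e n\<close> with the Newton polynomial
  \<open>X (X - 1) \<dots> (X - n + 1) / n!\<close> turns \<open>T\<close> into the translation \<open>u(X) \<mapsto> u(X + 1)\<close> and \<open>\<alpha>\<close>
  into evaluation at \<open>0\<close>, so that \<open>Q\<^sup>n u = c\<^sub>n u(X + n)\<close> with
  \<open>c\<^sub>0 = 1\<close> and \<open>c\<^sub>n\<^sub>+\<^sub>1 = c\<^sub>n\<^sup>2 u(n)\<close>.

  Given polynomials \<open>v\<close>, \<open>w\<close>, one writes down a polynomial \<open>u\<close> of bounded degree whose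
  coefficients at \<open>0\<close> and at \<open>n\<close> are close to those of \<open>v\<close> and \<open>w\<close>, and which vanishes at
  \<open>n / 2\<close>.  If the \<open>c\<^sub>j\<close> of \<open>v\<close> grow doubly exponentially and \<open>u\<close> is not too small at the
  other integers, then adding a small constant \<open>\<delta>\<close> to \<open>u\<close> makes \<open>c\<^sub>n\<close> huge on a circle
  \<open>\<bar>\<delta>\<bar> = r\<close> while \<open>c\<^sub>n = 0\<close> for \<open>\<delta> = 0\<close>; by the maximum principle some \<open>\<delta>\<close> in the disc
  gives \<open>c\<^sub>n = 1\<close>, so the orbit of \<open>u\<close> starts near \<open>v\<close> and passes near \<open>w\<close>.  A Baire argument
  yields one orbit whose closure contains all polynomials with growing \<open>c\<^sub>j\<close>.  They lie at bounded
  distance from every vector, meet every weak neighbourhood, and contain large multiples of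
  a dense set.  For unbounded \<open>\<Gamma>\<close> no growth is needed, since then any small value of \<open>c\<^sub>n\<close>
  may be compensated by an element of \<open>\<Gamma>\<close>.
\<close>

section \<open>The Hahn--Banach theorem for seminorms\<close>

text \<open>In a normed space the norm of \<open>Q x\<close> is at most a constant times the square
  of the norm of \<open>x\<close>, so some ball around 0 is mapped into itself and no orbit that
  enters a small enough ball can leave it. Density in the original topology is therefore out of
  reach in general, and one can aim only at targets from which escape is still possible. This is why
  every connecting polynomial must again be shown to be escaping: otherwise the Baire argument could
  not pass to the next target.

  The factor c_n is the product of the powers u(j)^(2^(n-1-j)), typically astronomically small or
  large, so size estimates alone never give the exact value 1. Two small parameters are spent on it.
  A real one, multiplying a function that keeps the zero at n/2, moves the values at the other
  integers away from 0; then a complex one tunes c_n. The second must be exponentially small in n in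
  order not to undo the first. Crossing the zero thus costs an exponentially small factor, which is
  affordable because the zero is far from 0 and the growth before it is doubly exponential.\<close>

lemma seminorm_nonneg: "seminorm smul p \<Longrightarrow> 0 \<le> p x"
  and seminorm_triangle: "seminorm smul p \<Longrightarrow> p (x + y) \<le> p x + p y"
  and seminorm_scale: "seminorm smul p \<Longrightarrow> p (smul c x) = cmod c * p x"
  by (simp_all add: seminorm_def)

text \<open>Only real nonnegative scalars occur, because the Hahn-Banach argument treats the real
  part of a complex functional. The inequality in the scaling clause suffices: scaling back by
  \<open>1/r\<close> reverses it.\<close>

definition sublinear :: "(complex \<Rightarrow> 'a::ab_group_add \<Rightarrow> 'a) \<Rightarrow> ('a \<Rightarrow> real) \<Rightarrow> bool" where
  "sublinear smul q \<longleftrightarrow>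
     (\<forall>x y. q (x + y) \<le> q x + q y) \<and> (\<forall>r x. 0 \<le> r \<longrightarrow> q (smul (of_real r) x) \<le> r * q x)"

context vector_space
begin

lemma linear_functional_iff:
  "Vector_Spaces.linear scale (*) f \<longleftrightarrow>
     (\<forall>x y. f (x + y) = f x + f y) \<and> (\<forall>c x. f (scale c x) = c * f x)"
proof -
  have "vector_space ((*) :: 'a \<Rightarrow> 'a \<Rightarrow> 'a)"
    by unfold_locales (auto simp: algebra_simps)
  then show ?thesis
    unfolding Vector_Spaces.linear_iff using vector_space_axioms by simp
qed

lemma linear_self_iff:
  "Vector_Spaces.linear scale scale f \<longleftrightarrow>
     (\<forall>x y. f (x + y) = f x + f y) \<and> (\<forall>c x. f (scale c x) = scale c (f x))"
  unfolding Vector_Spaces.linear_iff using vector_space_axioms by simp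

end

locale complex_vector_space = vector_space smul
  for smul :: "complex \<Rightarrow> 'a::ab_group_add \<Rightarrow> 'a"
begin

lemma sublinear_triangle: "sublinear smul q \<Longrightarrow> q (x + y) \<le> q x + q y"
  by (simp add: sublinear_def)

lemma sublinear_scale_le: "sublinear smul q \<Longrightarrow> 0 \<le> r \<Longrightarrow> q (smul (of_real r) x) \<le> r * q x"
  by (simp add: sublinear_def)

lemma sublinear_scale:
  assumes "sublinear smul q" "0 < r"
  shows "q (smul (of_real r) x) = r * q x"
proof (rule antisym)
  show "q (smul (of_real r) x) \<le> r * q x"
    using assms by (simp add: sublinear_scale_le)
  have "q (smul (of_real (1/r)) (smul (of_real r) x)) \<le> (1/r) * q (smul (of_real r) x)"
    using assms by (intro sublinear_scale_le) auto
  then show "r * q x \<le> q (smul (of_real r) x)"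
    using assms by (simp add: field_simps)
qed

lemma sublinear_zero:
  assumes "sublinear smul q"
  shows "q 0 = 0"
proof (rule antisym)
  show "q 0 \<le> 0" using sublinear_scale_le[OF assms, of 0 0] by simp
  show "0 \<le> q 0" using sublinear_triangle[OF assms, of 0 0] by simp
qed

lemma sublinear_ge_uminus: "sublinear smul q \<Longrightarrow> - q (- x) \<le> q x"
  using sublinear_triangle[of q x "-x"] sublinear_zero[of q] by simp

text \<open>Take \<open>q' y\<close> as the infimum over \<open>t \<ge> 0\<close> of
  \<open>q (y + t x) - t q x\<close>. The values \<open>t = 0\<close> and \<open>t = 1\<close> give
  the two upper bounds, and \<open>t q x = q (t x) \<le> q (y + t x) + q (- y)\<close> keeps the
  infimum finite.\<close>

lemma sublinear_lower:
  fixes q :: "'a \<Rightarrow> real"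
  assumes q: "sublinear smul q"
  obtains q' where "sublinear smul q'" "q' \<le> q" "\<And>y. q' y \<le> q (y + x) - q x"
proof -
  define F where "F = (\<lambda>y t. q (y + smul (of_real t) x) - t * q x)"
  define q' where "q' = (\<lambda>y. INF t\<in>{0..}. F y t)"
  have bound: "- q (- y) \<le> F y t" if "0 \<le> t" for y t
  proof (cases "t = 0")
    case True
    then show ?thesis using sublinear_ge_uminus[OF q] by (simp add: F_def)
  next
    case False
    with that have "t * q x = q (smul (of_real t) x)" using sublinear_scale[OF q, of t x] by simp
    also have "\<dots> = q ((y + smul (of_real t) x) + (- y))" by simp
    also have "\<dots> \<le> q (y + smul (of_real t) x) + q (- y)" by (rule sublinear_triangle[OF q])
    finally show ?thesis by (simp add: F_def)
  qed
  have bdd: "bdd_below (F y ` {0..})" for y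
    using bound by (auto intro!: bdd_belowI)
  have le: "q' y \<le> F y t" if "0 \<le> t" for y t
    unfolding q'_def using that by (intro cINF_lower[OF bdd]) auto
  have ge: "a \<le> q' y" if "\<And>t. 0 \<le> t \<Longrightarrow> a \<le> F y t" for a y
    unfolding q'_def using that by (intro cINF_greatest) auto
  have add: "q' (y + z) \<le> q' y + q' z" for y z
  proof -
    have 1: "q' (y + z) \<le> F y s + F z t" if "0 \<le> s" "0 \<le> t" for s t
    proof -
      have "q' (y + z) \<le> F (y + z) (s + t)" using that by (intro le) auto
      also have "\<dots> \<le> F y s + F z t"
        using sublinear_triangle[OF q, of "y + smul (of_real s) x" "z + smul (of_real t) x"]
        by (simp add: F_def algebra_simps scale_left_distrib)
      finally show ?thesis .
    qed
    have "q' (y + z) - F z t \<le> q' y" if "0 \<le> t" for t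
      using that 1 by (intro ge) (simp add: algebra_simps)
    then have "q' (y + z) - q' y \<le> q' z" by (intro ge) (simp add: algebra_simps)
    then show ?thesis by simp
  qed
  have scale: "q' (smul (of_real r) y) \<le> r * q' y" if r: "0 \<le> r" for r y
  proof (cases "r = 0")
    case True
    have "q' 0 \<le> F 0 0" by (rule le) simp
    then show ?thesis using True sublinear_zero[OF q] by (simp add: F_def)
  next
    case False
    with r have r: "0 < r" by simp
    have "q' (smul (of_real r) y) / r \<le> F y t" if "0 \<le> t" for t
    proof -
      have "q' (smul (of_real r) y) \<le> F (smul (of_real r) y) (r * t)"
        using that r by (intro le) auto
      also have "\<dots> = q (smul (of_real r) (y + smul (of_real t) x)) - r * t * q x"
        by (simp add: F_def scale_right_distrib)
      also have "\<dots> = r * F y t"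
        unfolding sublinear_scale[OF q r] by (simp add: F_def algebra_simps)
      finally show ?thesis using r by (simp add: field_simps)
    qed
    then have "q' (smul (of_real r) y) / r \<le> q' y" by (rule ge)
    then show ?thesis using r by (simp add: field_simps)
  qed
  show thesis
  proof
    show "sublinear smul q'" using add scale by (simp add: sublinear_def)
    show "q' \<le> q" using le[of 0] by (auto simp: le_fun_def F_def)
    show "q' y \<le> q (y + x) - q x" for y using le[of 1 y] by (simp add: F_def)
  qed
qed

text \<open>Zorn's lemma: a chain is bounded below by its pointwise infimum, which is finite because
  every member is at least \<open>- p (- x)\<close> at \<open>x\<close>. The infimum is subadditive
  because the smaller of two members of the chain can serve both arguments.\<close>

lemma ex_minimal_sublinear:
  assumes p: "sublinear smul p"
  obtains q where "sublinear smul q" "q \<le> p" "\<And>q'. sublinear smul q' \<Longrightarrow> q' \<le> q \<Longrightarrow> q' = q"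
proof -
  define A where "A = {q. sublinear smul q \<and> q \<le> p}"
  have "\<exists>m\<in>A. \<forall>a\<in>A. a \<le> m \<longrightarrow> a = m"
  proof (rule predicate_Zorn[of A "\<lambda>a b. b \<le> a"])
    show "partial_order_on A (relation_of (\<lambda>a b. b \<le> a) A)"
      by (rule partial_order_on_relation_ofI) auto
  next
    fix C assume "C \<in> Chains (relation_of (\<lambda>a b. b \<le> a) A)"
    then have CA: "C \<subseteq> A" and tot: "\<And>a b. a \<in> C \<Longrightarrow> b \<in> C \<Longrightarrow> a \<le> b \<or> b \<le> a"
      unfolding Chains_def relation_of_def by auto
    show "\<exists>u\<in>A. \<forall>a\<in>C. u \<le> a"
    proof (cases "C = {}")
      case True
      then show ?thesis using p by (auto simp: A_def)
    next
      case False
      define u where "u = (\<lambda>x. INF q\<in>C. q x)"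
      have "- p (- x) \<le> q x" if "q \<in> C" for q x
      proof -
        have "sublinear smul q" "q (- x) \<le> p (- x)"
          using that CA by (auto simp: A_def le_fun_def)
        then show ?thesis using sublinear_ge_uminus[of q x] by linarith
      qed
      then have bdd: "bdd_below ((\<lambda>q. q x) ` C)" for x
        by (auto intro!: bdd_belowI)
      have le: "u x \<le> q x" if "q \<in> C" for q x
        unfolding u_def by (rule cINF_lower[OF bdd that])
      have ge: "a \<le> u x" if "\<And>q. q \<in> C \<Longrightarrow> a \<le> q x" for a x
        unfolding u_def using that False by (intro cINF_greatest) auto
      have sub: "sublinear smul q" if "q \<in> C" for q using that CA by (auto simp: A_def)
      have 1: "u (x + y) \<le> q1 x + q2 y" if q: "q1 \<in> C" "q2 \<in> C" for x y q1 q2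
        using tot[OF q]
      proof
        assume "q1 \<le> q2"
        then have "q1 y \<le> q2 y" by (simp add: le_fun_def)
        then show ?thesis
          using le[OF q(1), of "x + y"] sublinear_triangle[OF sub[OF q(1)], of x y] by linarith
      next
        assume "q2 \<le> q1"
        then have "q2 x \<le> q1 x" by (simp add: le_fun_def)
        then show ?thesis
          using le[OF q(2), of "x + y"] sublinear_triangle[OF sub[OF q(2)], of x y] by linarith
      qed
      have 2: "u (x + y) \<le> u x + u y" for x y
      proof -
        have "u (x + y) - q2 y \<le> u x" if "q2 \<in> C" for q2
          using that 1 by (intro ge) (simp add: algebra_simps)
        then have "u (x + y) - u x \<le> u y" by (intro ge) (simp add: algebra_simps)
        then show ?thesis by simp
      qed
      have 3: "u (smul (of_real r) x) \<le> r * u x" if r: "0 \<le> r" for r x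
      proof (cases "r = 0")
        case True
        obtain q where "q \<in> C" using False by auto
        then show ?thesis using True le[of q 0] sublinear_zero[OF sub, of q] by simp
      next
        case False
        with r have r: "0 < r" by simp
        have "u (smul (of_real r) x) / r \<le> q x" if "q \<in> C" for q
          using le[OF that, of "smul (of_real r) x"] sublinear_scale[OF sub[OF that] r, of x] r
          by (simp add: field_simps)
        then have "u (smul (of_real r) x) / r \<le> u x" by (rule ge)
        then show ?thesis using r by (simp add: field_simps)
      qed
      have "u \<le> p"
      proof -
        obtain q where "q \<in> C" using False by auto
        then have "u x \<le> p x" for x
          using le[of q x] CA by (auto simp: A_def le_fun_def intro: order_trans)
        then show ?thesis by (simp add: le_fun_def)
      qed
      with 2 3 have "u \<in> A" by (simp add: A_def sublinear_def)
      then show ?thesis using le by (auto simp: le_fun_def)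
    qed
  qed
  then show thesis using that unfolding A_def
    by (metis (mono_tags, lifting) mem_Collect_eq order_trans)
qed

text \<open>Lowering \<open>q\<close> in the direction \<open>x\<close> gives nothing new by minimality, which is the reverse of the
  triangle inequality.\<close>

lemma minimal_sublinear_add:
  assumes q: "sublinear smul q" and min: "\<And>q'. sublinear smul q' \<Longrightarrow> q' \<le> q \<Longrightarrow> q' = q"
  shows "q (x + y) = q x + q y"
proof (rule antisym)
  show "q (x + y) \<le> q x + q y" by (rule sublinear_triangle[OF q])
  obtain q' where "sublinear smul q'" "q' \<le> q" and *: "\<And>y. q' y \<le> q (y + x) - q x"
    using sublinear_lower[OF q] by blast
  then have "q' = q" using min by blast
  then show "q x + q y \<le> q (x + y)" using *[of y] by (simp add: algebra_simps)
qed

text \<open>A minimal sublinear functional is real linear. To force the value \<open>p x\<close> at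
  \<open>x\<close>, the seminorm is first lowered in the direction \<open>x\<close>: every
  \<open>q \<le> p'\<close> then has \<open>q (- x) \<le> - p x\<close>.\<close>

lemma hahn_banach_seminorm:
  assumes p: "seminorm smul p"
  obtains g where "Vector_Spaces.linear smul (*) g" "\<And>z. cmod (g z) \<le> p z" "g x = of_real (p x)"
proof -
  have subp: "sublinear smul p"
    using seminorm_triangle[OF p] seminorm_scale[OF p] by (simp add: sublinear_def)
  obtain p' where p': "sublinear smul p'" "p' \<le> p" "\<And>y. p' y \<le> p (y + x) - p x"
    using sublinear_lower[OF subp] by blast
  obtain q where q: "sublinear smul q" "q \<le> p'"
    and min: "\<And>q'. sublinear smul q' \<Longrightarrow> q' \<le> q \<Longrightarrow> q' = q"
    using ex_minimal_sublinear[OF p'(1)] by blast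
  note add = minimal_sublinear_add[OF q(1) min]
  have q0: "q 0 = 0" by (rule sublinear_zero[OF q(1)])
  have qm: "q (- z) = - q z" for z using add[of z "-z"] q0 by simp
  have real: "q (smul (of_real r) z) = r * q z" for r z
  proof (cases r "0 :: real" rule: linorder_cases)
    case less
    have "q (smul (of_real r) z) = - q (smul (of_real (-r)) z)"
      using qm[of "smul (of_real r) z"] by (simp add: scale_minus_left)
    then show ?thesis using sublinear_scale[OF q(1), of "-r" z] less by simp
  next
    case equal
    then show ?thesis using q0 by simp
  next
    case greater
    then show ?thesis by (rule sublinear_scale[OF q(1)])
  qed
  have le: "q z \<le> p z" for z using q(2) p'(2) by (auto simp: le_fun_def intro: order_trans)
  \<comment> \<open>The unique complex linear functional with real part \<open>q\<close>.\<close>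
  define g where "g = (\<lambda>z. Complex (q z) (- q (smul \<i> z)))"
  have g_add: "g (y + z) = g y + g z" for y z
    by (simp add: g_def complex_eq_iff add scale_right_distrib)
  have g_scale: "g (smul c z) = c * g z" for c z
  proof -
    have e: "q (smul c z) = Re c * q z + Im c * q (smul \<i> z)" for c z
    proof -
      have "smul c z = smul (of_real (Re c)) z + smul (of_real (Im c)) (smul \<i> z)"
        by (simp add: scale_left_distrib[symmetric] complex_eq mult.commute)
      then show ?thesis by (simp only: add real)
    qed
    have ii: "q (smul (\<i> * c) z) = Re c * q (smul \<i> z) - Im c * q z"
      using e[of "\<i> * c" z] by simp
    show ?thesis
      unfolding g_def by (simp add: complex_eq_iff e[of c z] ii)
  qed
  have g_le: "cmod (g z) \<le> p z" for z
  proof (cases "g z = 0")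
    case True
    then show ?thesis using seminorm_nonneg[OF p] by simp
  next
    case False
    define c where "c = of_real (cmod (g z)) / g z"
    have c: "cmod c = 1" using False by (simp add: c_def norm_divide)
    have "g (smul c z) = of_real (cmod (g z))" using False by (simp add: g_scale c_def)
    then have "cmod (g z) = Re (g (smul c z))" by simp
    also have "\<dots> = q (smul c z)" by (simp add: g_def)
    also have "\<dots> \<le> p (smul c z)" by (rule le)
    finally show ?thesis using seminorm_scale[OF p, of c z] c by simp
  qed
  have "p x \<le> q x"
  proof -
    have "q (- x) \<le> p' (- x)" using q(2) by (simp add: le_fun_def)
    also have "\<dots> \<le> p 0 - p x" using p'(3)[of "-x"] by simp
    also have "p 0 = 0" by (rule sublinear_zero[OF subp])
    finally show ?thesis using qm by simp
  qed
  with le[of x] have qx: "Re (g x) = p x" by (simp add: g_def)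
  have "Im (g x) = 0"
  proof -
    have "(Re (g x))\<^sup>2 + (Im (g x))\<^sup>2 = (cmod (g x))\<^sup>2" by (simp add: cmod_power2)
    also have "\<dots> \<le> (p x)\<^sup>2" by (intro power_mono g_le) simp
    finally show ?thesis using qx by simp
  qed
  with qx have "g x = of_real (p x)" by (simp add: complex_eq_iff)
  moreover have "Vector_Spaces.linear smul (*) g"
    using g_add g_scale by (simp add: linear_functional_iff)
  ultimately show thesis using that g_le by blast
qed

end

section \<open>Biorthogonal systems and backward shifts in Frechet spaces\<close>

locale frechet_seminorms = complex_frechet_space smul
  for smul :: "complex \<Rightarrow> 'a::{topological_ab_group_add, t2_space} \<Rightarrow> 'a" +
  fixes p :: "nat \<Rightarrow> 'a \<Rightarrow> real"
  assumes seminorm_p: "seminorm smul (p k)"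
    and continuous_p: "continuous_on UNIV (p k)"
    and p_mono: "j \<le> k \<Longrightarrow> p j x \<le> p k x"
    and p_base: "open U \<Longrightarrow> 0 \<in> U \<Longrightarrow> \<exists>k. \<exists>e>0. {x. p k x < e} \<subseteq> U"
begin

sublocale complex_vector_space smul ..

lemma p_nonneg [simp]: "0 \<le> p k x"
  by (rule seminorm_nonneg[OF seminorm_p])

lemma p_triangle: "p k (x + y) \<le> p k x + p k y"
  by (rule seminorm_triangle[OF seminorm_p])

lemma p_scale [simp]: "p k (smul c x) = cmod c * p k x"
  by (rule seminorm_scale[OF seminorm_p])

lemma p_zero [simp]: "p k 0 = 0"
  using p_scale[of k 0 0] by simp

lemma p_minus [simp]: "p k (- x) = p k x"
  using p_scale[of k "-1" x] by simp

lemma p_commute: "p k (x - y) = p k (y - x)"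
  using p_minus[of k "x - y"] by simp

lemma p_diff_triangle: "p k (x - z) \<le> p k (x - y) + p k (y - z)"
  using p_triangle[of k "x - y" "y - z"] by simp

lemma p_triangle_diff: "p k (x - y) \<le> p k x + p k y"
  using p_triangle[of k x "- y"] by simp

lemma p_sum: "p k (sum f A) \<le> (\<Sum>i\<in>A. p k (f i))"
  by (induction A rule: infinite_finite_induct) (auto intro: order_trans[OF p_triangle])

lemma open_contains_p_ball:
  assumes "open U" "x \<in> U"
  obtains k e where "e > 0" "\<And>y. p k (y - x) < e \<Longrightarrow> y \<in> U"
proof -
  have "open ((\<lambda>z. z + x) -` U)"
    using assms(1) by (intro open_vimage) (auto intro!: continuous_intros)
  moreover have "0 \<in> (\<lambda>z. z + x) -` U" using assms by simp
  ultimately obtain k e where "e > 0" "{x. p k x < e} \<subseteq> (\<lambda>z. z + x) -` U"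
    using p_base by metis
  then have "y \<in> U" if "p k (y - x) < e" for y
    using that by (force simp: subset_iff dest: spec[of _ "y - x"])
  with \<open>e > 0\<close> show thesis by (rule that)
qed

lemma open_p_ball: "open {y. p k (y - x) < e}"
proof -
  have "continuous_on UNIV (\<lambda>y. p k (y - x))"
    by (intro continuous_on_compose2[OF continuous_p[of k]] continuous_intros) auto
  then show ?thesis
    by (simp add: open_Collect_less)
qed

lemma tendsto_p_iff: "(f \<longlongrightarrow> l) F \<longleftrightarrow> (\<forall>k. ((\<lambda>i. p k (f i - l)) \<longlongrightarrow> 0) F)"
proof
  assume f: "(f \<longlongrightarrow> l) F"
  have "((\<lambda>i. p k (f i - l)) \<longlongrightarrow> p k (l - l)) F" for k
    by (rule continuous_on_tendsto_compose[OF continuous_p tendsto_diff[OF f tendsto_const]]) auto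
  then show "\<forall>k. ((\<lambda>i. p k (f i - l)) \<longlongrightarrow> 0) F" by simp
next
  assume *: "\<forall>k. ((\<lambda>i. p k (f i - l)) \<longlongrightarrow> 0) F"
  show "(f \<longlongrightarrow> l) F"
  proof (rule topological_tendstoI)
    fix S assume "open S" "l \<in> S"
    then obtain k e where e: "e > 0" "\<And>y. p k (y - l) < e \<Longrightarrow> y \<in> S"
      using open_contains_p_ball by metis
    have "\<forall>\<^sub>F i in F. p k (f i - l) < e"
      using order_tendstoD(2)[OF *[rule_format, of k] e(1)] .
    then show "\<forall>\<^sub>F i in F. f i \<in> S" by eventually_elim (rule e(2))
  qed
qed

lemma p_Cauchy_convergent:
  assumes "\<And>k e. e > 0 \<Longrightarrow> \<exists>N. \<forall>i\<ge>N. \<forall>j\<ge>N. p k (s i - s j) < e"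
  obtains l where "s \<longlonglongrightarrow> l"
proof -
  have "\<exists>l. s \<longlonglongrightarrow> l"
  proof (rule complete)
    fix U :: "'a set" assume "open U" "0 \<in> U"
    then obtain k e where "e > 0" "{x. p k x < e} \<subseteq> U" using p_base by metis
    then show "\<exists>N. \<forall>i\<ge>N. \<forall>j\<ge>N. s i - s j \<in> U" using assms[of e k] by blast
  qed
  then show thesis using that by blast
qed

lemma p_separates: "x \<noteq> 0 \<Longrightarrow> \<exists>k. p k x > 0"
proof -
  assume "x \<noteq> 0"
  then have "open (- {x})" "0 \<in> - {x}" by auto
  then obtain k e where "e > 0" "{y. p k y < e} \<subseteq> - {x}" using p_base by metis
  then have "\<not> p k x < e" by auto
  with \<open>e > 0\<close> show ?thesis by (intro exI[of _ k]) linarith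
qed

lemma tendsto_smul:
  assumes "(f \<longlongrightarrow> c) F" "(g \<longlongrightarrow> x) F"
  shows "((\<lambda>i. smul (f i) (g i)) \<longlongrightarrow> smul c x) F"
  using continuous_on_tendsto_compose[OF continuous_scale, of "\<lambda>i. (f i, g i)" "(c, x)" F]
    assms by (auto intro: tendsto_Pair)

lemma continuous_on_smul:
  assumes "continuous_on S f" "continuous_on S g"
  shows "continuous_on S (\<lambda>x. smul (f x) (g x))"
  using assms unfolding continuous_on_def by (auto intro: tendsto_smul)

lemma linear_functional_continuous:
  assumes "Vector_Spaces.linear smul (*) f" and le: "\<And>x. cmod (f x) \<le> C * p k x"
  shows "continuous_on UNIV f"
proof -
  have add: "f (x + y) = f x + f y" for x y using assms(1) by (simp add: linear_functional_iff)
  have diff: "f (x - y) = f x - f y" for x y using add[of "x - y" y] by simp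
  have "(f \<longlongrightarrow> f x) (at x)" for x
  proof -
    have "((\<lambda>y. p k (y - x)) \<longlongrightarrow> 0) (at x)"
      using tendsto_ident_at[of x UNIV] unfolding tendsto_p_iff by blast
    then have lim: "((\<lambda>y. C * p k (y - x)) \<longlongrightarrow> 0) (at x)"
      using tendsto_mult_right_zero by blast
    have "((\<lambda>y. f y - f x) \<longlongrightarrow> 0) (at x)"
      by (rule Lim_null_comparison[OF _ lim]) (simp add: diff[symmetric] le)
    then show ?thesis by (simp add: LIM_zero_iff)
  qed
  then show ?thesis by (simp add: continuous_on_def)
qed

lemma linear_continuous:
  assumes "Vector_Spaces.linear smul smul T" and le: "\<And>j. \<exists>k C. \<forall>x. p j (T x) \<le> C * p k x"
  shows "continuous_on UNIV T"
proof -
  have add: "T (x + y) = T x + T y" for x y using assms(1) by (simp add: linear_self_iff)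
  have diff: "T (x - y) = T x - T y" for x y using add[of "x - y" y] by (simp add: algebra_simps)
  have "(T \<longlongrightarrow> T x) (at x)" for x
    unfolding tendsto_p_iff
  proof
    fix j
    obtain k C where C: "\<And>x. p j (T x) \<le> C * p k x" using le by blast
    have "((\<lambda>y. p k (y - x)) \<longlongrightarrow> 0) (at x)"
      using tendsto_ident_at[of x UNIV] unfolding tendsto_p_iff by blast
    then have lim: "((\<lambda>y. C * p k (y - x)) \<longlongrightarrow> 0) (at x)"
      using tendsto_mult_right_zero by blast
    show "((\<lambda>y. p j (T y - T x)) \<longlongrightarrow> 0) (at x)"
      by (rule Lim_null_comparison[OF _ lim]) (simp add: diff[symmetric] C)
  qed
  then show ?thesis by (simp add: continuous_on_def)
qed

text \<open>Each point of a countable dense set is repeated infinitely often, so good approximations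
  occur beyond every \<open>N\<close>. The biorthogonal construction needs this, since its
  \<open>n\<close>-th step controls an error only in the seminorm \<open>p n\<close>.\<close>

lemma ex_dense_sequence:
  assumes "separable_space (euclidean :: 'a topology)"
  obtains y :: "nat \<Rightarrow> 'a"
  where "\<And>x k e N. e > 0 \<Longrightarrow> \<exists>n\<ge>N. p k (y n - x) < e"
proof -
  obtain C :: "'a set" where C: "countable C" "closure C = UNIV"
    using assms unfolding separable_space_def by auto
  then have "C \<noteq> {}" by auto
  with C(1) obtain z :: "nat \<Rightarrow> 'a" where z: "range z = C"
    by (metis range_from_nat_into)
  define y where "y = z \<circ> fst \<circ> prod_decode"
  have "\<exists>n\<ge>N. p k (y n - x) < e" if "e > 0" for x k e N
  proof -
    have "x \<in> closure C" using C by simp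
    moreover have "open {y. p k (y - x) < e}" "x \<in> {y. p k (y - x) < e}"
      using that open_p_ball by auto
    ultimately obtain c where "c \<in> C" "p k (c - x) < e"
      by (metis (no_types, lifting) closure_iff_nhds_not_empty disjoint_iff mem_Collect_eq order_refl)
    then obtain m where m: "p k (z m - x) < e" using z by auto
    have "y (prod_encode (m, N)) = z m" by (simp add: y_def)
    moreover have "N \<le> prod_encode (m, N)" by (rule le_prod_encode_2)
    ultimately show ?thesis using m by metis
  qed
  then show thesis using that by blast
qed

section \<open>Projections of finite corank and the biorthogonal system\<close>

definition p_bounded :: "('a \<Rightarrow> 'a) \<Rightarrow> bool" where
  "p_bounded R \<longleftrightarrow> (\<forall>j. \<exists>C\<ge>0. \<forall>v. p j (R v) \<le> C * p j v)"

text \<open>The state of the recursive construction: the range of \<open>R\<close> is what remains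
  after finitely many vectors have been split off. \<open>p_bounded\<close> has the same index on
  both sides, so that composing a functional with \<open>R\<close> does not change the seminorm that
  dominates it.\<close>

definition projection_with_small_kernel :: "('a \<Rightarrow> 'a) \<Rightarrow> bool" where
  "projection_with_small_kernel R \<longleftrightarrow>
     Vector_Spaces.linear smul smul R \<and> (\<forall>v. R (R v) = R v) \<and>
     (\<exists>F. finite F \<and> (\<forall>v. v - R v \<in> span F)) \<and> p_bounded R"

lemma infinite_dim_nonzero:
  assumes "\<not> (\<exists>B. finite_dimensional_vector_space smul B)" "finite F" "\<And>v. v - R v \<in> span F"
  shows "\<exists>v. R v \<noteq> 0"
proof (rule ccontr)
  assume "\<not> ?thesis"
  with assms(3) have F: "v \<in> span F" for v by (metis diff_zero)
  obtain B where "B \<subseteq> F" "independent B" "F \<subseteq> span B"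
    using maximal_independent_subset by blast
  then have "finite B" "span B = UNIV"
    using F assms(2) by (auto intro: finite_subset) (metis in_mono span_minimal subspace_span)
  with \<open>independent B\<close> have "finite_dimensional_vector_space smul B"
    by unfold_locales auto
  with assms(1) show False by blast
qed

text \<open>\<open>\<kappa>\<close> is the first index whose seminorm does not vanish on the range
  of \<open>R\<close>. A vector \<open>v\<close> near \<open>y\<close> with
  \<open>p \<kappa> (R v) \<noteq> 0\<close> exists, and a Hahn-Banach functional for
  \<open>p \<kappa>\<close> at \<open>R v\<close>, composed with \<open>R\<close>, splits off the
  line through \<open>R v\<close>.\<close>

lemma biorthogonal_step:
  assumes inf: "\<not> (\<exists>B. finite_dimensional_vector_space smul B)"
    and R: "projection_with_small_kernel R" and e: "e > 0"
  obtains x f \<kappa> C v R' where "projection_with_small_kernel R'"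
    "Vector_Spaces.linear smul (*) f" "x = R v" "p n (v - y) < e" "f x = 1" "\<And>z. f (R z) = f z"
    "R' = (\<lambda>z. R z - smul (f z) x)" "\<kappa> = (LEAST k. \<exists>v. p k (R v) \<noteq> 0)"
    "\<exists>v. p \<kappa> (R v) \<noteq> 0" "\<And>z. cmod (f z) \<le> C * p \<kappa> z"
proof -
  have linR: "R (a + b) = R a + R b" "R (smul c a) = smul c (R a)" for a b c
    using R by (auto simp: projection_with_small_kernel_def linear_self_iff)
  have idem: "R (R a) = R a" for a
    using R by (auto simp: projection_with_small_kernel_def)
  obtain F where F: "finite F" "\<And>v. v - R v \<in> span F"
    using R by (auto simp: projection_with_small_kernel_def)
  have bddR: "\<exists>C\<ge>0. \<forall>v. p j (R v) \<le> C * p j v" for j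
    using R by (auto simp: projection_with_small_kernel_def p_bounded_def)
  obtain z0 where "R z0 \<noteq> 0" using infinite_dim_nonzero[OF inf F] by blast
  then have ex: "\<exists>k v. p k (R v) \<noteq> 0" using p_separates[of "R z0"] by (metis less_irrefl)
  define \<kappa> where "\<kappa> = (LEAST k. \<exists>v. p k (R v) \<noteq> 0)"
  have \<kappa>: "\<exists>v. p \<kappa> (R v) \<noteq> 0" unfolding \<kappa>_def by (rule LeastI_ex[OF ex])
  have less: "p j (R v) = 0" if "j < \<kappa>" for j v
    using not_less_Least[OF that[unfolded \<kappa>_def]] by blast
  obtain h where h: "p \<kappa> (R h) > 0" using \<kappa> by (metis p_nonneg less_eq_real_def)
  have "\<exists>v. p n (v - y) < e \<and> p \<kappa> (R v) > 0"
  proof (cases "p \<kappa> (R y) = 0")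
    case False
    then have "p \<kappa> (R y) > 0" using p_nonneg[of \<kappa> "R y"] by linarith
    then show ?thesis using e by (intro exI[of _ y]) simp
  next
    case True
    \<comment> \<open>If \<open>p \<kappa>\<close> does not see \<open>R y\<close>, then
      \<open>y\<close> is moved by a multiple of \<open>h\<close> that costs less than
      \<open>e\<close> in \<open>p n\<close>.\<close>
    define t where "t = e / (2 * (1 + p n h))"
    have pos: "1 + p n h > 0" using p_nonneg[of n h] by linarith
    then have t: "t > 0" using e by (simp add: t_def)
    have "t * p n h < e"
    proof -
      have "t * p n h \<le> t * (1 + p n h)" using t by simp
      also have "\<dots> = e / 2" using pos by (simp add: t_def divide_simps)
      finally show ?thesis using e by simp
    qed
    moreover have "p \<kappa> (R (y + smul (of_real t) h)) \<ge> t * p \<kappa> (R h) - p \<kappa> (R y)"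
      using p_triangle_diff[of \<kappa> "R (y + smul (of_real t) h)" "R y"] t by (simp add: linR)
    ultimately show ?thesis using True t h
      by (intro exI[of _ "y + smul (of_real t) h"]) (auto intro: less_le_trans[of 0 "t * p \<kappa> (R h)"])
  qed
  then obtain v where v: "p n (v - y) < e" "p \<kappa> (R v) > 0" by blast
  define x where "x = R v"
  obtain g where g: "Vector_Spaces.linear smul (*) g" "\<And>z. cmod (g z) \<le> p \<kappa> z"
    "g x = of_real (p \<kappa> x)"
    using hahn_banach_seminorm[OF seminorm_p] by blast
  \<comment> \<open>Dividing by \<open>p \<kappa> x\<close> gives \<open>f x = 1\<close>; composing
    with \<open>R\<close> gives \<open>f (R z) = f z\<close>.\<close>
  define f where "f = (\<lambda>z. g (R z) / of_real (p \<kappa> x))"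
  have linf: "f (a + b) = f a + f b" "f (smul c a) = c * f a" for a b c
    using g(1) by (simp_all add: f_def linR linear_functional_iff add_divide_distrib)
  have fR: "f (R z) = f z" for z by (simp add: f_def idem)
  have fx: "f x = 1" using v g(3) by (simp add: f_def x_def idem)
  have Rx: "R x = x" by (simp add: x_def idem)
  obtain C0 where C0: "C0 \<ge> 0" "\<And>v. p \<kappa> (R v) \<le> C0 * p \<kappa> v" using bddR by blast
  have f_le: "cmod (f z) \<le> p \<kappa> (R z) / p \<kappa> x" for z
    using v g(2)[of "R z"] by (simp add: f_def norm_divide x_def divide_right_mono)
  define R' where "R' = (\<lambda>z. R z - smul (f z) x)"
  have "R' (R' z) = R' z" for z
  proof -
    have Rd: "R (a - b) = R a - R b" for a b using linR(1)[of "a - b" b] by (simp add: algebra_simps)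
    have fd: "f (a - b) = f a - f b" for a b using linf(1)[of "a - b" b] by (simp add: algebra_simps)
    show ?thesis by (simp add: R'_def Rd fd linR linf idem fR fx Rx)
  qed
  moreover have "Vector_Spaces.linear smul smul R'"
    by (simp add: linear_self_iff R'_def linR linf scale_left_distrib scale_right_diff_distrib)
  moreover have "\<exists>F. finite F \<and> (\<forall>v. v - R' v \<in> span F)"
  proof (intro exI conjI allI)
    show "finite (insert x F)" using F by simp
    show "z - R' z \<in> span (insert x F)" for z
    proof -
      have "z - R' z = (z - R z) + smul (f z) x" by (simp add: R'_def)
      also have "\<dots> \<in> span (insert x F)"
      proof (rule span_add)
        show "z - R z \<in> span (insert x F)" using F(2)[of z] span_mono[of F "insert x F"] by blast
        show "smul (f z) x \<in> span (insert x F)" by (intro span_scale span_base) simp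
      qed
      finally show ?thesis .
    qed
  qed
  moreover have "p_bounded R'"
    unfolding p_bounded_def
  proof
    fix j
    obtain C where C: "C \<ge> 0" "\<And>v. p j (R v) \<le> C * p j v" using bddR by blast
    \<comment> \<open>Below \<open>\<kappa>\<close> the seminorm \<open>p j\<close> vanishes at
      \<open>x\<close>, so the correction is invisible; from \<open>\<kappa>\<close> on,
      \<open>p \<kappa> \<le> p j\<close> bounds the coefficient \<open>f z\<close> by
      \<open>p j\<close> itself.\<close>
    show "\<exists>C\<ge>0. \<forall>v. p j (R' v) \<le> C * p j v"
    proof (cases "j < \<kappa>")
      case True
      have "p j (R' z) \<le> C * p j z" for z
      proof -
        have "p j (R' z) \<le> p j (R z) + cmod (f z) * p j x"
          unfolding R'_def using p_triangle_diff[of j "R z" "smul (f z) x"] by simp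
        also have "p j x = 0" unfolding x_def by (rule less[OF True])
        finally show ?thesis using C(2)[of z] by simp
      qed
      then show ?thesis using C(1) by blast
    next
      case False
      define r where "r = p j x / p \<kappa> x"
      have r: "r \<ge> 0" by (simp add: r_def)
      have "p j (R' z) \<le> (C + C * r) * p j z" for z
      proof -
        have "p j (R' z) \<le> p j (R z) + cmod (f z) * p j x"
          unfolding R'_def using p_triangle_diff[of j "R z" "smul (f z) x"] by simp
        also have "cmod (f z) * p j x \<le> p \<kappa> (R z) / p \<kappa> x * p j x"
          by (intro mult_right_mono f_le) simp
        also have "\<dots> = p \<kappa> (R z) * r" by (simp add: r_def)
        also have "\<dots> \<le> p j (R z) * r"
          using False r by (intro mult_right_mono p_mono) auto
        also have "\<dots> \<le> (C * p j z) * r"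
          using r by (intro mult_right_mono C)
        finally show ?thesis using C(2)[of z] by (simp add: algebra_simps)
      qed
      moreover have "0 \<le> C + C * r" using C(1) r by simp
      ultimately show ?thesis by blast
    qed
  qed
  ultimately have proj: "projection_with_small_kernel R'"
    by (simp add: projection_with_small_kernel_def)
  have f_bound: "cmod (f z) \<le> C0 / p \<kappa> x * p \<kappa> z" for z
  proof -
    have "cmod (f z) \<le> p \<kappa> (R z) / p \<kappa> x" by (rule f_le)
    also have "\<dots> \<le> (C0 * p \<kappa> z) / p \<kappa> x" by (intro divide_right_mono C0) simp
    finally show ?thesis by simp
  qed
  have "Vector_Spaces.linear smul (*) f"
    by (simp add: linear_functional_iff linf)
  note facts = proj this x_def v(1) fx fR R'_def \<kappa>_def \<kappa> f_bound
  show thesis by (rule that) (fact facts)+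
qed

text \<open>The functional \<open>f n\<close> is controlled by \<open>p (\<kappa> n)\<close>, and \<open>x n\<close> is invisible to the seminorms before
  \<open>\<kappa> n\<close>.  If \<open>\<kappa>\<close> is bounded, one seminorm dominates almost all \<open>f n\<close>; if it is not (as in the space of
  all sequences), every seminorm vanishes at almost all \<open>x n\<close>.  Either way small weights make
  \<open>\<Sum>n. f (Suc n) z x n\<close> converge to a continuous operator.\<close>

lemma biorthogonal_system:
  assumes inf: "\<not> (\<exists>B. finite_dimensional_vector_space smul B)"
    and sep: "separable_space (euclidean :: 'a topology)"
  obtains x :: "nat \<Rightarrow> 'a" and f :: "nat \<Rightarrow> 'a \<Rightarrow> complex" and \<kappa> :: "nat \<Rightarrow> nat" and C :: "nat \<Rightarrow> real"
  where "\<And>n. Vector_Spaces.linear smul (*) (f n)"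
    "\<And>n m. f n (x m) = (if n = m then 1 else 0)"
    "\<And>n z. cmod (f n z) \<le> C n * p (\<kappa> n) z"
    "mono \<kappa>" "\<And>j n. j < \<kappa> n \<Longrightarrow> p j (x n) = 0"
    "\<And>y k e. e > 0 \<Longrightarrow> \<exists>v\<in>span (range x). p k (v - y) < e"
proof -
  obtain y :: "nat \<Rightarrow> 'a" where y: "\<And>x k e N. e > 0 \<Longrightarrow> \<exists>n\<ge>N. p k (y n - x) < e"
    using ex_dense_sequence[OF sep] by blast
  define \<Phi> where "\<Phi> = (\<lambda>n R R' x f \<kappa> C v.
    Vector_Spaces.linear smul (*) f \<and> x = R v \<and> p n (v - y n) < 1 / real (Suc n) \<and> f x = 1 \<and>
    (\<forall>z. f (R z) = f z) \<and> R' = (\<lambda>z. R z - smul (f z) x) \<and>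
    \<kappa> = (LEAST k. \<exists>v. p k (R v) \<noteq> 0) \<and> (\<exists>v. p \<kappa> (R v) \<noteq> 0) \<and> (\<forall>z. cmod (f z) \<le> C * p \<kappa> z))"
  \<comment> \<open>The clause for \<open>n = 0\<close> records that the recursion starts at the
    identity, which the choice principle would otherwise forget.\<close>
  define \<Psi> where "\<Psi> = (\<lambda>(n::nat) R. projection_with_small_kernel R \<and> (n = 0 \<longrightarrow> R = (\<lambda>v. v)))"
  define \<Theta> where "\<Theta> = (\<lambda>n R R'. \<exists>x f \<kappa> C v. \<Phi> n R R' x f \<kappa> C v)"
  have "\<exists>R. \<forall>n. \<Psi> n (R n) \<and> \<Theta> n (R n) (R (Suc n))"
  proof (rule dependent_nat_choice)
    have "p_bounded (\<lambda>v. v)" unfolding p_bounded_def by (intro allI exI[of _ 1]) simp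
    then have "projection_with_small_kernel (\<lambda>v. v)"
      by (auto simp: projection_with_small_kernel_def linear_self_iff)
    then show "\<exists>R. \<Psi> 0 R" unfolding \<Psi>_def by blast
  next
    fix R and n :: nat assume "\<Psi> n R"
    then have PR: "projection_with_small_kernel R" by (simp add: \<Psi>_def)
    have e: "1 / real (Suc n) > 0" by simp
    obtain x f \<kappa> C v R' where "projection_with_small_kernel R'"
      "Vector_Spaces.linear smul (*) f" "x = R v" "p n (v - y n) < 1 / real (Suc n)" "f x = 1"
      "\<And>z. f (R z) = f z" "R' = (\<lambda>z. R z - smul (f z) x)"
      "\<kappa> = (LEAST k. \<exists>v. p k (R v) \<noteq> 0)" "\<exists>v. p \<kappa> (R v) \<noteq> 0" "\<And>z. cmod (f z) \<le> C * p \<kappa> z"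
      by (rule biorthogonal_step[OF inf PR e, of n "y n"]) (rule that)
    then have "\<Psi> (Suc n) R'" "\<Phi> n R R' x f \<kappa> C v"
      unfolding \<Phi>_def \<Psi>_def by blast+
    then show "\<exists>R'. \<Psi> (Suc n) R' \<and> \<Theta> n R R'" unfolding \<Theta>_def by blast
  qed
  then obtain R where \<Psi>: "\<And>n. \<Psi> n (R n)" and \<Theta>: "\<And>n. \<Theta> n (R n) (R (Suc n))" by blast
  have R: "projection_with_small_kernel (R n)" "R 0 = (\<lambda>v. v)" for n
    using \<Psi>[of n] \<Psi>[of 0] by (simp_all add: \<Psi>_def)
  have "\<forall>n. \<exists>x f \<kappa> C v. \<Phi> n (R n) (R (Suc n)) x f \<kappa> C v" using \<Theta> by (simp add: \<Theta>_def)
  then obtain x f \<kappa> C v where \<Phi>: "\<And>n. \<Phi> n (R n) (R (Suc n)) (x n) (f n) (\<kappa> n) (C n) (v n)"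
    unfolding choice_iff by blast
  have linf: "Vector_Spaces.linear smul (*) (f n)" and xv: "x n = R n (v n)"
    and vy: "p n (v n - y n) < 1 / real (Suc n)" and fx: "f n (x n) = 1"
    and fR: "f n (R n z) = f n z" and RS: "R (Suc n) = (\<lambda>z. R n z - smul (f n z) (x n))"
    and \<kappa>: "\<kappa> n = (LEAST k. \<exists>v. p k (R n v) \<noteq> 0)" and ex\<kappa>: "\<exists>v. p (\<kappa> n) (R n v) \<noteq> 0"
    and fC: "cmod (f n z) \<le> C n * p (\<kappa> n) z" for n z
    using \<Phi>[of n] unfolding \<Phi>_def by blast+
  have linR: "R n (a + b) = R n a + R n b" "R n (smul c a) = smul c (R n a)" for n a b c
    using R(1)[of n] by (auto simp: projection_with_small_kernel_def linear_self_iff)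
  have linfR: "f n (a + b) = f n a + f n b" "f n (smul c a) = c * f n a" for n a b c
    using linf[of n] by (auto simp: linear_functional_iff)
  have Rd: "R n (a - b) = R n a - R n b" for n a b
    using linR(1)[of n "a - b" b] by (simp add: algebra_simps)
  have fd: "f n (a - b) = f n a - f n b" for n a b
    using linfR(1)[of n "a - b" b] by (simp add: algebra_simps)
  have idem: "R n (R n z) = R n z" for n z
    using R(1)[of n] by (auto simp: projection_with_small_kernel_def)
  have Rx: "R n (x n) = x n" for n by (simp add: xv idem)
  have RRS: "R n (R (Suc n) z) = R (Suc n) z" for n z
    by (simp add: RS Rd idem linR Rx)
  have RSR: "R (Suc n) (R n z) = R (Suc n) z" for n z
    by (simp add: RS idem fR)
  \<comment> \<open>The projections commute and their ranges decrease: composing two of them in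
    either order gives the later one.\<close>
  have Rge: "R n (R m z) = R m z \<and> R m (R n z) = R m z" if "n \<le> m" for n m z
    using that
  proof (induction m arbitrary: z rule: dec_induct)
    case base
    then show ?case by (simp add: idem)
  next
    case (step m)
    have "R n (R (Suc m) z) = R n (R m (R (Suc m) z))" by (simp only: RRS)
    also have "\<dots> = R (Suc m) z" using step.IH[of "R (Suc m) z"] by (simp add: RRS)
    finally have 1: "R n (R (Suc m) z) = R (Suc m) z" .
    have "R (Suc m) (R n z) = R (Suc m) (R m (R n z))" by (simp only: RSR)
    also have "\<dots> = R (Suc m) z" using step.IH[of z] RSR[of m z] by simp
    finally show ?case using 1 by simp
  qed
  have RSx: "R (Suc n) (x n) = 0" for n
    by (simp add: RS Rx fx)
  have fRS: "f n (R (Suc n) z) = 0" for n z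
    by (simp add: RS fd linfR fR fx)
  have f0: "f n 0 = 0" for n using fd[of n 0 0] by simp
  have R0: "R n 0 = 0" for n using Rd[of n 0 0] by simp
  \<comment> \<open>For \<open>n < m\<close> the vector \<open>x m\<close> lies in the range of
    \<open>R (Suc n)\<close>, on which \<open>f n\<close> vanishes. For \<open>m < n\<close> it is
    killed by \<open>R (Suc m)\<close>, hence by \<open>R n\<close>, through which
    \<open>f n\<close> factors.\<close>
  have biorth: "f n (x m) = (if n = m then 1 else 0)" for n m
  proof (cases n m rule: linorder_cases)
    case less
    have "x m = R (Suc n) (x m)" using Rge[of "Suc n" m "v m"] less by (simp add: xv)
    then show ?thesis using fRS[of n "x m"] less by simp
  next
    case equal
    then show ?thesis by (simp add: fx)
  next
    case greater
    have "f n (x m) = f n (R n (R (Suc m) (x m)))"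
      using Rge[of "Suc m" n "x m"] greater by (simp add: fR)
    also have "\<dots> = 0" by (simp only: RSx R0 f0)
    finally show ?thesis using greater by simp
  qed
  have "\<kappa> n \<le> \<kappa> (Suc n)" for n
  proof -
    obtain w where "p (\<kappa> (Suc n)) (R (Suc n) w) \<noteq> 0" using ex\<kappa> by blast
    then have "\<exists>v. p (\<kappa> (Suc n)) (R n v) \<noteq> 0" using RRS by metis
    then show ?thesis unfolding \<kappa>[of n] by (rule Least_le)
  qed
  then have mono: "mono \<kappa>" by (simp add: mono_iff_le_Suc)
  have zero: "p j (x n) = 0" if "j < \<kappa> n" for j n
    using not_less_Least[OF that[unfolded \<kappa>]] xv by metis
  have mem: "z - R n z \<in> span (range x)" for n z
  proof (induction n)
    case 0
    then show ?case by (simp add: R span_zero)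
  next
    case (Suc n)
    have "z - R (Suc n) z = (z - R n z) + smul (f n z) (x n)" by (simp add: RS)
    also have "\<dots> \<in> span (range x)" using Suc by (intro span_add span_scale) (auto intro: span_base)
    finally show ?case .
  qed
  have "v n \<in> span (range x)" for n
  proof -
    have "v n = (v n - R n (v n)) + x n" by (simp add: xv)
    also have "\<dots> \<in> span (range x)" using mem by (intro span_add) (auto intro: span_base)
    finally show ?thesis .
  qed
  moreover have "\<exists>n. p k (v n - z) < e" if e: "e > 0" for z k and e :: real
  proof -
    obtain N where N: "inverse (real (Suc N)) < e / 2"
      using reals_Archimedean[of "e / 2"] e by auto
    obtain n where n: "n \<ge> max N k" "p k (y n - z) < e / 2"
      using y[of "e / 2"] e by (metis half_gt_zero)
    have "p k (v n - z) \<le> p k (v n - y n) + p k (y n - z)" by (rule p_diff_triangle)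
    also have "p k (v n - y n) \<le> p n (v n - y n)" using n by (intro p_mono) simp
    also have "\<dots> < 1 / real (Suc n)" by (rule vy)
    also have "\<dots> \<le> 1 / real (Suc N)" using n by (simp add: field_simps)
    finally show ?thesis using N n(2) by (intro exI[of _ n]) (simp add: inverse_eq_divide)
  qed
  ultimately have "\<exists>v\<in>span (range x). p k (v - z) < e" if "e > 0" for z k and e :: real
    using that by blast
  note D = this
  show thesis by (rule that) (fact linf biorth fC mono zero D)+
qed

lemma backward_shift_exists:
  assumes inf: "\<not> (\<exists>B. finite_dimensional_vector_space smul B)"
    and sep: "separable_space (euclidean :: 'a topology)"
  obtains e :: "nat \<Rightarrow> 'a" and \<alpha> :: "'a \<Rightarrow> complex" and B :: "'a \<Rightarrow> 'a"
  where "Vector_Spaces.linear smul (*) \<alpha>" "continuous_on UNIV \<alpha>"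
    "Vector_Spaces.linear smul smul B" "continuous_on UNIV B"
    "\<And>n. \<alpha> (e n) = (if n = 0 then 1 else 0)" "B (e 0) = 0" "\<And>n. B (e (Suc n)) = e n"
    "\<And>y k \<epsilon>. \<epsilon> > 0 \<Longrightarrow> \<exists>v\<in>span (range e). p k (v - y) < \<epsilon>"
proof (rule biorthogonal_system[OF inf sep])
  fix x :: "nat \<Rightarrow> 'a" and f :: "nat \<Rightarrow> 'a \<Rightarrow> complex" and \<kappa> :: "nat \<Rightarrow> nat" and C :: "nat \<Rightarrow> real"
  assume linf: "\<And>n. Vector_Spaces.linear smul (*) (f n)"
    and biorth: "\<And>n m. f n (x m) = (if n = m then 1 else 0)"
    and fC: "\<And>n z. cmod (f n z) \<le> C n * p (\<kappa> n) z"
    and mono: "mono \<kappa>" and zero: "\<And>j n. j < \<kappa> n \<Longrightarrow> p j (x n) = 0"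
    and dense: "\<And>y k e. e > 0 \<Longrightarrow> \<exists>v\<in>span (range x). p k (v - y) < e"
  have linfR: "f n (a + b) = f n a + f n b" "f n (smul c a) = c * f n a" for n a b c
    using linf[of n] by (auto simp: linear_functional_iff)
  \<comment> \<open>The \<open>n\<close>-th term of the shift carries the ratio
    \<open>\<mu> n / \<mu> (Suc n)\<close>. By this recursion the ratio cancels the constant of
    \<open>f (Suc n)\<close> and the size \<open>p n (x n)\<close>, which dominates
    \<open>p j (x n)\<close> for \<open>j \<le> n\<close>, and leaves a factor
    \<open>(1/2) ^ n\<close>.\<close>
  define \<mu> where "\<mu> = rec_nat 1 (\<lambda>n m. m * 2 ^ n * (1 + \<bar>C (Suc n)\<bar>) * (1 + p n (x n)))"
  have \<mu>0: "\<mu> 0 = (1::real)"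
    and \<mu>S: "\<mu> (Suc n) = \<mu> n * 2 ^ n * (1 + \<bar>C (Suc n)\<bar>) * (1 + p n (x n))" for n
    by (simp_all add: \<mu>_def)
  have pos1: "1 + p n (x n) > 0" "1 + \<bar>C n\<bar> > 0" for n
    using p_nonneg[of n "x n"] by linarith+
  have \<mu>pos: "\<mu> n > 0" for n
    by (induction n) (simp_all add: \<mu>0 \<mu>S pos1)
  define e where "e = (\<lambda>n. smul (of_real (\<mu> n)) (x n))"
  define \<phi> where "\<phi> = (\<lambda>n z. f n z / of_real (\<mu> n))"
  have lin\<phi>: "\<phi> n (a + b) = \<phi> n a + \<phi> n b" "\<phi> n (smul c a) = c * \<phi> n a" for n a b c
    by (simp_all add: \<phi>_def linfR add_divide_distrib)
  have \<phi>e: "\<phi> n (e m) = (if n = m then 1 else 0)" for n m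
    using \<mu>pos[of n] \<mu>pos[of m] by (simp add: \<phi>_def e_def linfR biorth)
  define tm where "tm = (\<lambda>n z. smul (\<phi> (Suc n) z) (e n))"
  have ptm: "p j (tm n z) = cmod (f (Suc n) z) / \<mu> (Suc n) * (\<mu> n * p j (x n))" for j n z
    using \<mu>pos[of n] \<mu>pos[of "Suc n"] by (simp add: tm_def \<phi>_def e_def norm_divide norm_mult)
  have ptm_general: "p j (tm n z) \<le> (\<bar>C (Suc n)\<bar> / \<mu> (Suc n) * (\<mu> n * p j (x n))) * p (\<kappa> (Suc n)) z"
    for j n z
  proof -
    have "cmod (f (Suc n) z) \<le> \<bar>C (Suc n)\<bar> * p (\<kappa> (Suc n)) z"
      by (rule order_trans[OF fC]) (intro mult_right_mono, auto)
    then have "p j (tm n z) \<le> (\<bar>C (Suc n)\<bar> * p (\<kappa> (Suc n)) z) / \<mu> (Suc n) * (\<mu> n * p j (x n))"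
      unfolding ptm using \<mu>pos[of n] \<mu>pos[of "Suc n"]
      by (intro mult_right_mono divide_right_mono) auto
    then show ?thesis by (simp add: mult_ac)
  qed
  have ptm_small: "p j (tm n z) \<le> (1/2) ^ n * p (\<kappa> (Suc n)) z" if "j \<le> n" for j n z
  proof -
    have "\<bar>C (Suc n)\<bar> / \<mu> (Suc n) * (\<mu> n * p j (x n))
        = (\<bar>C (Suc n)\<bar> / (1 + \<bar>C (Suc n)\<bar>)) * (p j (x n) / (1 + p n (x n))) * (1/2) ^ n"
    proof -
      have "c / (m * t * a * b) * (m * q) = (c / a) * (q / b) * (1 / t)"
        if "m > 0" "t > 0" "a > 0" "b > 0" for c m t a b q :: real
        using that by (simp add: divide_simps)
      from this[OF \<mu>pos[of n] _ pos1(2)[of "Suc n"] pos1(1)[of n], of "2 ^ n"]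
      show ?thesis by (simp add: \<mu>S power_one_over)
    qed
    also have "\<dots> \<le> 1 * 1 * (1/2) ^ n"
    proof (intro mult_right_mono mult_mono)
      have "p j (x n) \<le> p n (x n)" by (rule p_mono[OF that])
      then show "p j (x n) / (1 + p n (x n)) \<le> 1" using pos1[of n] by simp
    qed (use pos1[of n] in auto)
    finally have "\<bar>C (Suc n)\<bar> / \<mu> (Suc n) * (\<mu> n * p j (x n)) \<le> (1/2) ^ n" by simp
    then show ?thesis
      using ptm_general[of j n z] by (meson mult_right_mono order_trans p_nonneg)
  qed
  \<comment> \<open>A single \<open>k\<close> and a single \<open>D\<close> must serve all
    \<open>n\<close>. All but finitely many terms obey the geometric bound with
    \<open>D = 1\<close>; the rest are absorbed into \<open>D\<close>, with \<open>k\<close> at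
    least their \<open>\<kappa> (Suc n)\<close>.\<close>
  have bound: "\<exists>k D. D \<ge> 0 \<and> (\<forall>n z. p j (tm n z) \<le> D * (1/2) ^ n * p k z)" for j
  proof -
    have "\<exists>k N. (\<forall>n\<ge>N. \<forall>z. p j (tm n z) \<le> (1/2) ^ n * p k z) \<and> (\<forall>n<N. \<kappa> (Suc n) \<le> k)"
    proof (cases "\<forall>n. \<kappa> n \<le> j")
      case True
      have "p j (tm n z) \<le> (1/2) ^ n * p j z" if "n \<ge> j" for n z
        using ptm_small[OF that, of z] p_mono[of "\<kappa> (Suc n)" j z] True
        by (meson mult_left_mono order_trans zero_le_divide_1_iff zero_le_numeral zero_le_power)
      then show ?thesis using True by blast
    next
      case False
      then obtain n0 where n0: "j < \<kappa> n0" by (auto simp: not_le)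
      have "p j (tm n z) \<le> (1/2) ^ n * p (\<kappa> n0) z" if "n \<ge> n0" for n z
      proof -
        have "j < \<kappa> n" using n0 monoD[OF mono that] by simp
        then show ?thesis by (simp add: ptm zero)
      qed
      moreover have "\<kappa> (Suc n) \<le> \<kappa> n0" if "n < n0" for n
        using that by (intro monoD[OF mono]) simp
      ultimately show ?thesis by blast
    qed
    then obtain k N where large: "\<And>n z. n \<ge> N \<Longrightarrow> p j (tm n z) \<le> (1/2) ^ n * p k z"
      and small: "\<And>n. n < N \<Longrightarrow> \<kappa> (Suc n) \<le> k" by blast
    define d where "d = (\<lambda>n. \<bar>C (Suc n)\<bar> / \<mu> (Suc n) * (\<mu> n * p j (x n)))"
    have d0: "d n \<ge> 0" for n using \<mu>pos[of n] \<mu>pos[of "Suc n"] by (simp add: d_def)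
    define D where "D = 1 + (\<Sum>n<N. d n * 2 ^ n)"
    have D1: "D \<ge> 1" using d0 by (simp add: D_def sum_nonneg)
    have "p j (tm n z) \<le> D * (1/2) ^ n * p k z" for n z
    proof (cases "n \<ge> N")
      case True
      have "1 * ((1/2) ^ n * p k z) \<le> D * ((1/2) ^ n * p k z)"
        using D1 by (intro mult_right_mono) auto
      then have "(1/2) ^ n * p k z \<le> D * (1/2) ^ n * p k z" by (simp only: mult.assoc mult_1)
      with large[OF True, of z] show ?thesis by (rule order_trans)
    next
      case False
      have "p j (tm n z) \<le> d n * p (\<kappa> (Suc n)) z"
        using ptm_general[of j n z] by (simp add: d_def)
      also have "\<dots> \<le> d n * p k z"
        using False d0 by (intro mult_left_mono p_mono small) auto
      also have "d n * 2 ^ n \<le> D"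
      proof -
        have "d n * 2 ^ n \<le> (\<Sum>n<N. d n * 2 ^ n)"
          using False d0 by (intro member_le_sum) auto
        then show ?thesis by (simp add: D_def)
      qed
      then have "d n * p k z \<le> D * (1/2) ^ n * p k z"
        by (intro mult_right_mono) (auto simp: field_simps)
      finally show ?thesis .
    qed
    moreover have "D \<ge> 0" using D1 by simp
    ultimately show ?thesis by blast
  qed
  define S where "S = (\<lambda>n z. \<Sum>i<n. tm i z)"
  have geo: "(\<Sum>i\<in>{a..<b}. (1/2) ^ i) \<le> 2 * (1/2 :: real) ^ a" for a b
  proof (cases "a \<le> b")
    case True
    have "(\<Sum>i\<in>{a..<b}. (1/2) ^ i) = ((1/2) ^ a - (1/2) ^ b) / (1 - 1/2 :: real)"
      using sum_gp_multiplied[of a "b - 1" "1/2 :: real"] True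
      by (cases b; cases "a = b") (auto simp: atLeastLessThanSuc_atLeastAtMost field_simps)
    then show ?thesis by simp
  qed simp
  have S_diff: "p j (S b z - S a z) \<le> D * p k z * (2 * (1/2) ^ a)"
    if "a \<le> b" "D \<ge> 0" "\<And>n. p j (tm n z) \<le> D * (1/2) ^ n * p k z" for a b j z D k
  proof -
    have "S b z = S a z + (\<Sum>i\<in>{a..<b}. tm i z)"
      unfolding S_def using that(1) by (simp add: lessThan_atLeast0 sum.atLeastLessThan_concat)
    then have "p j (S b z - S a z) \<le> (\<Sum>i\<in>{a..<b}. p j (tm i z))" by (simp add: p_sum)
    also have "\<dots> \<le> (\<Sum>i\<in>{a..<b}. D * (1/2) ^ i * p k z)" by (intro sum_mono that(3))
    also have "\<dots> = D * p k z * (\<Sum>i\<in>{a..<b}. (1/2) ^ i)" by (simp add: sum_distrib_left mult_ac)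
    also have "\<dots> \<le> D * p k z * (2 * (1/2) ^ a)" using that(2) by (intro mult_left_mono geo) simp
    finally show ?thesis .
  qed
  have "\<exists>l. (\<lambda>n. S n z) \<longlonglongrightarrow> l" for z
  proof -
    have "\<exists>N. \<forall>i\<ge>N. \<forall>j\<ge>N. p k (S i z - S j z) < e" if e: "e > 0" for k and e :: real
    proof -
      obtain k' D where D: "D \<ge> 0" "\<And>n. p k (tm n z) \<le> D * (1/2) ^ n * p k' z" using bound by blast
      have "((\<lambda>a. D * p k' z * (2 * (1/2) ^ a)) \<longlongrightarrow> D * p k' z * (2 * 0)) sequentially"
        by (intro tendsto_intros LIMSEQ_power_zero) auto
      then have "\<forall>\<^sub>F a in sequentially. D * p k' z * (2 * (1/2) ^ a) < e"
        using e by (intro order_tendstoD(2)) auto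
      then obtain N where N: "D * p k' z * (2 * (1/2) ^ N) < e"
        by (auto simp: eventually_sequentially)
      have *: "p k (S i z - S j z) < e" if "N \<le> j" "j \<le> i" for i j
      proof -
        have "p k (S i z - S j z) \<le> D * p k' z * (2 * (1/2) ^ j)" by (rule S_diff[OF that(2) D])
        also have "\<dots> \<le> D * p k' z * (2 * (1/2) ^ N)"
          using D(1) that by (intro mult_left_mono power_decreasing) auto
        finally show ?thesis using N by simp
      qed
      have "p k (S i z - S j z) < e" if "N \<le> j" "N \<le> i" for i j
        using *[of j i] *[of i j] that p_commute[of k "S i z" "S j z"] by (cases "j \<le> i") auto
      then show ?thesis by blast
    qed
    then show ?thesis using p_Cauchy_convergent[of "\<lambda>n. S n z"] by metis
  qed
  then obtain B where B: "\<And>z. (\<lambda>n. S n z) \<longlonglongrightarrow> B z" by metis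
  have SA: "S n (a + b) = S n a + S n b" "S n (smul c a) = smul c (S n a)" for n a b c
    by (simp_all add: S_def tm_def lin\<phi> scale_left_distrib sum.distrib scale_sum_right)
  have "B (a + b) = B a + B b" for a b
    using B[of "a + b"] tendsto_add[OF B[of a] B[of b]] unfolding SA by (rule LIMSEQ_unique)
  moreover have "B (smul c a) = smul c (B a)" for c a
    using B[of "smul c a"] tendsto_smul[OF tendsto_const[of c] B[of a]] unfolding SA
    by (rule LIMSEQ_unique)
  ultimately have linB: "Vector_Spaces.linear smul smul B" by (simp add: linear_self_iff)
  have "\<exists>k C. \<forall>z. p j (B z) \<le> C * p k z" for j
  proof -
    obtain k D where D: "D \<ge> 0" "\<And>n z. p j (tm n z) \<le> D * (1/2) ^ n * p k z" using bound by blast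
    have "p j (B z) \<le> 2 * D * p k z" for z
    proof -
      have "(\<lambda>n. p j (S n z)) \<longlonglongrightarrow> p j (B z)"
        by (rule continuous_on_tendsto_compose[OF continuous_p B]) auto
      moreover have "p j (S n z) \<le> 2 * D * p k z" for n
        using S_diff[of 0 n D j z k] D by (simp add: S_def mult_ac)
      ultimately show ?thesis by (intro LIMSEQ_le_const2) auto
    qed
    then show ?thesis by blast
  qed
  then have contB: "continuous_on UNIV B" by (intro linear_continuous linB)
  have \<phi>0lin: "Vector_Spaces.linear smul (*) (\<phi> 0)" by (simp add: linear_functional_iff lin\<phi>)
  have \<phi>0cont: "continuous_on UNIV (\<phi> 0)"
    by (rule linear_functional_continuous[OF \<phi>0lin, of "C 0" "\<kappa> 0"]) (simp add: \<phi>_def \<mu>0 fC)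
  have tme: "tm n (e m) = (if m = Suc n then e n else 0)" for n m
    by (auto simp: tm_def \<phi>e)
  have "B (e 0) = 0"
    using LIMSEQ_unique[OF B[of "e 0"]] by (simp add: S_def tme)
  moreover have "B (e (Suc m)) = e m" for m
  proof -
    have "S n (e (Suc m)) = e m" if "n \<ge> Suc m" for n
    proof -
      have "S n (e (Suc m)) = (\<Sum>i<n. if i = m then e m else 0)"
        unfolding S_def by (intro sum.cong) (auto simp: tme)
      then show ?thesis using that by simp
    qed
    then have "(\<lambda>n. S n (e (Suc m))) \<longlonglongrightarrow> e m"
      by (intro tendsto_eventually) (auto simp: eventually_sequentially)
    then show ?thesis using B LIMSEQ_unique by blast
  qed
  moreover have "span (range e) = span (range x)"
  proof (intro equalityI span_minimal subspace_span subsetI)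
    fix z assume "z \<in> range e"
    then show "z \<in> span (range x)" by (auto simp: e_def intro: span_scale span_base)
  next
    fix z assume "z \<in> range x"
    then obtain n where "z = x n" by auto
    then have "z = smul (of_real (1 / \<mu> n)) (e n)" using \<mu>pos[of n] by (simp add: e_def)
    then show "z \<in> span (range e)" by (metis rangeI span_base span_scale)
  qed
  ultimately show thesis using that[of "\<phi> 0" B e] \<phi>0lin \<phi>0cont linB contB \<phi>e dense by auto
qed

end

section \<open>Scalar factors along an orbit\<close>

text \<open>Explicitly the product of \<open>z j ^ (2 ^ (n - 1 - j))\<close> over
  \<open>j < n\<close>: early values enter with enormous exponents.\<close>

primrec orbit_coeff :: "(nat \<Rightarrow> complex) \<Rightarrow> nat \<Rightarrow> complex" where
  "orbit_coeff z 0 = 1"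
| "orbit_coeff z (Suc n) = (orbit_coeff z n)\<^sup>2 * z n"

text \<open>When the coefficient at \<open>m\<close> equals 1, the recursion restarts there with the
  shifted sequence. This is how a connecting polynomial inherits the growth of its second
  endpoint.\<close>

lemma orbit_coeff_add:
  "orbit_coeff z (m + i) = orbit_coeff z m ^ (2 ^ i) * orbit_coeff (\<lambda>j. z (m + j)) i"
  by (induction i) (simp_all add: power_mult_distrib power_mult[symmetric] mult_ac)

lemma orbit_coeff_eq_0: "z k = 0 \<Longrightarrow> k < n \<Longrightarrow> orbit_coeff z n = 0"
  by (induction n) (auto simp: less_Suc_eq)

text \<open>The normalised size \<open>d j = \<bar>c j\<bar> * \<sigma> * \<beta> ^ (j + 1)\<close>
  is chosen so that the lower bound on \<open>z j\<close> becomes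
  \<open>d (j + 1) \<ge> (d j)^2\<close>, without any weight. It is used with \<open>\<beta>\<close>
  equal to 1, 1/3 and 1/16.\<close>

lemma orbit_coeff_growth:
  assumes \<sigma>: "\<sigma> > 0" and \<beta>: "\<beta> > 0"
    and z: "\<And>j. m \<le> j \<Longrightarrow> j < m + i \<Longrightarrow> \<sigma> * \<beta> ^ j \<le> cmod (z j)"
  shows "(cmod (orbit_coeff z m) * \<sigma> * \<beta> ^ (m + 1)) ^ (2 ^ i)
           \<le> cmod (orbit_coeff z (m + i)) * \<sigma> * \<beta> ^ (m + i + 1)"
  using z
proof (induction i)
  case (Suc i)
  let ?d = "\<lambda>i. cmod (orbit_coeff z (m + i)) * \<sigma> * \<beta> ^ (m + i + 1)"
  have "(cmod (orbit_coeff z m) * \<sigma> * \<beta> ^ (m + 1)) ^ (2 ^ Suc i)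
      = ((cmod (orbit_coeff z m) * \<sigma> * \<beta> ^ (m + 1)) ^ (2 ^ i))\<^sup>2"
    by (simp add: power_mult[symmetric] mult.commute)
  also have "\<dots> \<le> (?d i)\<^sup>2"
    using Suc \<sigma> \<beta> by (intro power_mono) auto
  also have "\<dots> = ((cmod (orbit_coeff z (m + i)))\<^sup>2 * (\<sigma> * \<beta> ^ (m + i))) * (\<sigma> * \<beta> ^ (m + i + 2))"
    by (simp add: power2_eq_square power_add algebra_simps)
  also have "\<dots> \<le> ((cmod (orbit_coeff z (m + i)))\<^sup>2 * cmod (z (m + i))) * (\<sigma> * \<beta> ^ (m + i + 2))"
    using Suc.prems[of "m + i"] \<sigma> \<beta> by (intro mult_right_mono mult_left_mono) auto
  also have "\<dots> = ?d (Suc i)"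
    by (simp add: norm_mult norm_power)
  finally show ?case .
qed simp

lemma orbit_coeff_tendsto:
  assumes "\<And>j. j < J \<Longrightarrow> ((\<lambda>i. w i j) \<longlongrightarrow> z j) F"
  shows "((\<lambda>i. orbit_coeff (w i) J) \<longlongrightarrow> orbit_coeff z J) F"
  using assms by (induction J) (auto intro!: tendsto_intros)

lemma orbit_coeff_perturb:
  assumes "e > 0"
  shows "\<exists>d>0. \<forall>w. (\<forall>j<J. cmod (w j - z j) \<le> d) \<longrightarrow> cmod (orbit_coeff w J - orbit_coeff z J) < e"
proof (rule ccontr)
  assume "\<not> ?thesis"
  then have "\<exists>w. (\<forall>j<J. cmod (w j - z j) \<le> d) \<and> \<not> cmod (orbit_coeff w J - orbit_coeff z J) < e"
    if "d > 0" for d using that by blast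
  then have "\<exists>w. (\<forall>j<J. cmod (w j - z j) \<le> 1 / real (Suc n)) \<and>
      \<not> cmod (orbit_coeff w J - orbit_coeff z J) < e" for n by simp
  then obtain w where w: "\<And>n j. j < J \<Longrightarrow> cmod (w n j - z j) \<le> 1 / real (Suc n)"
    "\<And>n. \<not> cmod (orbit_coeff (w n) J - orbit_coeff z J) < e" by metis
  have "(\<lambda>n. w n j) \<longlonglongrightarrow> z j" if "j < J" for j
  proof -
    have "(\<lambda>n. w n j - z j) \<longlonglongrightarrow> 0"
      by (rule Lim_null_comparison[of _ "\<lambda>n. 1 / real (Suc n)"])
        (use w(1)[OF that] LIMSEQ_Suc[OF lim_1_over_n[where 'a = real]] in auto)
    then show ?thesis by (simp add: LIM_zero_iff)
  qed
  then have "(\<lambda>n. orbit_coeff (w n) J) \<longlonglongrightarrow> orbit_coeff z J"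
    by (rule orbit_coeff_tendsto)
  then have "\<forall>\<^sub>F n in sequentially. cmod (orbit_coeff (w n) J - orbit_coeff z J) < e"
    using assms by (auto simp: tendsto_iff dist_norm)
  with w(2) show False by (auto simp: eventually_sequentially)
qed

lemma orbit_coeff_holomorphic: "(\<lambda>t. orbit_coeff (\<lambda>j. z j + t) n) holomorphic_on S"
  by (induction n) (auto intro!: holomorphic_intros)

text \<open>If \<open>\<bar>b\<bar> < 2 ^ q\<close> then \<open>b ^ i\<close> is at most
  \<open>m ^ q\<close> for \<open>m = 2 ^ i\<close>, and an exponential in \<open>m\<close> beats
  every power of \<open>m\<close>.\<close>

lemma double_exp_dominates:
  fixes \<tau> b C :: real
  assumes "\<tau> > 1"
  shows "\<forall>\<^sub>F i in sequentially. C * b ^ i \<le> \<tau> ^ (2 ^ i)"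
proof -
  obtain q where q: "\<bar>b\<bar> < 2 ^ q" using real_arch_pow[of 2 "\<bar>b\<bar>"] by auto
  have "filterlim (\<lambda>m::nat. \<tau> ^ m / real m ^ q) at_top at_top"
    using assms by real_asymp
  then have "filterlim (\<lambda>i::nat. \<tau> ^ (2 ^ i) / real (2 ^ i) ^ q) at_top at_top"
  proof (rule filterlim_compose)
    show "filterlim (\<lambda>i::nat. 2 ^ i :: nat) at_top at_top"
      by (rule filterlim_at_top_mono[OF filterlim_ident]) (simp add: less_imp_le)
  qed
  then have "\<forall>\<^sub>F i in sequentially. \<bar>C\<bar> \<le> \<tau> ^ (2 ^ i) / real (2 ^ i) ^ q"
    by (simp add: filterlim_at_top)
  then show ?thesis
  proof eventually_elim
    case (elim i)
    have "C * b ^ i \<le> \<bar>C\<bar> * \<bar>b\<bar> ^ i" by (metis abs_ge_self abs_mult power_abs)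
    also have "\<dots> \<le> \<bar>C\<bar> * (2 ^ q) ^ i" using q by (intro mult_left_mono power_mono) auto
    also have "(2 ^ q) ^ i = (real (2 ^ i) ^ q :: real)"
      by (simp add: power_mult[symmetric] mult.commute)
    also have "\<bar>C\<bar> * \<dots> \<le> \<tau> ^ (2 ^ i)" using elim by (simp add: pos_le_divide_eq)
    finally show ?case .
  qed
qed

text \<open>Each forbidden point is avoided by passing to the first or the last third of the current
  interval, whichever lies across the midpoint from it. That third is at distance at least one sixth
  of the length, and the length is \<open>\<epsilon> / 3 ^ j\<close> when the \<open>j\<close>-th
  point is treated.\<close>

lemma avoid_finite:
  fixes s :: "nat \<Rightarrow> complex" and \<epsilon> c :: real
  assumes "\<epsilon> > 0"
  shows "\<exists>a\<in>{c..c + \<epsilon>}. \<forall>j<n. \<epsilon> / (6 * 3 ^ j) \<le> cmod (s j + of_real a)"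
  using assms
proof (induction n arbitrary: s c \<epsilon>)
  case 0
  then show ?case by (intro bexI[of _ c]) auto
next
  case (Suc n)
  define c' where "c' = (if Re (s 0) + c + \<epsilon> / 2 \<ge> 0 then c + 2 * \<epsilon> / 3 else c)"
  obtain a where a: "a \<in> {c'..c' + \<epsilon> / 3}"
    "\<And>j. j < n \<Longrightarrow> \<epsilon> / 3 / (6 * 3 ^ j) \<le> cmod (s (Suc j) + of_real a)"
    using Suc.IH[of "\<epsilon> / 3" c' "\<lambda>j. s (Suc j)"] Suc.prems by auto
  have "\<epsilon> / (6 * 3 ^ j) \<le> cmod (s j + of_real a)" if "j < Suc n" for j
  proof (cases j)
    case 0
    have "\<epsilon> / 6 \<le> \<bar>Re (s 0 + of_real a)\<bar>"
      using a(1) Suc.prems by (auto simp: c'_def split: if_splits)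
    then show ?thesis using abs_Re_le_cmod[of "s 0 + of_real a"] 0 by simp
  next
    case (Suc i)
    then show ?thesis using a(2)[of i] that by simp
  qed
  moreover have "a \<in> {c..c + \<epsilon>}" using a(1) Suc.prems by (auto simp: c'_def split: if_splits)
  ultimately show ?case by blast
qed

text \<open>The bounds for index \<open>j\<close> do not depend on \<open>n\<close>, so the sets of
  admissible \<open>a\<close> are nested nonempty compact sets.\<close>

lemma avoid_all:
  fixes s :: "nat \<Rightarrow> complex" and \<epsilon> :: real
  assumes "\<epsilon> > 0"
  shows "\<exists>a\<in>{0..\<epsilon>}. \<forall>j. \<epsilon> / (6 * 3 ^ j) \<le> cmod (s j + of_real a)"
proof -
  define S where "S = (\<lambda>n. {0..\<epsilon>} \<inter> (\<Inter>j\<in>{..<n}. {a. \<epsilon> / (6 * 3 ^ j) \<le> cmod (s j + of_real a)}))"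
  have "\<Inter>(range S) \<noteq> {}"
  proof (rule compact_nest)
    show "compact (S n)" for n
      unfolding S_def
      by (intro compact_Int_closed closed_INT ballI closed_Collect_le continuous_intros) auto
    show "S n \<noteq> {}" for n
      using avoid_finite[OF assms, of 0 n s] by (auto simp: S_def)
    show "S n \<subseteq> S m" if "m \<le> n" for m n
      using that by (auto simp: S_def)
  qed
  then obtain a where "\<And>n. a \<in> S n" by auto
  then have "a \<in> {0..\<epsilon>}" "\<And>j. \<epsilon> / (6 * 3 ^ j) \<le> cmod (s j + of_real a)"
    unfolding S_def by (auto dest: spec[of _ "Suc _"]) 
  then show ?thesis by blast
qed

text \<open>If \<open>\<zeta>\<close> were omitted, \<open>\<zeta> / (f t - \<zeta>)\<close> would
  be holomorphic on the disc, of modulus 1 at the centre and less than 1 on the circle, where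
  \<open>f\<close> exceeds \<open>2 * cmod \<zeta>\<close>.\<close>

lemma attains_value_in_disc:
  assumes f: "f holomorphic_on UNIV" and f0: "f 0 = 0" and r: "r > 0"
    and big: "\<And>t. cmod t = r \<Longrightarrow> 2 * cmod \<zeta> < cmod (f t)"
  shows "\<exists>t. cmod t \<le> r \<and> f t = \<zeta>"
proof (rule ccontr)
  assume "\<not> ?thesis"
  then have ne: "f t \<noteq> \<zeta>" if "cmod t \<le> r" for t using that by blast
  then have "\<zeta> \<noteq> 0" using f0 r by force
  define g where "g = (\<lambda>t. \<zeta> / (f t - \<zeta>))"
  have hol: "g holomorphic_on cball 0 r"
    unfolding g_def using ne
    by (intro holomorphic_intros holomorphic_on_subset[OF f]) auto
  \<comment> \<open>Compactness of the circle turns the pointwise strict bound into a uniform one,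
    as the maximum principle requires.\<close>
  obtain B where B: "B < 1" "\<And>t. cmod t = r \<Longrightarrow> cmod (g t) \<le> B"
  proof -
    have "compact (sphere (0::complex) r)" "sphere (0::complex) r \<noteq> {}" using r by auto
    moreover have "continuous_on (sphere 0 r) (\<lambda>t. cmod (g t))"
      by (intro continuous_intros holomorphic_on_imp_continuous_on holomorphic_on_subset[OF hol]) auto
    ultimately obtain t0 where t0: "t0 \<in> sphere 0 r" "\<And>t. t \<in> sphere 0 r \<Longrightarrow> cmod (g t) \<le> cmod (g t0)"
      using continuous_attains_sup by metis
    have "cmod \<zeta> < cmod (f t0 - \<zeta>)"
      using big[of t0] t0(1) norm_triangle_ineq2[of "f t0" \<zeta>] by simp
    then have "cmod (g t0) < 1"
      by (simp add: g_def norm_divide divide_less_eq)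
    then show thesis using that t0(2) by simp
  qed
  have "cmod (g 0) \<le> B"
  proof (rule maximum_modulus_frontier[of g "cball 0 r"])
    show "g holomorphic_on interior (cball 0 r)"
      by (rule holomorphic_on_subset[OF hol]) (rule interior_subset)
    show "continuous_on (closure (cball 0 r)) g"
      using holomorphic_on_imp_continuous_on[OF hol] by simp
  qed (use r B in \<open>auto simp: frontier_cball\<close>)
  moreover have "cmod (g 0) = 1" using \<open>\<zeta> \<noteq> 0\<close> by (simp add: g_def f0)
  ultimately show False using B by simp
qed

section \<open>Size of a polynomial at the natural numbers\<close>

lemma poly_upper_bound:
  fixes v :: "complex poly"
  obtains C where "C > 0" "\<And>z. cmod (poly v z) \<le> C * (1 + cmod z) ^ degree v"
proof
  let ?C = "1 + (\<Sum>i\<le>degree v. cmod (coeff v i))"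
  show "?C > 0" by (simp add: add_pos_nonneg sum_nonneg)
  show "cmod (poly v z) \<le> ?C * (1 + cmod z) ^ degree v" for z
  proof -
    have "cmod (poly v z) \<le> (\<Sum>i\<le>degree v. cmod (coeff v i) * cmod z ^ i)"
      unfolding poly_altdef by (rule order_trans[OF norm_sum]) (simp add: norm_mult norm_power)
    also have "\<dots> \<le> (\<Sum>i\<le>degree v. cmod (coeff v i) * (1 + cmod z) ^ degree v)"
    proof (intro sum_mono mult_left_mono)
      fix i assume "i \<in> {..degree v}"
      have "cmod z ^ i \<le> (1 + cmod z) ^ i" by (intro power_mono) auto
      also have "\<dots> \<le> (1 + cmod z) ^ degree v" using \<open>i \<in> _\<close> by (intro power_increasing) auto
      finally show "cmod z ^ i \<le> (1 + cmod z) ^ degree v" .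
    qed simp
    also have "\<dots> \<le> ?C * (1 + cmod z) ^ degree v"
      by (simp add: sum_distrib_right[symmetric] mult_right_mono)
    finally show ?thesis .
  qed
qed

text \<open>The quotient by \<open>(1 + real j) ^ degree w\<close> tends to the modulus of the
  leading coefficient, and its finitely many other values are positive. It is read off from the
  reflected polynomial at \<open>1 / (1 + j)\<close>; shifting \<open>w\<close> by one avoids
  division by zero at \<open>j = 0\<close>.\<close>

lemma poly_lower_bound:
  fixes w :: "complex poly"
  assumes nz: "\<And>j. poly w (of_nat j) \<noteq> 0"
  obtains \<kappa> where "\<kappa> > 0" "\<And>j. \<kappa> * (1 + real j) ^ degree w \<le> cmod (poly w (of_nat j))"
proof -
  have "w \<noteq> 0" using nz by auto
  define q where "q = pcompose w [:-1, 1:]"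
  have q: "degree q = degree w" "q \<noteq> 0"
    using \<open>w \<noteq> 0\<close> by (auto simp: q_def degree_pcompose pcompose_eq_0_iff)
  define g where "g = (\<lambda>j. cmod (poly (reflect_poly q) (inverse (1 + of_nat j))))"
  have g: "g j * (1 + real j) ^ degree w = cmod (poly w (of_nat j))" for j
  proof -
    have ne: "1 + of_nat j \<noteq> (0::complex)" by (metis of_nat_Suc of_nat_neq_0)
    then have "poly (reflect_poly q) (inverse (1 + of_nat j))
        = inverse (1 + of_nat j) ^ degree q * poly q (1 + of_nat j)"
      using poly_reflect_poly_nz[of "inverse (1 + of_nat j)" q] by simp
    also have "poly q (1 + of_nat j) = poly w (of_nat j)" by (simp add: q_def poly_pcompose)
    finally have "g j = inverse (1 + real j) ^ degree w * cmod (poly w (of_nat j))"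
      using norm_of_nat[where 'a = complex, of "Suc j"]
      by (simp add: g_def norm_mult norm_power norm_inverse q(1))
    then show ?thesis by (simp add: power_inverse field_simps)
  qed
  have "(\<lambda>j. poly (reflect_poly q) (inverse (1 + of_nat j))) \<longlonglongrightarrow> poly (reflect_poly q) 0"
    by (intro tendsto_poly LIMSEQ_Suc[of "\<lambda>n. inverse (of_nat n)", simplified] lim_inverse_n)
  then have lim: "g \<longlonglongrightarrow> cmod (lead_coeff q)"
    unfolding g_def using tendsto_norm by fastforce
  have pos: "cmod (lead_coeff q) > 0" using q(2) leading_coeff_0_iff zero_less_norm_iff by blast
  then have "\<forall>\<^sub>F j in sequentially. cmod (lead_coeff q) / 2 < g j"
    by (intro order_tendstoD(1)[OF lim]) simp
  then obtain N where N: "\<And>j. j \<ge> N \<Longrightarrow> cmod (lead_coeff q) / 2 < g j"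
    by (auto simp: eventually_sequentially)
  have gpos: "g j > 0" for j
    using g[of j] nz[of j] by (metis mult_zero_left norm_ge_zero norm_le_zero_iff g_def not_le order_antisym)
  define \<kappa> where "\<kappa> = Min (insert (cmod (lead_coeff q) / 2) (g ` {..<N}))"
  have "\<kappa> > 0" unfolding \<kappa>_def using pos gpos by (subst Min_gr_iff) auto
  moreover have "\<kappa> \<le> g j" for j
  proof (cases "j < N")
    case True
    then show ?thesis unfolding \<kappa>_def by (intro Min_le) auto
  next
    case False
    have "\<kappa> \<le> cmod (lead_coeff q) / 2" unfolding \<kappa>_def by (intro Min_le) auto
    then show ?thesis using N[of j] False by simp
  qed
  then have "\<kappa> * (1 + real j) ^ degree w \<le> cmod (poly w (of_nat j))" for j
    unfolding g[symmetric] by (intro mult_right_mono) auto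
  ultimately show thesis using that by blast
qed

section \<open>Polynomials connecting two given polynomials\<close>

text \<open>Convergence inside one finite dimensional space of polynomials. The degree bound makes
  every linear map into the Frechet space respect it, which coefficientwise convergence alone does
  not ensure.\<close>

definition poly_tendsto :: "(nat \<Rightarrow> complex poly) \<Rightarrow> complex poly \<Rightarrow> bool" where
  "poly_tendsto U u \<longleftrightarrow>
     (\<exists>d. \<forall>l. degree (U l) \<le> d) \<and> (\<forall>i. (\<lambda>l. coeff (U l) i) \<longlonglongrightarrow> coeff u i)"

lemma poly_tendsto_const: "poly_tendsto (\<lambda>_. u) u"
  by (auto simp: poly_tendsto_def)

lemma poly_tendsto_add:
  assumes "poly_tendsto U u" "poly_tendsto V v"
  shows "poly_tendsto (\<lambda>l. U l + V l) (u + v)"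
proof -
  obtain d e where "\<And>l. degree (U l) \<le> d" "\<And>l. degree (V l) \<le> e"
    using assms by (auto simp: poly_tendsto_def)
  then have "\<forall>l. degree (U l + V l) \<le> max d e"
    by (meson degree_add_le max.coboundedI1 max.coboundedI2)
  with assms show ?thesis by (auto simp: poly_tendsto_def intro: tendsto_add)
qed

lemma poly_tendsto_mult:
  assumes "poly_tendsto U u" "poly_tendsto V v"
  shows "poly_tendsto (\<lambda>l. U l * V l) (u * v)"
proof -
  obtain d e where "\<And>l. degree (U l) \<le> d" "\<And>l. degree (V l) \<le> e"
    using assms by (auto simp: poly_tendsto_def)
  then have "\<forall>l. degree (U l * V l) \<le> d + e"
    by (meson add_mono degree_mult_le order_trans)
  with assms show ?thesis
    by (auto simp: poly_tendsto_def coeff_mult intro!: tendsto_sum tendsto_mult)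
qed

lemma poly_tendsto_smult:
  assumes "a \<longlonglongrightarrow> b" "poly_tendsto U u"
  shows "poly_tendsto (\<lambda>l. smult (a l) (U l)) (smult b u)"
  using assms unfolding poly_tendsto_def
  by (auto intro!: tendsto_mult)

lemma poly_tendsto_diff:
  assumes "poly_tendsto U u" "poly_tendsto V v"
  shows "poly_tendsto (\<lambda>l. U l - V l) (u - v)"
  using poly_tendsto_add[OF assms(1) poly_tendsto_smult[OF tendsto_const[of "-1"] assms(2)]]
  by simp

lemma poly_tendsto_pCons:
  assumes "a \<longlonglongrightarrow> b" "poly_tendsto U u"
  shows "poly_tendsto (\<lambda>l. pCons (a l) (U l)) (pCons b u)"
proof -
  obtain d where "\<And>l. degree (U l) \<le> d"
    using assms by (auto simp: poly_tendsto_def)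
  then have "\<forall>l. degree (pCons (a l) (U l)) \<le> Suc d"
    by (meson degree_pCons_le not_less_eq_eq order_trans)
  moreover have "(\<lambda>l. coeff (pCons (a l) (U l)) i) \<longlonglongrightarrow> coeff (pCons b u) i" for i
    using assms by (cases i) (auto simp: poly_tendsto_def)
  ultimately show ?thesis unfolding poly_tendsto_def by blast
qed

lemma poly_tendsto_power:
  assumes "poly_tendsto U u"
  shows "poly_tendsto (\<lambda>l. U l ^ k) (u ^ k)"
  by (induction k) (auto intro: poly_tendsto_const poly_tendsto_mult assms)

lemma poly_tendsto_eval:
  assumes "poly_tendsto U u"
  shows "(\<lambda>l. poly (U l) z) \<longlonglongrightarrow> poly u z"
proof -
  obtain d where d: "\<And>l. degree (U l) \<le> d" and lim: "\<And>i. (\<lambda>l. coeff (U l) i) \<longlonglongrightarrow> coeff u i"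
    using assms by (auto simp: poly_tendsto_def)
  have eval: "poly q z = (\<Sum>i\<le>e. coeff q i * z ^ i)" if "degree q \<le> e" for q :: "complex poly" and e
    unfolding poly_altdef using that by (intro sum.mono_neutral_left) (auto simp: coeff_eq_0)
  have "(\<lambda>l. \<Sum>i\<le>max d (degree u). coeff (U l) i * z ^ i) \<longlonglongrightarrow> (\<Sum>i\<le>max d (degree u). coeff u i * z ^ i)"
    by (intro tendsto_intros lim)
  then show ?thesis using eval[of _ "max d (degree u)"] d by (simp add: le_max_iff_disj)
qed

section \<open>The connecting polynomials and their limits at both ends\<close>

abbreviation horizon :: "nat \<Rightarrow> complex" where "horizon l \<equiv> of_nat (2 * Suc l)"

lemma horizon_nonzero: "horizon l \<noteq> 0"
  by (simp only: of_nat_eq_0_iff) simp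

lemma tendsto_over_Suc: "(\<lambda>l. c / of_nat (Suc l) :: complex) \<longlonglongrightarrow> 0"
  using tendsto_mult[OF tendsto_const[of c] LIMSEQ_Suc[OF lim_1_over_n[where 'a = complex]]] by simp

lemma tendsto_over_horizon: "(\<lambda>l. c / horizon l) \<longlonglongrightarrow> 0"
proof -
  have "c / horizon l = (c / 2) / of_nat (Suc l)" for l by (simp only: of_nat_mult) simp
  then show ?thesis using tendsto_over_Suc[of "c / 2"] by simp
qed

text \<open>Shifting by a multiple of \<open>horizon l\<close> creates powers of it up to the degree
  of \<open>w\<close>. Each linear factor is paired with one factor \<open>d X / horizon l\<close>,
  and the product stays bounded; at least one small factor is left over and tends to 0.\<close>

lemma poly_tendsto_shift_vanish:
  assumes "degree w < K"
  shows "poly_tendsto (\<lambda>l. (w \<circ>\<^sub>p [:c * horizon l, 1:]) * [:0, d / horizon l:] ^ K) 0"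
  using assms
proof (induction w arbitrary: K rule: pCons_induct)
  case 0
  then show ?case by (simp add: poly_tendsto_const)
next
  case (pCons a w)
  then obtain K' where K: "K = Suc K'" by (cases K) auto
  let ?Z = "\<lambda>l. [:0, d / horizon l:]" and ?q = "\<lambda>l. [:c * horizon l, 1:]"
  have Z: "poly_tendsto ?Z 0"
    using poly_tendsto_pCons[OF tendsto_const[of 0] poly_tendsto_pCons[OF tendsto_over_horizon[of d] poly_tendsto_const[of 0]]]
    by simp
  then have ZK: "poly_tendsto (\<lambda>l. ?Z l ^ K) 0"
    using poly_tendsto_power[OF Z, of K] by (simp add: K)
  have 1: "poly_tendsto (\<lambda>l. [:a:] * ?Z l ^ K) 0"
    using poly_tendsto_mult[OF poly_tendsto_const[of "[:a:]"] ZK] by (simp only: mult_zero_right)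
  show ?case
  proof (cases "w = 0")
    case True
    then show ?thesis using 1 by (simp add: pcompose_pCons)
  next
    case False
    then have IH: "poly_tendsto (\<lambda>l. (w \<circ>\<^sub>p ?q l) * ?Z l ^ K') 0"
      using pCons.prems K by (intro pCons.IH) auto
    have qZ: "?q l * ?Z l = [:0, c * d, d / horizon l:]" for l
      using horizon_nonzero[of l] by (simp del: of_nat_Suc of_nat_mult)
    have "poly_tendsto (\<lambda>l. [:0, c * d, d / horizon l:]) [:0, c * d, 0:]"
      by (intro poly_tendsto_pCons tendsto_const poly_tendsto_const tendsto_over_horizon)
    from poly_tendsto_mult[OF this IH]
    have 2: "poly_tendsto (\<lambda>l. (?q l * ?Z l) * ((w \<circ>\<^sub>p ?q l) * ?Z l ^ K')) 0"
      by (simp only: qZ mult_zero_right)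
    have "(pCons a w \<circ>\<^sub>p ?q l) * ?Z l ^ K
        = [:a:] * ?Z l ^ K + (?q l * ?Z l) * ((w \<circ>\<^sub>p ?q l) * ?Z l ^ K')" for l
      unfolding pcompose_pCons K power_Suc by (simp only: algebra_simps)
    then show ?thesis using poly_tendsto_add[OF 1 2] by (simp only: add_0)
  qed
qed

definition midfactor :: "nat \<Rightarrow> complex poly" where
  "midfactor l = [:-1, 1 / of_nat (Suc l):]"

text \<open>The powers annihilate \<open>w\<close> near \<open>0\<close> and \<open>v\<close> near \<open>horizon l\<close>; the factor \<open>midfactor l\<close> is \<open>-1\<close> at \<open>0\<close>, \<open>1\<close> at
  \<open>horizon l\<close> and vanishes halfway.\<close>

definition connect :: "complex poly \<Rightarrow> complex poly \<Rightarrow> nat \<Rightarrow> complex poly" where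
  "connect v w l = midfactor l *
     ((w \<circ>\<^sub>p [:- horizon l, 1:]) * [:0, 1 / horizon l:] ^ Suc (degree w) - v * [:1, - 1 / horizon l:] ^ Suc (degree v))"

lemma midfactor_tendsto: "poly_tendsto midfactor [:-1:]"
proof -
  have "poly_tendsto midfactor [:-1, 0:]"
    unfolding midfactor_def[abs_def]
    by (intro poly_tendsto_pCons tendsto_const poly_tendsto_const tendsto_over_Suc)
  then show ?thesis by simp
qed

lemma midfactor_shift: "midfactor l \<circ>\<^sub>p [:horizon l, 1:] = [:1, 1 / of_nat (Suc l):]"
proof -
  have "of_nat (Suc l) \<noteq> (0::complex)" by (rule of_nat_neq_0)
  then have "horizon l / of_nat (Suc l) = 2" by (simp add: divide_eq_eq)
  then show ?thesis by (simp add: midfactor_def pcompose_pCons del: of_nat_Suc of_nat_mult)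
qed

lemma midfactor_shift_tendsto: "poly_tendsto (\<lambda>l. midfactor l \<circ>\<^sub>p [:horizon l, 1:]) [:1:]"
proof -
  have "poly_tendsto (\<lambda>l. midfactor l \<circ>\<^sub>p [:horizon l, 1:]) [:1, 0:]"
    unfolding midfactor_shift
    by (intro poly_tendsto_pCons tendsto_const poly_tendsto_const tendsto_over_Suc)
  then show ?thesis by simp
qed

text \<open>The limit -1 of \<open>midfactor\<close> cancels the minus sign in front of
  \<open>v\<close>.\<close>

lemma connect_tendsto: "poly_tendsto (connect v w) v"
proof -
  have 1: "poly_tendsto (\<lambda>l. (w \<circ>\<^sub>p [:- horizon l, 1:]) * [:0, 1 / horizon l:] ^ Suc (degree w)) 0"
    using poly_tendsto_shift_vanish[of w "Suc (degree w)" "-1" 1] by (simp del: of_nat_Suc of_nat_mult)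
  have "poly_tendsto (\<lambda>l. [:1, - 1 / horizon l:]) [:1, 0:]"
    by (intro poly_tendsto_pCons tendsto_const poly_tendsto_const tendsto_over_horizon)
  from poly_tendsto_mult[OF poly_tendsto_const[of v] poly_tendsto_power[OF this, of "Suc (degree v)"]]
  have 2: "poly_tendsto (\<lambda>l. v * [:1, - 1 / horizon l:] ^ Suc (degree v)) v"
    by (simp del: of_nat_Suc of_nat_mult power_Suc add: one_pCons[symmetric])
  show ?thesis
    unfolding connect_def[abs_def]
    using poly_tendsto_mult[OF midfactor_tendsto poly_tendsto_diff[OF 1 2]] by simp
qed

text \<open>After the shift the two powers exchange roles: the one beside \<open>w\<close> tends to
  1, the one beside \<open>v\<close> now suppresses the shifted \<open>v\<close>, and
  \<open>midfactor\<close> tends to 1.\<close>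

lemma connect_shift_tendsto: "poly_tendsto (\<lambda>l. connect v w l \<circ>\<^sub>p [:horizon l, 1:]) w"
proof -
  have e: "connect v w l \<circ>\<^sub>p [:horizon l, 1:] = (midfactor l \<circ>\<^sub>p [:horizon l, 1:]) *
      (w * [:1, 1 / horizon l:] ^ Suc (degree w) - (v \<circ>\<^sub>p [:horizon l, 1:]) * [:0, - 1 / horizon l:] ^ Suc (degree v))" for l
  proof -
    have "(w \<circ>\<^sub>p [:- horizon l, 1:]) \<circ>\<^sub>p [:horizon l, 1:] = w"
      by (simp add: pcompose_assoc[symmetric] pcompose_pCons pcompose_idR del: of_nat_Suc of_nat_mult)
    moreover have "[:0, 1 / horizon l:] \<circ>\<^sub>p [:horizon l, 1:] = [:1, 1 / horizon l:]"
      "[:1, - 1 / horizon l:] \<circ>\<^sub>p [:horizon l, 1:] = [:0, - 1 / horizon l:]"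
      using horizon_nonzero[of l] by (simp_all add: pcompose_pCons del: of_nat_Suc of_nat_mult)
    moreover have "(q ^ k) \<circ>\<^sub>p r = (q \<circ>\<^sub>p r) ^ k" for q r :: "complex poly" and k
      by (induction k) (simp_all add: pcompose_mult pcompose_1)
    ultimately show ?thesis
      unfolding connect_def pcompose_mult pcompose_diff by (simp only:)
  qed
  have "poly_tendsto (\<lambda>l. [:1, 1 / horizon l:]) [:1, 0:]"
    by (intro poly_tendsto_pCons tendsto_const poly_tendsto_const tendsto_over_horizon)
  from poly_tendsto_mult[OF poly_tendsto_const[of w] poly_tendsto_power[OF this, of "Suc (degree w)"]]
  have 2: "poly_tendsto (\<lambda>l. w * [:1, 1 / horizon l:] ^ Suc (degree w)) w"
    by (simp del: of_nat_Suc of_nat_mult power_Suc add: one_pCons[symmetric])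
  have 3: "poly_tendsto (\<lambda>l. (v \<circ>\<^sub>p [:horizon l, 1:]) * [:0, - 1 / horizon l:] ^ Suc (degree v)) 0"
    using poly_tendsto_shift_vanish[of v "Suc (degree v)" 1 "-1"] by (simp del: of_nat_Suc of_nat_mult)
  show ?thesis
    unfolding e using poly_tendsto_mult[OF midfactor_shift_tendsto poly_tendsto_diff[OF 2 3]]
    by (simp add: one_pCons[symmetric])
qed

section \<open>Lower bounds for the connecting polynomials at the integers\<close>

lemma poly_midfactor: "poly (midfactor l) z = z / of_nat (Suc l) - 1"
  by (simp add: midfactor_def)

lemma poly_connect:
  "poly (connect v w l) z = poly (midfactor l) z *
     (poly w (z - horizon l) * (z / horizon l) ^ Suc (degree w) - poly v z * (1 - z / horizon l) ^ Suc (degree v))"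
  by (simp add: connect_def poly_pcompose del: of_nat_Suc of_nat_mult power_Suc)

lemma connect_midpoint: "poly (connect v w l + smult a ((midfactor l)\<^sup>2)) (of_nat (Suc l)) = 0"
proof -
  have "of_nat (Suc l) \<noteq> (0::complex)" by (rule of_nat_neq_0)
  then have "poly (midfactor l) (of_nat (Suc l)) = 0" by (simp add: poly_midfactor del: of_nat_Suc)
  then show ?thesis by (simp add: poly_connect)
qed

text \<open>With \<open>k = Suc l\<close> the value is \<open>\<bar>j - k\<bar> / k\<close>. For
  \<open>j < k\<close> one has \<open>k \<le> (j + 1) * (k - j)\<close>, and for
  \<open>j > k\<close> simply \<open>k < j\<close>. What matters is that the bound is independent of
  \<open>l\<close>.\<close>

lemma midfactor_lower_bound:
  assumes "j \<noteq> Suc l"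
  shows "(1/2) ^ j \<le> cmod (poly (midfactor l) (of_nat j))"
proof -
  define k where "k = Suc l"
  have k: "real k > 0" by (simp add: k_def)
  have "cmod (poly (midfactor l) (of_nat j)) = \<bar>real j / real k - 1\<bar>"
  proof -
    have "poly (midfactor l) (of_nat j) = of_real (real j / real k - 1)"
      by (simp add: poly_midfactor k_def)
    then show ?thesis by (simp only: norm_of_real)
  qed
  also have "\<dots> = \<bar>real j - real k\<bar> / real k"
    using k by (simp add: field_simps abs_divide[symmetric])
  finally have eq: "cmod (poly (midfactor l) (of_nat j)) = \<bar>real j - real k\<bar> / real k" .
  have "real k \<le> 2 ^ j * \<bar>real j - real k\<bar>"
  proof (cases "j < k")
    case True
    have "Suc j \<le> 2 ^ j" by (rule Suc_leI[OF less_exp])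
    then have 1: "real (Suc j) \<le> 2 ^ j" by (metis of_nat_le_iff of_nat_numeral of_nat_power)
    obtain i where i: "k = j + Suc i" using True less_imp_Suc_add by auto
    have "real k \<le> real (Suc j) * real (Suc i)" by (simp add: i algebra_simps)
    also have "\<dots> \<le> 2 ^ j * real (Suc i)" using 1 by (intro mult_right_mono) auto
    finally show ?thesis by (simp add: i add.commute)
  next
    case False
    then have "k < j" using assms by (simp add: k_def)
    then have "1 \<le> \<bar>real j - real k\<bar>" by linarith
    moreover have "real k \<le> 2 ^ j" using \<open>k < j\<close> of_nat_less_two_power[of j, where 'a = real] by linarith
    ultimately show ?thesis
      using mult_mono[of "real k" "2 ^ j" 1 "\<bar>real j - real k\<bar>"] by simp
  qed
  then show ?thesis unfolding eq using k by (simp add: field_simps power_one_over)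
qed

text \<open>With \<open>X j\<close> the value of \<open>midfactor l\<close>, the value in question
  is \<open>(X j)^2 * (S j / X j + a)\<close>, so \<open>a\<close> only has to avoid finitely many
  points. The square keeps the zero at \<open>Suc l\<close> and tends to 1 at both ends.\<close>

lemma connect_avoids_zero:
  assumes \<epsilon>: "\<epsilon> > 0"
  obtains a where "0 \<le> a" "a \<le> \<epsilon>"
    "\<And>j. j \<noteq> Suc l \<Longrightarrow> j < n \<Longrightarrow>
       \<epsilon> / 6 * (1/16) ^ j \<le> cmod (poly (connect v w l + smult (of_real a) ((midfactor l)\<^sup>2)) (of_nat j))"
proof -
  define S where "S = (\<lambda>j. poly w (of_nat j - horizon l) * (of_nat j / horizon l) ^ Suc (degree w)
    - poly v (of_nat j) * (1 - of_nat j / horizon l) ^ Suc (degree v))"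
  define X where "X = (\<lambda>j. poly (midfactor l) (of_nat j))"
  obtain a where a: "a \<in> {0..0 + \<epsilon>}" "\<And>j. j < n \<Longrightarrow> \<epsilon> / (6 * 3 ^ j) \<le> cmod (S j / X j + of_real a)"
    using avoid_finite[OF \<epsilon>, of 0 n "\<lambda>j. S j / X j"] by blast
  have "\<epsilon> / 6 * (1/16) ^ j \<le> cmod (poly (connect v w l + smult (of_real a) ((midfactor l)\<^sup>2)) (of_nat j))"
    if j: "j \<noteq> Suc l" "j < n" for j
  proof -
    have X: "(1/2) ^ j \<le> cmod (X j)" unfolding X_def by (rule midfactor_lower_bound[OF j(1)])
    then have "X j \<noteq> 0" by (metis norm_zero not_le zero_less_divide_1_iff zero_less_numeral zero_less_power)
    have "poly (connect v w l + smult (of_real a) ((midfactor l)\<^sup>2)) (of_nat j) = X j * S j + of_real a * (X j)\<^sup>2"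
      unfolding poly_add poly_connect S_def X_def poly_smult poly_power by simp
    also have "\<dots> = (X j)\<^sup>2 * (S j / X j + of_real a)"
      using \<open>X j \<noteq> 0\<close> by (simp add: power2_eq_square algebra_simps)
    finally have "cmod (poly (connect v w l + smult (of_real a) ((midfactor l)\<^sup>2)) (of_nat j))
        = (cmod (X j))\<^sup>2 * cmod (S j / X j + of_real a)" by (simp add: norm_mult norm_power)
    moreover have "((1/2) ^ j)\<^sup>2 * (\<epsilon> / (6 * 3 ^ j)) \<le> (cmod (X j))\<^sup>2 * cmod (S j / X j + of_real a)"
      using X a(2)[OF j(2)] \<epsilon> by (intro mult_mono power_mono) auto
    \<comment> \<open>The losses 4^j from \<open>(X j)^2\<close> and 3^j from the avoidance multiply
      to 12^j, rounded up to 16^j.\<close>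
    moreover have "\<epsilon> / 6 * (1/16) ^ j \<le> ((1/2) ^ j)\<^sup>2 * (\<epsilon> / (6 * 3 ^ j))"
    proof -
      have "((1/2 :: real) ^ j)\<^sup>2 = ((1/2)\<^sup>2) ^ j" by (metis power_mult mult.commute)
      then have "((1/2) ^ j)\<^sup>2 * (\<epsilon> / (6 * 3 ^ j)) = \<epsilon> / 6 * (((1/2)\<^sup>2) ^ j * (1/3) ^ j)"
        by (simp add: power_one_over)
      also have "\<dots> = \<epsilon> / 6 * (1/12) ^ j"
        unfolding power_mult_distrib[symmetric] by (simp add: power2_eq_square)
      also have "\<dots> \<ge> \<epsilon> / 6 * (1/16) ^ j"
        using \<epsilon> by (intro mult_left_mono power_mono) auto
      finally show ?thesis .
    qed
    ultimately show ?thesis by linarith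
  qed
  then show thesis using that a(1) by auto
qed

text \<open>The degree assumption makes the term containing \<open>w\<close> dominate at all integers beyond \<open>horizon l\<close>.\<close>

lemma connect_tail:
  assumes deg: "degree v < degree w" and \<kappa>: "\<kappa> > 0"
    and w: "\<And>i. \<kappa> * (1 + real i) ^ degree w \<le> cmod (poly w (of_nat i))"
  shows "\<forall>\<^sub>F l in sequentially. \<forall>a i. 0 \<le> a \<and> a \<le> \<kappa> / 8 \<longrightarrow>
    \<kappa> / 2 \<le> cmod (poly (connect v w l + smult (of_real a) ((midfactor l)\<^sup>2)) (of_nat (2 * Suc l + i)))"
proof -
  define N where "N = degree v"
  define M where "M = degree w"
  obtain C where C: "C > 0" "\<And>z. cmod (poly v z) \<le> C * (1 + cmod z) ^ N"
    unfolding N_def using poly_upper_bound[of v] by blast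
  have "(\<lambda>l. (C * 2 ^ N / 2) * (1 / real (Suc l))) \<longlonglongrightarrow> (C * 2 ^ N / 2) * 0"
    by (intro tendsto_intros LIMSEQ_Suc[OF lim_1_over_n])
  then have "\<forall>\<^sub>F l in sequentially. (C * 2 ^ N / 2) * (1 / real (Suc l)) < \<kappa> / 4"
    using \<kappa> by (intro order_tendstoD(2)) auto
  then show ?thesis
  proof (eventually_elim, intro allI impI, elim conjE)
    fix l i and a :: real
    assume l: "(C * 2 ^ N / 2) * (1 / real (Suc l)) < \<kappa> / 4" and a: "0 \<le> a" "a \<le> \<kappa> / 8"
    define n where "n = real (2 * Suc l)"
    have n: "n \<ge> 1" by (simp add: n_def)
    \<comment> \<open>Distance beyond the horizon in units of the horizon. At \<open>z\<close> the
      three linear factors become \<open>1 + 2 * t\<close>, \<open>1 + t\<close> and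
      \<open>- t\<close>.\<close>
    define t where "t = real i / n"
    have t: "t \<ge> 0" "real i = t * n" using n by (simp_all add: t_def)
    have nl: "C * 2 ^ N / n < \<kappa> / 4" using l by (simp add: n_def)
    define z :: complex where "z = of_nat (2 * Suc l + i)"
    have z1: "poly (midfactor l) z = of_real (1 + 2 * t)"
    proof -
      have "z / of_nat (Suc l) = of_real (2 + real i / real (Suc l))"
        by (simp add: z_def field_simps)
      also have "real i / real (Suc l) = 2 * t" by (simp add: t_def n_def field_simps)
      finally show ?thesis by (simp add: poly_midfactor del: of_nat_Suc)
    qed
    have z2: "z - horizon l = of_nat i" by (simp add: z_def)
    have horizon_n: "horizon l = of_real n" by (simp add: n_def)
    have z3: "z / horizon l = of_real (1 + t)"
    proof -
      have "real (2 * Suc l + i) = n * (1 + t)" unfolding of_nat_add n_def[symmetric]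
        using n by (simp add: t_def distrib_left)
      then have "z = of_real n * of_real (1 + t)"
        unfolding z_def by (metis of_real_mult of_real_of_nat_eq)
      then show ?thesis using n unfolding horizon_n by simp
    qed
    define W where "W = poly w (of_nat i) * of_real (1 + t) ^ Suc M"
    define V where "V = poly v z * of_real (- t) ^ Suc N"
    define A :: complex where "A = of_real a * of_real (1 + 2 * t)"
    have "poly (connect v w l + smult (of_real a) ((midfactor l)\<^sup>2)) z = of_real (1 + 2 * t) * (W - V + A)"
      unfolding poly_add poly_connect poly_smult poly_power z1 z2 z3 W_def V_def A_def M_def N_def
      by (simp add: algebra_simps power2_eq_square)
    then have eq: "cmod (poly (connect v w l + smult (of_real a) ((midfactor l)\<^sup>2)) z) = (1 + 2 * t) * cmod (W - V + A)"
      using t(1) by (simp only: norm_mult norm_of_real)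
    define G where "G = (1 + real i) ^ M * (1 + t) ^ Suc M"
    have G1: "1 \<le> (1 + real i) ^ M" "1 \<le> (1 + t) ^ M" using t(1) by (simp_all add: one_le_power)
    have Gt: "1 + t \<le> G"
    proof -
      have "1 * (1 * (1 + t)) \<le> (1 + real i) ^ M * ((1 + t) ^ M * (1 + t))"
        using G1 t(1) by (intro mult_mono) auto
      then show ?thesis by (simp add: G_def mult_ac)
    qed
    have cW: "\<kappa> * G \<le> cmod W"
    proof -
      have "\<kappa> * (1 + real i) ^ M * (1 + t) ^ Suc M \<le> cmod (poly w (of_nat i)) * (1 + t) ^ Suc M"
        using w[of i] t(1) unfolding M_def by (intro mult_right_mono) auto
      also have "\<dots> = cmod W"
        using t(1) by (simp only: W_def norm_mult norm_power norm_of_real)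
      finally show ?thesis by (simp add: G_def mult_ac)
    qed
    \<comment> \<open>Together \<open>n ^ N\<close> and \<open>t ^ Suc N\<close> make
      \<open>real i ^ Suc N / n\<close>. The surplus \<open>1 / n\<close> makes \<open>V\<close>
      negligible, and \<open>Suc N \<le> M\<close> lets the power of \<open>i\<close> be absorbed by
      the growth of \<open>w\<close>.\<close>
    have cV: "cmod V \<le> (C * 2 ^ N / n) * G"
    proof -
      have "cmod V = cmod (poly v z) * t ^ Suc N"
        using t(1) by (simp only: V_def norm_mult norm_power norm_of_real) simp
      also have "\<dots> \<le> (C * (1 + cmod z) ^ N) * t ^ Suc N"
        using t(1) by (intro mult_right_mono C) auto
      also have "\<dots> \<le> (C * (2 * n * (1 + t)) ^ N) * t ^ Suc N"
      proof -
        have "cmod z = n + real i" unfolding z_def norm_of_nat by (simp add: n_def)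
        then have "1 + cmod z \<le> 2 * n * (1 + t)" using n t by (simp add: algebra_simps)
        then show ?thesis using C(1) t(1) by (intro mult_right_mono mult_left_mono power_mono) auto
      qed
      also have "\<dots> = (C * 2 ^ N / n) * (real i ^ Suc N * (1 + t) ^ N)"
        using n unfolding t(2) power_mult_distrib by (simp add: field_simps)
      also have "\<dots> \<le> (C * 2 ^ N / n) * ((1 + real i) ^ M * (1 + t) ^ Suc M)"
      proof (intro mult_left_mono mult_mono)
        have "real i ^ Suc N \<le> (1 + real i) ^ Suc N" by (intro power_mono) auto
        also have "\<dots> \<le> (1 + real i) ^ M" using deg by (intro power_increasing) (auto simp: N_def M_def)
        finally show "real i ^ Suc N \<le> (1 + real i) ^ M" .
        show "(1 + t) ^ N \<le> (1 + t) ^ Suc M"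
          using deg t(1) by (intro power_increasing) (auto simp: N_def M_def)
      qed (use C n t in auto)
      finally show ?thesis by (simp add: G_def)
    qed
    have cA: "cmod A \<le> 2 * a * G"
    proof -
      have "cmod A = a * (1 + 2 * t)" using a t(1) by (simp only: A_def norm_mult norm_of_real)
      also have "\<dots> \<le> a * (2 * (1 + t))" using a by (intro mult_left_mono) auto
      also have "\<dots> \<le> a * (2 * G)" using a Gt by (intro mult_left_mono) auto
      finally show ?thesis by simp
    qed
    \<comment> \<open>Of \<open>\<kappa>\<close>, one quarter is lost to \<open>V\<close> and one
      quarter to \<open>A\<close>.\<close>
    have "(\<kappa> / 2) * 1 \<le> (\<kappa> - C * 2 ^ N / n - 2 * a) * G"
      using nl a Gt t(1) \<kappa> by (intro mult_mono) auto
    also have "\<dots> = \<kappa> * G - (C * 2 ^ N / n) * G - 2 * a * G" by (simp add: algebra_simps)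
    also have "\<dots> \<le> cmod W - cmod V - cmod A" using cW cV cA by linarith
    also have "\<dots> \<le> cmod (W - V + A)"
      using norm_triangle_ineq2[of "W" "V - A"] norm_triangle_ineq4[of V A] by (simp add: algebra_simps)
    finally have "\<kappa> / 2 \<le> cmod (W - V + A)" by simp
    also have "\<dots> \<le> (1 + 2 * t) * cmod (W - V + A)"
      using t(1) mult_right_mono[of 1 "1 + 2 * t" "cmod (W - V + A)"] by simp
    finally show "\<kappa> / 2 \<le> cmod (poly (connect v w l + smult (of_real a) ((midfactor l)\<^sup>2)) (of_nat (2 * Suc l + i)))"
      using eq unfolding z_def by simp
  qed
qed

section \<open>Escaping polynomials\<close>

abbreviation nat_values :: "complex poly \<Rightarrow> nat \<Rightarrow> complex" where
  "nat_values v \<equiv> (\<lambda>j. poly v (of_nat j))"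

text \<open>With \<open>d\<^sub>j = \<kappa> \<bar>c\<^sub>j\<bar>\<close> the lower bound gives \<open>d\<^sub>j\<^sub>+\<^sub>1 \<ge> d\<^sub>j\<^sup>2\<close> for \<open>j \<ge> J\<close>, so \<open>d\<^sub>J > 1\<close> forces doubly
  exponential growth.\<close>

definition escaping :: "complex poly \<Rightarrow> bool" where
  "escaping v \<longleftrightarrow> (\<exists>\<kappa>>0. \<exists>J. (\<forall>j\<ge>J. \<kappa> \<le> cmod (nat_values v j)) \<and>
     \<kappa> * cmod (orbit_coeff (nat_values v) J) > 1)"

lemma orbit_coeff_nonzero: "(\<And>j. j < n \<Longrightarrow> z j \<noteq> 0) \<Longrightarrow> orbit_coeff z n \<noteq> 0"
  by (induction n) auto

lemma escaping_nonzero: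
  assumes "escaping v"
  shows "poly v (of_nat j) \<noteq> 0"
proof -
  obtain \<kappa> J where \<kappa>: "\<kappa> > 0" "\<And>j. j \<ge> J \<Longrightarrow> \<kappa> \<le> cmod (nat_values v j)"
    "\<kappa> * cmod (orbit_coeff (nat_values v) J) > 1"
    using assms by (auto simp: escaping_def)
  show ?thesis
  proof (cases "j < J")
    case True
    then show ?thesis using orbit_coeff_eq_0[of "nat_values v" j J] \<kappa>(3) by auto
  next
    case False
    then show ?thesis using \<kappa>(2)[of j] \<kappa>(1) by auto
  qed
qed

lemma escaping_orbit_coeff_unbounded:
  assumes "escaping v"
  shows "\<exists>J. K < cmod (orbit_coeff (nat_values v) J)"
proof -
  obtain \<kappa> J where \<kappa>: "\<kappa> > 0" "\<And>j. j \<ge> J \<Longrightarrow> \<kappa> \<le> cmod (nat_values v j)"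
    "\<kappa> * cmod (orbit_coeff (nat_values v) J) > 1"
    using assms by (auto simp: escaping_def)
  let ?\<tau> = "cmod (orbit_coeff (nat_values v) J) * \<kappa> * 1 ^ (J + 1)"
  have "?\<tau> > 1" using \<kappa>(3) by (simp add: mult.commute)
  then have "\<forall>\<^sub>F i in sequentially. (\<kappa> * (\<bar>K\<bar> + 1)) * 1 ^ i \<le> ?\<tau> ^ (2 ^ i)"
    by (rule double_exp_dominates)
  then obtain i where "(\<kappa> * (\<bar>K\<bar> + 1)) * 1 ^ i \<le> ?\<tau> ^ (2 ^ i)"
    by (auto simp: eventually_sequentially)
  also have "\<dots> \<le> cmod (orbit_coeff (nat_values v) (J + i)) * \<kappa> * 1 ^ (J + i + 1)"
    using \<kappa> by (intro orbit_coeff_growth) auto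
  finally have "\<kappa> * (\<bar>K\<bar> + 1) \<le> \<kappa> * cmod (orbit_coeff (nat_values v) (J + i))"
    by (simp add: mult.commute)
  then have "\<bar>K\<bar> + 1 \<le> cmod (orbit_coeff (nat_values v) (J + i))" using \<kappa>(1) by simp
  then show ?thesis by (intro exI[of _ "J + i"]) linarith
qed

text \<open>The constant \<open>\<kappa>\<close> in the definition of \<open>escaping\<close>
  depends on \<open>w\<close> in an uncontrolled way, whereas avoiding zeros yields explicit bounds
  decaying like 3^-j. Under these the growth is already doubly exponential, so it eventually exceeds
  \<open>1 / \<kappa>\<close>, however small \<open>\<kappa>\<close> is.\<close>

lemma escapingI:
  assumes \<sigma>: "\<sigma> > 0" and w: "\<And>j. \<sigma> * (1/3) ^ j \<le> cmod (nat_values w j)"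
    and J: "cmod (orbit_coeff (nat_values w) J) * \<sigma> * (1/3) ^ (J + 1) > 1"
  shows "escaping w"
proof -
  have "poly w (of_nat j) \<noteq> 0" for j
    using w[of j] mult_pos_pos[OF \<sigma>, of "(1/3) ^ j"] by auto
  then obtain \<kappa> where \<kappa>: "\<kappa> > 0" "\<And>j. \<kappa> * (1 + real j) ^ degree w \<le> cmod (nat_values w j)"
    using poly_lower_bound[of w] by metis
  have lower: "\<kappa> \<le> cmod (nat_values w j)" for j
  proof -
    have "\<kappa> * 1 \<le> \<kappa> * (1 + real j) ^ degree w" using \<kappa>(1) by (intro mult_left_mono one_le_power) auto
    then show ?thesis using \<kappa>(2)[of j] by simp
  qed
  let ?\<tau> = "cmod (orbit_coeff (nat_values w) J) * \<sigma> * (1/3) ^ (J + 1)"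
  have "\<forall>\<^sub>F i in sequentially. (2 * \<sigma> / \<kappa>) * 1 ^ i \<le> ?\<tau> ^ (2 ^ i)"
    by (rule double_exp_dominates[OF J])
  then obtain i where "(2 * \<sigma> / \<kappa>) * 1 ^ i \<le> ?\<tau> ^ (2 ^ i)"
    by (auto simp: eventually_sequentially)
  also have "\<dots> \<le> cmod (orbit_coeff (nat_values w) (J + i)) * \<sigma> * (1/3) ^ (J + i + 1)"
    using \<sigma> w by (intro orbit_coeff_growth) auto
  also have "\<dots> \<le> cmod (orbit_coeff (nat_values w) (J + i)) * \<sigma> * 1"
    using \<sigma> by (intro mult_left_mono power_le_one) auto
  finally have "\<sigma> * (2 / \<kappa>) \<le> \<sigma> * cmod (orbit_coeff (nat_values w) (J + i))"
    by (simp add: mult.commute)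
  then have "2 / \<kappa> \<le> cmod (orbit_coeff (nat_values w) (J + i))"
    using \<sigma> by (simp only: mult_le_cancel_left_pos)
  then have "1 < \<kappa> * cmod (orbit_coeff (nat_values w) (J + i))"
    using \<kappa>(1) by (simp add: field_simps)
  then show ?thesis using \<kappa>(1) lower unfolding escaping_def by blast
qed

section \<open>Transitions from one polynomial to another\<close>

definition connection :: "complex poly \<Rightarrow> complex poly \<Rightarrow> nat \<Rightarrow> real \<Rightarrow> complex \<Rightarrow> complex poly" where
  "connection v w l a \<delta> = connect v w l + smult (of_real a) ((midfactor l)\<^sup>2) + [:\<delta>:]"

lemma poly_connection:
  "poly (connection v w l a \<delta>) z = poly (connect v w l + smult (of_real a) ((midfactor l)\<^sup>2)) z + \<delta>"
  by (simp add: connection_def)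

lemma midfactor_square_tendsto: "poly_tendsto (\<lambda>l. (midfactor l)\<^sup>2) 1"
  using poly_tendsto_power[OF midfactor_tendsto, of 2] by (simp add: power2_eq_square one_pCons)

lemma midfactor_square_shift_tendsto: "poly_tendsto (\<lambda>l. (midfactor l)\<^sup>2 \<circ>\<^sub>p [:horizon l, 1:]) 1"
proof -
  have "(midfactor l)\<^sup>2 \<circ>\<^sub>p [:horizon l, 1:] = (midfactor l \<circ>\<^sub>p [:horizon l, 1:])\<^sup>2" for l
    by (simp add: power2_eq_square pcompose_mult)
  then show ?thesis
    using poly_tendsto_power[OF midfactor_shift_tendsto, of 2] by (simp add: power2_eq_square one_pCons)
qed

lemma eventually_values_close:
  assumes "poly_tendsto U u" "poly_tendsto X 1" "e > 0"
  shows "\<forall>\<^sub>F l in sequentially. \<forall>j<J. cmod (nat_values (U l) j - nat_values u j) \<le> e \<and>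
    cmod (nat_values (X l) j) \<le> 2"
proof -
  have "\<forall>\<^sub>F l in sequentially. cmod (nat_values (U l) j - nat_values u j) \<le> e \<and>
    cmod (nat_values (X l) j) \<le> 2" for j
  proof -
    have "\<forall>\<^sub>F l in sequentially. dist (poly (U l) (of_nat j)) (poly u (of_nat j)) < e"
      using tendstoD[OF poly_tendsto_eval[OF assms(1)] assms(3)] .
    moreover have "\<forall>\<^sub>F l in sequentially. cmod (poly (X l) (of_nat j)) < 2"
      using tendsto_norm[OF poly_tendsto_eval[OF assms(2), of "of_nat j"]]
      by (intro order_tendstoD(2)) auto
    ultimately show ?thesis by eventually_elim (auto simp: dist_norm)
  qed
  then have "\<forall>\<^sub>F l in sequentially. \<forall>j\<in>{..<J}. cmod (nat_values (U l) j - nat_values u j) \<le> e \<and>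
    cmod (nat_values (X l) j) \<le> 2"
    by (intro eventually_ball_finite) auto
  then show ?thesis by eventually_elim auto
qed

text \<open>One quarter of \<open>e\<close> goes to \<open>U\<close>, two to \<open>a X\<close>
  since \<open>X\<close> is at most 2 in modulus, and one to \<open>\<delta>\<close>.\<close>

lemma connection_close:
  assumes "cmod (poly U z - c) \<le> e / 4" "cmod (poly X z) \<le> 2" "0 \<le> a" "a \<le> e / 4" "cmod \<delta> \<le> e / 4"
  shows "cmod (poly (U + smult (of_real a) X + [:\<delta>:]) z - c) \<le> e"
proof -
  have "cmod (poly (U + smult (of_real a) X + [:\<delta>:]) z - c)
      = cmod ((poly U z - c) + (of_real a * poly X z + \<delta>))" by (simp add: algebra_simps)
  also have "\<dots> \<le> cmod (poly U z - c) + cmod (of_real a * poly X z + \<delta>)" by (rule norm_triangle_ineq)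
  also have "cmod (of_real a * poly X z + \<delta>) \<le> cmod (of_real a * poly X z) + cmod \<delta>"
    by (rule norm_triangle_ineq)
  also have "cmod (of_real a * poly X z) = a * cmod (poly X z)" using assms(3) by (simp add: norm_mult)
  also have "a * cmod (poly X z) \<le> (e / 4) * 2" using assms by (intro mult_mono) auto
  finally show ?thesis using assms by simp
qed

text \<open>The coefficients first grow as for \<open>v\<close>. From \<open>J1\<close> on, the
  exponentially small lower bounds keep squaring them, so that at the zero \<open>k = Suc l\<close>
  they can pay for the factor \<open>\<delta>\<close>, and they are still large at
  \<open>n = 2 * k\<close>. Once \<open>\<delta>\<close> makes the coefficient at \<open>n\<close>
  equal to 1, the growth of \<open>w\<close> takes over and makes the connection escape.\<close>

lemma transition_escaping:
  assumes v: "escaping v" and w: "escaping w" and deg: "degree v < degree w" and \<epsilon>: "\<epsilon> > 0"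
  shows "\<forall>\<^sub>F l in sequentially. \<exists>a \<delta>. 0 \<le> a \<and> a \<le> \<epsilon> \<and> cmod \<delta> \<le> \<epsilon> \<and>
    orbit_coeff (nat_values (connection v w l a \<delta>)) (2 * Suc l) = 1 \<and>
    escaping (connection v w l a \<delta>)"
proof -
  obtain \<kappa> J where \<kappa>: "\<kappa> > 0" "\<And>j. j \<ge> J \<Longrightarrow> \<kappa> \<le> cmod (nat_values v j)"
    "\<kappa> * cmod (orbit_coeff (nat_values v) J) > 1"
    using v by (auto simp: escaping_def)
  define c where "c = cmod (orbit_coeff (nat_values v) J)"
  \<comment> \<open>A point strictly between \<open>1 / \<kappa>\<close> and \<open>c\<close>: the
    product \<open>\<kappa> * c > 1\<close> keeps a margin, so that it remains above 1 when values
    and coefficient are perturbed.\<close>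
  define c1 where "c1 = (c + 1 / \<kappa>) / 2"
  have c: "1 / \<kappa> < c" using \<kappa> by (simp add: c_def field_simps)
  then have c1: "1 / \<kappa> < c1" "c1 < c" by (simp_all add: c1_def)
  then have c1pos: "c1 > 0" using \<kappa>(1) less_trans zero_less_divide_1_iff by blast
  have \<kappa>c1: "1 / c1 < \<kappa>" using c1(1) c1pos \<kappa>(1) by (simp add: field_simps)
  obtain d where d: "d > 0" "\<And>z. (\<And>j. j < J \<Longrightarrow> cmod (z j - nat_values v j) \<le> d) \<Longrightarrow>
      cmod (orbit_coeff z J - orbit_coeff (nat_values v) J) < c - c1"
    using orbit_coeff_perturb[of "c - c1" J "nat_values v"] c1(2) by auto
  define \<eta> where "\<eta> = min d ((\<kappa> - 1 / c1) / 2)"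
  have \<eta>: "\<eta> > 0" "\<eta> \<le> d" "\<eta> \<le> (\<kappa> - 1 / c1) / 2"
  proof -
    show "\<eta> > 0" using d(1) \<kappa>c1 by (simp add: \<eta>_def)
    show "\<eta> \<le> d" unfolding \<eta>_def by (rule min.cobounded1)
    show "\<eta> \<le> (\<kappa> - 1 / c1) / 2" unfolding \<eta>_def by (rule min.cobounded2)
  qed
  have \<kappa>\<eta>: "1 / c1 < \<kappa> - \<eta>" using \<eta>(3) \<kappa>c1 by simp
  have \<kappa>\<eta>pos: "\<kappa> - \<eta> > 0" using \<kappa>\<eta> c1pos less_trans zero_less_divide_1_iff by blast
  define \<tau> where "\<tau> = c1 * (\<kappa> - \<eta>)"
  have \<tau>: "\<tau> > 1" using \<kappa>\<eta> c1pos by (simp add: \<tau>_def field_simps)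
  have start: "\<tau> \<le> cmod (orbit_coeff z J) * (\<kappa> - \<eta>)"
    if "\<And>j. j < J \<Longrightarrow> cmod (z j - nat_values v j) \<le> \<eta>" for z
  proof -
    have "cmod (orbit_coeff z J - orbit_coeff (nat_values v) J) < c - c1"
      using that \<eta>(2) by (intro d(2)) (meson order_trans)
    then have "c1 \<le> cmod (orbit_coeff z J)"
      using norm_triangle_ineq2[of "orbit_coeff (nat_values v) J" "orbit_coeff z J"]
      by (simp add: c_def norm_minus_commute)
    then show ?thesis unfolding \<tau>_def using \<kappa>\<eta>pos by (intro mult_right_mono) auto
  qed
  obtain \<kappa>w where \<kappa>w: "\<kappa>w > 0" "\<And>j. \<kappa>w * (1 + real j) ^ degree w \<le> cmod (nat_values w j)"
    using poly_lower_bound[of w] escaping_nonzero[OF w] by metis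
  obtain J2 where J2: "8 / \<kappa>w < cmod (orbit_coeff (nat_values w) J2)"
    using escaping_orbit_coeff_unbounded[OF w] by blast
  obtain d2 where d2: "d2 > 0" "\<And>z. (\<And>j. j < J2 \<Longrightarrow> cmod (z j - nat_values w j) \<le> d2) \<Longrightarrow>
      cmod (orbit_coeff z J2 - orbit_coeff (nat_values w) J2) < 4 / \<kappa>w"
    using orbit_coeff_perturb[of "4 / \<kappa>w" J2 "nat_values w"] \<kappa>w(1) by auto
  \<comment> \<open>\<open>\<eta> / 4\<close> and \<open>d2 / 4\<close> are the shares of the
    perturbation near 0 and near the horizon, and \<open>\<kappa>w / 16\<close> keeps the values
    beyond the horizon large.\<close>
  define \<epsilon>' where "\<epsilon>' = Min {\<epsilon>, \<eta> / 4, \<kappa>w / 16, d2 / 4, 1}"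
  have \<epsilon>'pos: "\<epsilon>' > 0" using \<epsilon> \<eta>(1) \<kappa>w(1) d2(1) by (simp add: \<epsilon>'_def)
  have \<epsilon>': "\<epsilon>' \<le> \<epsilon>" "\<epsilon>' \<le> \<eta> / 4" "\<epsilon>' \<le> \<kappa>w / 16" "\<epsilon>' \<le> d2 / 4" "\<epsilon>' \<le> 1"
    by (simp_all add: \<epsilon>'_def)
  \<comment> \<open>Half of the constant \<open>\<epsilon>' / 6\<close> in the lower bound; the
    other half is left to \<open>\<delta>\<close>.\<close>
  define \<sigma> where "\<sigma> = \<epsilon>' / 12"
  have \<sigma>: "\<sigma> > 0" "\<sigma> \<le> \<epsilon>'" "\<sigma> \<le> 1" using \<epsilon>'pos \<epsilon>'(5) by (simp_all add: \<sigma>_def)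
  have "\<forall>\<^sub>F i in sequentially. (2 * \<kappa> * 16 ^ (J + 1) / \<sigma>) * 16 ^ i \<le> \<tau> ^ (2 ^ i)"
    by (rule double_exp_dominates[OF \<tau>])
  \<comment> \<open>\<open>v\<close> is followed for \<open>i0\<close> more steps, until the size
    normalised with the weaker weights (1/16)^j is at least 2.\<close>
  then obtain i0 where i0: "(2 * \<kappa> * 16 ^ (J + 1) / \<sigma>) * 16 ^ i0 \<le> \<tau> ^ (2 ^ i0)"
    by (auto simp: eventually_sequentially)
  define J1 where "J1 = J + i0"
  have "\<forall>\<^sub>F i in sequentially. (2 * 16 ^ J1) * 16 ^ i \<le> (2::real) ^ (2 ^ i)"
    by (rule double_exp_dominates) simp
  \<comment> \<open>From \<open>J1\<close> the normalised size reaches \<open>2 * 16 ^ k\<close> at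
    the zero \<open>k = J1 + i\<close>, which will pay for the factor lost there.\<close>
  then obtain i1 where i1: "\<And>i. i \<ge> i1 \<Longrightarrow> (2 * 16 ^ J1) * 16 ^ i \<le> (2::real) ^ (2 ^ i)"
    by (auto simp: eventually_sequentially)
  have "\<forall>\<^sub>F l in sequentially. J1 + i1 \<le> l" by (rule eventually_ge_at_top)
  moreover have "\<forall>\<^sub>F l in sequentially. \<forall>j<J1.
      cmod (nat_values (connect v w l) j - nat_values v j) \<le> \<eta> / 4 \<and> cmod (nat_values ((midfactor l)\<^sup>2) j) \<le> 2"
    using \<eta>(1) by (intro eventually_values_close connect_tendsto midfactor_square_tendsto) auto
  moreover have "\<forall>\<^sub>F l in sequentially. \<forall>j<J2.
      cmod (nat_values (connect v w l \<circ>\<^sub>p [:horizon l, 1:]) j - nat_values w j) \<le> d2 / 4 \<and>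
      cmod (nat_values ((midfactor l)\<^sup>2 \<circ>\<^sub>p [:horizon l, 1:]) j) \<le> 2"
    using d2(1) by (intro eventually_values_close connect_shift_tendsto midfactor_square_shift_tendsto) auto
  moreover note connect_tail[OF deg \<kappa>w]
  ultimately show ?thesis
  proof eventually_elim
    case (elim l)
    define k where "k = Suc l"
    define n where "n = 2 * k"
    have k: "J1 + i1 < k" "k < n" using elim(1) by (simp_all add: k_def n_def)
    obtain a where a: "0 \<le> a" "a \<le> \<epsilon>'" "\<And>j. j \<noteq> k \<Longrightarrow> j < n \<Longrightarrow>
        \<epsilon>' / 6 * (1/16) ^ j \<le> cmod (poly (connect v w l + smult (of_real a) ((midfactor l)\<^sup>2)) (of_nat j))"
      unfolding k_def using connect_avoids_zero[OF \<epsilon>'pos, of l n v w] by blast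
    define b where "b = nat_values (connect v w l + smult (of_real a) ((midfactor l)\<^sup>2))"
    have bk: "b k = 0" unfolding b_def k_def by (rule connect_midpoint)
    \<comment> \<open>As small as the smallest lower bound before \<open>n\<close>, so no
      \<open>\<delta>\<close> in the disc can cancel a value other than the one at
      \<open>k\<close>.\<close>
    define r where "r = \<sigma> * (1/16) ^ n"
    have r: "r > 0" "r \<le> \<epsilon>'"
    proof -
      show "r > 0" using \<sigma> by (simp add: r_def)
      have "\<sigma> * (1/16) ^ n \<le> \<sigma> * 1" using \<sigma> by (intro mult_left_mono power_le_one) auto
      then show "r \<le> \<epsilon>'" using \<sigma>(2) unfolding r_def by linarith
    qed
    have lower: "\<sigma> * (1/16) ^ j \<le> cmod (b j + \<delta>)" if "j \<noteq> k" "j < n" "cmod \<delta> \<le> r" for j \<delta>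
    proof -
      have "2 * (\<sigma> * (1/16) ^ j) \<le> cmod (b j)" using a(3)[OF that(1,2)] by (simp add: b_def \<sigma>_def)
      moreover have "r \<le> \<sigma> * (1/16) ^ j"
        unfolding r_def using that(2) \<sigma> by (intro mult_left_mono power_decreasing) auto
      ultimately show ?thesis
        using that(3) norm_triangle_ineq2[of "b j" "- \<delta>"] by simp
    qed
    have close: "cmod (b j + \<delta> - nat_values v j) \<le> \<eta>" if "j < J1" "cmod \<delta> \<le> r" for j \<delta>
    proof -
      have "cmod (poly (connect v w l + smult (of_real a) ((midfactor l)\<^sup>2) + [:\<delta>:]) (of_nat j) - nat_values v j) \<le> \<eta>"
        using elim(2) that a \<epsilon>'(2) r by (intro connection_close) auto
      then show ?thesis by (simp add: b_def)
    qed
    have d1: "2 \<le> cmod (orbit_coeff (\<lambda>j. b j + \<delta>) J1) * \<sigma> * (1/16) ^ (J1 + 1)" if "cmod \<delta> \<le> r" for \<delta>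
    proof -
      let ?z = "\<lambda>j. b j + \<delta>"
      have "\<tau> ^ (2 ^ i0) \<le> (cmod (orbit_coeff ?z J) * (\<kappa> - \<eta>) * 1 ^ (J + 1)) ^ (2 ^ i0)"
        using start[of ?z] close that \<tau> by (intro power_mono) (auto simp: J1_def)
      also have "\<dots> \<le> cmod (orbit_coeff ?z (J + i0)) * (\<kappa> - \<eta>) * 1 ^ (J + i0 + 1)"
      proof (rule orbit_coeff_growth)
        fix j assume j: "J \<le> j" "j < J + i0"
        have "cmod (?z j - nat_values v j) \<le> \<eta>" using close j that by (simp add: J1_def)
        moreover have "\<kappa> \<le> cmod (nat_values v j)" using \<kappa>(2) j by simp
        ultimately show "(\<kappa> - \<eta>) * 1 ^ j \<le> cmod (?z j)"
          using norm_triangle_ineq2[of "nat_values v j" "?z j"] by (simp add: norm_minus_commute)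
      qed (use \<kappa>\<eta>pos in auto)
      also have "\<dots> \<le> cmod (orbit_coeff ?z J1) * \<kappa>"
        using \<eta>(1) by (simp add: J1_def mult_left_mono)
      finally have "(2 * \<kappa> * 16 ^ (J + 1) / \<sigma>) * 16 ^ i0 \<le> cmod (orbit_coeff ?z J1) * \<kappa>"
        using i0 by linarith
      then have "\<kappa> * (2 * 16 ^ (J1 + 1) / \<sigma>) \<le> \<kappa> * cmod (orbit_coeff ?z J1)"
        by (simp add: J1_def power_add mult_ac)
      then have "2 * 16 ^ (J1 + 1) / \<sigma> \<le> cmod (orbit_coeff ?z J1)"
        by (simp only: mult_le_cancel_left_pos[OF \<kappa>(1)])
      then show ?thesis using \<sigma>(1) by (simp add: field_simps power_one_over)
    qed
    have big: "2 * cmod 1 < cmod (orbit_coeff (\<lambda>j. b j + \<delta>) n)" if "cmod \<delta> = r" for \<delta>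
    proof -
      let ?z = "\<lambda>j. b j + \<delta>"
      let ?d = "\<lambda>j. cmod (orbit_coeff ?z j) * \<sigma> * (1/16) ^ (j + 1)"
      obtain i where i: "k = J1 + i" "i \<ge> i1" using k(1) by (metis add_leD1 le_add1 less_imp_le nat_add_left_cancel_le le_Suc_ex)
      have "2 ^ (2 ^ i) \<le> ?d J1 ^ (2 ^ i)" using d1[of \<delta>] that by (intro power_mono) auto
      also have "\<dots> \<le> ?d (J1 + i)"
        using \<sigma>(1) lower that k i by (intro orbit_coeff_growth) auto
      finally have dk: "2 ^ (2 ^ i) \<le> ?d k" by (simp only: i(1))
      have "2 * 16 ^ k \<le> (2::real) ^ (2 ^ i)"
        using i1[OF i(2)] by (simp add: i(1) power_add)
      with dk have dk1: "2 * 16 ^ k \<le> ?d k" by linarith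
      moreover have "(1::real) \<le> 2 * 16 ^ k"
        using one_le_power[of "16::real" k] by linarith
      moreover have "x \<le> y\<^sup>2" if "x \<le> y" "1 \<le> x" for x y :: real
        using that self_le_power[of y 2] by linarith
      ultimately have dk2: "2 * 16 ^ k \<le> (?d k)\<^sup>2" by blast
      \<comment> \<open>At \<open>k\<close> the value has modulus
        \<open>\<sigma> * (1/16) ^ (2 * k)\<close> instead of \<open>\<sigma> * (1/16) ^ k\<close>;
        the squaring step loses exactly \<open>(1/16) ^ k\<close>.\<close>
      have dSk_eq: "?d (Suc k) = (?d k)\<^sup>2 * (1/16) ^ k"
      proof -
        have "?d (Suc k) = (cmod (orbit_coeff ?z k))\<^sup>2 * r * \<sigma> * (1/16) ^ (k + 2)"
          by (simp add: norm_mult norm_power bk that)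
        also have "\<dots> = (cmod (orbit_coeff ?z k))\<^sup>2 * \<sigma>\<^sup>2 * ((1/16) ^ (2 * k) * (1/16) ^ (k + 2))"
          by (simp add: r_def n_def power2_eq_square)
        also have "(1/16::real) ^ (2 * k) * (1/16) ^ (k + 2) = ((1/16) ^ (k + 1))\<^sup>2 * (1/16) ^ k"
          by (simp only: power_mult[symmetric] power_add[symmetric]) (simp add: algebra_simps)
        finally show ?thesis by (simp only: power_mult_distrib mult.assoc)
      qed
      have "(2 * 16 ^ k) * (1/16) ^ k \<le> (?d k)\<^sup>2 * (1/16) ^ k"
        by (intro mult_right_mono dk2) simp
      moreover have "(2 * 16 ^ k) * (1/16) ^ k = (2::real)" by (simp add: power_one_over)
      ultimately have dSk: "2 \<le> ?d (Suc k)" unfolding dSk_eq by simp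
      obtain i' where i': "n = Suc k + i'" using k(2) less_iff_Suc_add by (metis add_Suc)
      have "2 \<le> (2::real) ^ (2 ^ i')" using power_increasing[of 1 "2 ^ i'" "2::real"] by simp
      also have "\<dots> \<le> ?d (Suc k) ^ (2 ^ i')" using dSk by (intro power_mono) auto
      also have "\<dots> \<le> ?d (Suc k + i')"
        using \<sigma>(1) lower that i' by (intro orbit_coeff_growth) auto
      finally have "2 \<le> ?d n" by (simp only: i')
      also have "?d n \<le> cmod (orbit_coeff ?z n) * 1 * (1/16)"
        using \<sigma> by (intro mult_mono mult_left_mono) (auto intro: power_le_one)
      finally show ?thesis by simp
    qed
    have "orbit_coeff (\<lambda>j. b j + 0) n = 0"
      using bk k(2) by (intro orbit_coeff_eq_0[of _ k]) auto
    then obtain \<delta> where \<delta>: "cmod \<delta> \<le> r" "orbit_coeff (\<lambda>j. b j + \<delta>) n = 1"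
      using attains_value_in_disc[OF orbit_coeff_holomorphic[of b n UNIV] _ r(1) big] by blast
    define u where "u = connection v w l a \<delta>"
    have u: "nat_values u j = b j + \<delta>" for j by (simp add: u_def poly_connection b_def)
    \<comment> \<open>Beyond the horizon the values keep
      \<open>\<kappa>w / 2 - \<kappa>w / 16\<close>. As the coefficient at \<open>n\<close> is 1,
      the one at \<open>n + J2\<close> is that of a sequence close to \<open>w\<close>, hence above
      \<open>8 / \<kappa>w - 4 / \<kappa>w\<close>.\<close>
    have "escaping u"
      unfolding escaping_def
    proof (intro exI conjI allI impI)
      show "\<kappa>w / 4 > 0" using \<kappa>w by simp
      show "\<kappa>w / 4 \<le> cmod (nat_values u j)" if "n + J2 \<le> j" for j
      proof -
        have "2 * Suc l \<le> j" using that by (simp add: n_def k_def)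
        then obtain i where j: "j = 2 * Suc l + i" using le_Suc_ex by blast
        have "\<kappa>w / 2 \<le> cmod (b j)" unfolding b_def j using elim(4) a \<epsilon>'(3) by simp
        moreover have "cmod \<delta> \<le> \<kappa>w / 16" using \<delta>(1) r \<epsilon>'(3) by simp
        ultimately show ?thesis
          using norm_triangle_ineq2[of "b j" "- \<delta>"] \<kappa>w(1) by (simp add: u)
      qed
      have "cmod (nat_values u (n + j) - nat_values w j) \<le> d2" if "j < J2" for j
      proof -
        have e: "poly q (of_nat (n + j)) = poly (q \<circ>\<^sub>p [:horizon l, 1:]) (of_nat j)" for q :: "complex poly"
          by (simp add: poly_pcompose n_def k_def add.assoc)
        have "cmod (poly (connect v w l \<circ>\<^sub>p [:horizon l, 1:] + smult (of_real a) ((midfactor l)\<^sup>2 \<circ>\<^sub>p [:horizon l, 1:])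
            + [:\<delta>:]) (of_nat j) - nat_values w j) \<le> d2"
          using elim(3) that a \<epsilon>'(4) \<delta>(1) r by (intro connection_close) auto
        then show ?thesis
          unfolding u b_def poly_add poly_smult unfolding e by simp
      qed
      then have "cmod (orbit_coeff (\<lambda>j. nat_values u (n + j)) J2 - orbit_coeff (nat_values w) J2) < 4 / \<kappa>w"
        by (rule d2(2))
      then have "4 / \<kappa>w < cmod (orbit_coeff (\<lambda>j. nat_values u (n + j)) J2)"
        using J2 norm_triangle_ineq2[of "orbit_coeff (nat_values w) J2" "orbit_coeff (\<lambda>j. nat_values u (n + j)) J2"]
        by (simp add: norm_minus_commute)
      also have "orbit_coeff (\<lambda>j. nat_values u (n + j)) J2 = orbit_coeff (nat_values u) (n + J2)"
        unfolding orbit_coeff_add by (simp add: \<delta>(2) u)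
      finally show "1 < \<kappa>w / 4 * cmod (orbit_coeff (nat_values u) (n + J2))"
        using \<kappa>w(1) by (simp add: field_simps)
    qed
    moreover have "orbit_coeff (nat_values u) n = 1" using \<delta>(2) by (simp add: u)
    moreover have "a \<le> \<epsilon>" "cmod \<delta> \<le> \<epsilon>" using a(2) \<delta>(1) r(2) \<epsilon>'(1) by auto
    ultimately show ?case using a(1) unfolding u_def n_def k_def by blast
  qed
qed

text \<open>On the circle the coefficient is merely nonzero, hence bounded below by some
  \<open>m > 0\<close>. An element of \<open>\<Gamma>\<close> of modulus above \<open>2 / m\<close>
  makes \<open>1 / \<gamma>\<close> small enough to be attained in the disc.\<close>

lemma transition_unbounded:
  assumes \<Gamma>: "\<not> bounded \<Gamma>" and \<epsilon>: "\<epsilon> > 0"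
  shows "\<exists>a \<delta> \<gamma>. 0 \<le> a \<and> a \<le> \<epsilon> \<and> cmod \<delta> \<le> \<epsilon> \<and> \<gamma> \<in> \<Gamma> \<and>
    \<gamma> * orbit_coeff (nat_values (connection v w l a \<delta>)) (2 * Suc l) = 1"
proof -
  define k where "k = Suc l"
  define n where "n = 2 * k"
  have k: "k < n" by (simp add: k_def n_def)
  obtain a where a: "0 \<le> a" "a \<le> \<epsilon>" "\<And>j. j \<noteq> k \<Longrightarrow> j < n \<Longrightarrow>
      \<epsilon> / 6 * (1/16) ^ j \<le> cmod (poly (connect v w l + smult (of_real a) ((midfactor l)\<^sup>2)) (of_nat j))"
    unfolding k_def using connect_avoids_zero[OF \<epsilon>, of l n v w] by blast
  define b where "b = nat_values (connect v w l + smult (of_real a) ((midfactor l)\<^sup>2))"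
  have bk: "b k = 0" unfolding b_def k_def by (rule connect_midpoint)
  define r where "r = \<epsilon> / 12 * (1/16) ^ n"
  have r: "r > 0" "r \<le> \<epsilon>"
  proof -
    show "r > 0" using \<epsilon> by (simp add: r_def)
    have "\<epsilon> / 12 * (1/16) ^ n \<le> \<epsilon> / 12 * 1" using \<epsilon> by (intro mult_left_mono power_le_one) auto
    then show "r \<le> \<epsilon>" using \<epsilon> unfolding r_def by linarith
  qed
  have nz: "orbit_coeff (\<lambda>j. b j + \<delta>) n \<noteq> 0" if "cmod \<delta> = r" for \<delta>
  proof (rule orbit_coeff_nonzero)
    fix j assume j: "j < n"
    show "b j + \<delta> \<noteq> 0"
    proof (cases "j = k")
      case True
      then show ?thesis using bk that r(1) by auto
    next
      case False
      have "r < \<epsilon> / 6 * (1/16) ^ n" using \<epsilon> by (simp add: r_def)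
      also have "\<dots> \<le> \<epsilon> / 6 * (1/16) ^ j" using \<epsilon> j by (intro mult_left_mono power_decreasing) auto
      also have "\<dots> \<le> cmod (b j)" using a(3)[OF False j] by (simp add: b_def)
      finally show ?thesis using that by (metis add_eq_0_iff less_irrefl norm_minus_cancel)
    qed
  qed
  define f where "f = (\<lambda>\<delta>. orbit_coeff (\<lambda>j. b j + \<delta>) n)"
  have hol: "f holomorphic_on UNIV" unfolding f_def by (rule orbit_coeff_holomorphic)
  obtain m where m: "m > 0" "\<And>\<delta>. cmod \<delta> = r \<Longrightarrow> m \<le> cmod (f \<delta>)"
  proof -
    have "compact (sphere (0::complex) r)" "sphere (0::complex) r \<noteq> {}" using r by auto
    moreover have "continuous_on (sphere 0 r) (\<lambda>t. cmod (f t))"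
      by (intro continuous_intros holomorphic_on_imp_continuous_on holomorphic_on_subset[OF hol]) auto
    ultimately obtain t0 where t0: "t0 \<in> sphere 0 r" "\<And>t. t \<in> sphere 0 r \<Longrightarrow> cmod (f t0) \<le> cmod (f t)"
      using continuous_attains_inf by metis
    then show thesis using that[of "cmod (f t0)"] nz[of t0] by (simp add: f_def)
  qed
  obtain \<gamma> where \<gamma>: "\<gamma> \<in> \<Gamma>" "cmod \<gamma> > 2 / m"
    using \<Gamma> unfolding bounded_iff by (meson not_le)
  have \<gamma>pos: "cmod \<gamma> > 0" using \<gamma>(2) m(1) by (meson divide_pos_pos less_trans zero_less_numeral)
  then have "2 * cmod (1 / \<gamma>) < m" using \<gamma>(2) m(1) by (simp add: norm_divide field_simps)
  then have "2 * cmod (1 / \<gamma>) < cmod (f \<delta>)" if "cmod \<delta> = r" for \<delta>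
    using m(2)[OF that] by linarith
  moreover have "f 0 = 0" unfolding f_def using bk k by (intro orbit_coeff_eq_0[of _ k]) auto
  ultimately obtain \<delta> where \<delta>: "cmod \<delta> \<le> r" "f \<delta> = 1 / \<gamma>"
    using attains_value_in_disc[OF hol _ r(1)] by blast
  have "nat_values (connection v w l a \<delta>) = (\<lambda>j. b j + \<delta>)" by (simp add: poly_connection b_def)
  then have "\<gamma> * orbit_coeff (nat_values (connection v w l a \<delta>)) (2 * Suc l) = 1"
    using \<delta>(2) \<gamma>pos by (simp add: f_def n_def k_def)
  moreover have "cmod \<delta> \<le> \<epsilon>" using \<delta>(1) r(2) by simp
  ultimately show ?thesis using a(1,2) \<gamma>(1) by blast
qed

section \<open>The translation model\<close>

context frechet_seminorms
begin

text \<open>\<open>V\<close> itself need not be complete: the nested balls are centred in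
  \<open>V\<close>, but the limit of the centres may lie only in its closure.\<close>

lemma baire:
  assumes V: "V \<noteq> {}" and op: "\<And>i::nat. open (G i)"
    and dense: "\<And>i v k \<epsilon>. v \<in> V \<Longrightarrow> \<epsilon> > 0 \<Longrightarrow> \<exists>u\<in>V. p k (u - v) < \<epsilon> \<and> u \<in> G i"
  obtains x where "\<And>i. x \<in> G i"
proof -
  define P where "P = (\<lambda>(n::nat) (u, k::nat, r::real). u \<in> V \<and> r > 0)"
  \<comment> \<open>The index grows beyond every seminorm while the radius tends to 0, which makes
    the centres Cauchy in all seminorms.\<close>
  define R where "R = (\<lambda>n (u, k, r) (u', k', r'). Suc n \<le> k' \<and> r' \<le> (1/2) ^ n \<and>
    (\<forall>x. p k' (x - u') \<le> r' \<longrightarrow> x \<in> G n \<and> p k (x - u) \<le> r))"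
  have "\<exists>s. \<forall>n. P n (s n) \<and> R n (s n) (s (Suc n))"
  proof (rule dependent_nat_choice)
    obtain v where "v \<in> V" using V by blast
    then show "\<exists>s. P 0 s" by (intro exI[of _ "(v, 0, 1)"]) (simp add: P_def)
  next
    fix s n assume "P n s"
    moreover obtain u k r where s: "s = (u, k, r)" by (cases s)
    ultimately have u: "u \<in> V" "r > 0" by (auto simp: P_def)
    obtain u' where u': "u' \<in> V" "p k (u' - u) < r / 2" "u' \<in> G n"
      using dense[OF u(1), of "r / 2" k n] u(2) by auto
    obtain k1 e1 where e1: "e1 > 0" "\<And>y. p k1 (y - u') < e1 \<Longrightarrow> y \<in> G n"
      using open_contains_p_ball[OF op u'(3)] by metis
    define k' where "k' = max k (max k1 (Suc n))"
    define r' where "r' = min (r / 2) (min (e1 / 2) ((1/2) ^ n))"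
    have k': "k \<le> k'" "k1 \<le> k'" "Suc n \<le> k'" by (auto simp: k'_def)
    have r': "r' > 0" "r' \<le> r / 2" "r' \<le> e1 / 2" "r' \<le> (1/2) ^ n" using u e1 by (auto simp: r'_def)
    have "x \<in> G n \<and> p k (x - u) \<le> r" if "p k' (x - u') \<le> r'" for x
    proof
      show "x \<in> G n" using p_mono[OF k'(2), of "x - u'"] that r' e1 by (intro e1(2)) auto
      show "p k (x - u) \<le> r"
        using p_diff_triangle[of k x u u'] p_mono[OF k'(1), of "x - u'"] that r' u'(2) by linarith
    qed
    then have "P (Suc n) (u', k', r') \<and> R n s (u', k', r')"
      using u' r' k' by (auto simp: P_def R_def s)
    then show "\<exists>s'. P (Suc n) s' \<and> R n s s'" by blast
  qed
  then obtain s where s: "\<And>n. P n (s n)" "\<And>n. R n (s n) (s (Suc n))" by blast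
  define u where "u = (\<lambda>n. fst (s n))"
  define k where "k = (\<lambda>n. fst (snd (s n)))"
  define r where "r = (\<lambda>n. snd (snd (s n)))"
  have su: "s n = (u n, k n, r n)" for n by (simp add: u_def k_def r_def)
  have r: "r n > 0" for n using s(1)[of n] by (simp add: su P_def)
  have kS: "Suc n \<le> k (Suc n)" and rS: "r (Suc n) \<le> (1/2) ^ n"
    and inG: "p (k (Suc n)) (x - u (Suc n)) \<le> r (Suc n) \<Longrightarrow> x \<in> G n"
    and nested: "p (k (Suc n)) (x - u (Suc n)) \<le> r (Suc n) \<Longrightarrow> p (k n) (x - u n) \<le> r n" for n x
    using s(2)[of n] by (simp_all add: su R_def)
  have nest: "p (k m) (x - u m) \<le> r m \<Longrightarrow> p (k n) (x - u n) \<le> r n" if "n \<le> m" for n m x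
    using that by (induction m rule: dec_induct) (auto intro: nested)
  have um: "p (k n) (u m - u n) \<le> r n" if "n \<le> m" for n m
    using nest[OF that, of "u m"] r[of m] by simp
  obtain x where x: "u \<longlonglongrightarrow> x"
  proof (rule p_Cauchy_convergent[of u])
    fix K and e :: real assume "e > 0"
    obtain n0 where n0: "(1/2) ^ n0 < e / 2" using real_arch_pow_inv[of "e / 2" "1/2"] \<open>e > 0\<close> by auto
    define n where "n = max n0 K"
    have rn: "r (Suc n) < e / 2"
    proof -
      have "r (Suc n) \<le> (1/2) ^ n" by (rule rS)
      also have "\<dots> \<le> (1/2) ^ n0" by (intro power_decreasing) (auto simp: n_def)
      finally show ?thesis using n0 by simp
    qed
    have "K \<le> k (Suc n)" using kS[of n] by (simp add: n_def)
    have "p K (u i - u j) < e" if "Suc n \<le> i" "Suc n \<le> j" for i j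
    proof -
      have "p K (u i - u j) \<le> p (k (Suc n)) (u i - u j)" by (rule p_mono[OF \<open>K \<le> _\<close>])
      also have "\<dots> \<le> p (k (Suc n)) (u i - u (Suc n)) + p (k (Suc n)) (u (Suc n) - u j)"
        by (rule p_diff_triangle)
      also have "\<dots> \<le> r (Suc n) + r (Suc n)"
        using um[OF that(1)] um[OF that(2)] p_commute[of "k (Suc n)" "u (Suc n)" "u j"]
        by (intro add_mono) auto
      finally show ?thesis using rn by simp
    qed
    then show "\<exists>N. \<forall>i\<ge>N. \<forall>j\<ge>N. p K (u i - u j) < e" by blast
  qed blast
  have "x \<in> G n" for n
  proof (rule inG)
    have "(\<lambda>m. p (k (Suc n)) (u m - u (Suc n))) \<longlonglongrightarrow> p (k (Suc n)) (x - u (Suc n))"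
      by (rule continuous_on_tendsto_compose[OF continuous_p tendsto_diff[OF x tendsto_const]]) auto
    then show "p (k (Suc n)) (x - u (Suc n)) \<le> r (Suc n)"
      by (rule LIMSEQ_le_const2) (use um in blast)
  qed
  then show thesis using that by blast
qed

lemma closure_p_iff: "y \<in> closure S \<longleftrightarrow> (\<forall>k. \<forall>e>0. \<exists>x\<in>S. p k (x - y) < e)"
proof
  assume y: "y \<in> closure S"
  show "\<forall>k. \<forall>e>0. \<exists>x\<in>S. p k (x - y) < e"
  proof (intro allI impI)
    fix k and e :: real assume "e > 0"
    then have "y \<in> {x. p k (x - y) < e}" by simp
    with y open_p_ball[of k y e] show "\<exists>x\<in>S. p k (x - y) < e"
      using open_Int_closure_eq_empty[of "{x. p k (x - y) < e}" S] by blast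
  qed
next
  assume *: "\<forall>k. \<forall>e>0. \<exists>x\<in>S. p k (x - y) < e"
  show "y \<in> closure S"
  proof (rule ccontr)
    assume "y \<notin> closure S"
    then have "open (- closure S)" "y \<in> - closure S" by auto
    then obtain k e where "e > 0" "\<And>x. p k (x - y) < e \<Longrightarrow> x \<in> - closure S"
      using open_contains_p_ball by metis
    with * show False using closure_subset[of S] by blast
  qed
qed

end

section \<open>The quadratic polynomial and its orbits on polynomial vectors\<close>

locale translation_model = frechet_seminorms smul p
  for smul :: "complex \<Rightarrow> 'a::{topological_ab_group_add, t2_space} \<Rightarrow> 'a"
    and p :: "nat \<Rightarrow> 'a \<Rightarrow> real" +
  fixes T :: "'a \<Rightarrow> 'a" and \<alpha> :: "'a \<Rightarrow> complex" and vec :: "complex poly \<Rightarrow> 'a"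
  assumes linear_T: "Vector_Spaces.linear smul smul T"
    and continuous_T: "continuous_on UNIV T"
    and linear_\<alpha>: "Vector_Spaces.linear smul (*) \<alpha>"
    and continuous_\<alpha>: "continuous_on UNIV \<alpha>"
    and vec_add: "vec (u + v) = vec u + vec v"
    and vec_smult: "vec (smult c u) = smul c (vec u)"
    and T_vec: "T (vec u) = vec (u \<circ>\<^sub>p [:1, 1:])"
    and \<alpha>_vec: "\<alpha> (vec u) = poly u 0"
    and vec_dense: "\<epsilon> > 0 \<Longrightarrow> \<exists>u. p k (vec u - y) < \<epsilon>"
    and dense_sequence: "\<exists>y :: nat \<Rightarrow> 'a. \<forall>x k \<epsilon>. \<epsilon> > 0 \<longrightarrow> (\<exists>n. p k (y n - x) < \<epsilon>)"
begin

definition Q :: "'a \<Rightarrow> 'a" where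
  "Q x = smul (\<alpha> x) (T x)"

lemma T_scale: "T (smul c x) = smul c (T x)"
  using linear_T by (simp add: linear_self_iff)

lemma \<alpha>_scale: "\<alpha> (smul c x) = c * \<alpha> x"
  using linear_\<alpha> by (simp add: linear_functional_iff)

lemma homogeneous_Q: "homogeneous_polynomial smul 2 Q"
  unfolding homogeneous_polynomial_def
proof (intro exI conjI allI)
  let ?A = "\<lambda>xs. smul (\<alpha> (xs ! 0)) (T (xs ! 1))"
  have "Vector_Spaces.linear smul smul (\<lambda>y. ?A (xs[i := y]))"
    if "length xs = 2" "i < 2" for xs :: "'a list" and i
  proof -
    have "i = 0 \<or> i = 1" using that(2) by auto
    then show ?thesis
      using that linear_T linear_\<alpha>
      by (auto simp: linear_self_iff linear_functional_iff scale_left_distrib scale_right_distrib mult.commute)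
  qed
  then show "multilinear smul 2 ?A" by (auto simp: multilinear_def)
  show "Q x = ?A (replicate 2 x)" for x by (simp add: Q_def numeral_2_eq_2)
qed

lemma continuous_Q: "continuous_on UNIV Q"
  unfolding Q_def[abs_def] by (intro continuous_on_smul continuous_T continuous_\<alpha>)

lemma continuous_Q_iter: "continuous_on UNIV (Q ^^ n)"
proof (induction n)
  case (Suc n)
  have "continuous_on UNIV (Q \<circ> (Q ^^ n))"
    by (intro continuous_on_compose Suc continuous_on_subset[OF continuous_Q]) auto
  then show ?case by (simp add: o_def)
qed (auto simp: id_def continuous_on_id)

lemma vec_0: "vec 0 = 0"
  using vec_smult[of 0 0] by simp

lemma vec_sum: "vec (sum f A) = (\<Sum>i\<in>A. vec (f i))"
  by (induction A rule: infinite_finite_induct) (simp_all add: vec_0 vec_add)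

lemma Q_iter_vec:
  "(Q ^^ n) (vec u) = smul (orbit_coeff (nat_values u) n) (vec (u \<circ>\<^sub>p [:of_nat n, 1:]))"
proof (induction n)
  case 0
  show ?case by (simp add: pcompose_idR)
next
  case (Suc n)
  let ?q = "u \<circ>\<^sub>p [:of_nat n, 1:]"
  have "?q \<circ>\<^sub>p [:1, 1:] = u \<circ>\<^sub>p [:of_nat (Suc n), 1:]"
    by (simp add: pcompose_assoc[symmetric] pcompose_pCons add.commute)
  moreover have "poly ?q 0 = poly u (of_nat n)" by (simp add: poly_pcompose)
  moreover have "(Q ^^ Suc n) (vec u) = Q ((Q ^^ n) (vec u))" by simp
  ultimately show ?case
    unfolding Suc.IH Q_def by (simp add: T_scale \<alpha>_scale T_vec \<alpha>_vec power2_eq_square mult_ac)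
qed

text \<open>Bounded degree reduces the claim to a finite sum of fixed vectors with convergent
  scalars; linearity of \<open>vec\<close> then suffices.\<close>

lemma vec_tendsto:
  assumes "poly_tendsto U u"
  shows "(\<lambda>l. vec (U l)) \<longlonglongrightarrow> vec u"
proof -
  obtain d where d: "\<And>l. degree (U l) \<le> d" and lim: "\<And>i. (\<lambda>l. coeff (U l) i) \<longlonglongrightarrow> coeff u i"
    using assms by (auto simp: poly_tendsto_def)
  define e where "e = max d (degree u)"
  have e: "vec q = (\<Sum>i\<le>e. smul (coeff q i) (vec (monom 1 i)))" if "degree q \<le> e" for q
  proof -
    have "q = (\<Sum>i\<le>e. smult (coeff q i) (monom 1 i))"
      using poly_as_sum_of_monoms'[OF that] by (simp add: smult_monom)
    then have "vec q = vec (\<Sum>i\<le>e. smult (coeff q i) (monom 1 i))" by simp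
    then show ?thesis by (simp only: vec_sum vec_smult)
  qed
  have "(\<lambda>l. \<Sum>i\<le>e. smul (coeff (U l) i) (vec (monom 1 i))) \<longlonglongrightarrow> (\<Sum>i\<le>e. smul (coeff u i) (vec (monom 1 i)))"
    by (intro tendsto_sum tendsto_smul lim tendsto_const)
  moreover have "degree (U l) \<le> e" for l using d[of l] by (simp add: e_def)
  moreover have "degree u \<le> e" by (simp add: e_def)
  ultimately show ?thesis using e by simp
qed

text \<open>The tolerance is fixed before \<open>l\<close> and is uniform in \<open>a\<close> and
  \<open>\<delta>\<close>, because both parameters are chosen only after \<open>l\<close>.\<close>

lemma vec_perturbation_close:
  assumes U: "poly_tendsto U u" and X: "poly_tendsto X 1" and e: "e > 0"
  shows "\<exists>\<epsilon>>0. \<forall>\<^sub>F l in sequentially. \<forall>a \<delta>. 0 \<le> a \<and> a \<le> \<epsilon> \<and> cmod \<delta> \<le> \<epsilon> \<longrightarrow>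
    p k (vec (U l + smult (of_real a) (X l) + [:\<delta>:]) - vec u) < e"
proof (intro exI conjI)
  define A where "A = p k (vec 1)"
  define \<epsilon> where "\<epsilon> = (e / 4) / (A + 1)"
  have A: "A + 1 > 0" unfolding A_def using p_nonneg[of k "vec 1"] by linarith
  show "\<epsilon> > 0" using A e by (simp add: \<epsilon>_def)
  have \<epsilon>A: "\<epsilon> * (A + 1) = e / 4" using A \<epsilon>_def by (metis less_irrefl nonzero_eq_divide_eq)
  have "(\<lambda>l. p k (vec (U l) - vec u)) \<longlonglongrightarrow> 0"
    using vec_tendsto[OF U] unfolding tendsto_p_iff by blast
  then have 1: "\<forall>\<^sub>F l in sequentially. p k (vec (U l) - vec u) < e / 2"
    using e by (intro order_tendstoD(2)) auto
  have "(\<lambda>l. p k (vec (X l) - vec 1)) \<longlonglongrightarrow> 0"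
    using vec_tendsto[OF X] unfolding tendsto_p_iff by blast
  then have 2: "\<forall>\<^sub>F l in sequentially. p k (vec (X l) - vec 1) < 1"
    by (intro order_tendstoD(2)) auto
  show "\<forall>\<^sub>F l in sequentially. \<forall>a \<delta>. 0 \<le> a \<and> a \<le> \<epsilon> \<and> cmod \<delta> \<le> \<epsilon> \<longrightarrow>
    p k (vec (U l + smult (of_real a) (X l) + [:\<delta>:]) - vec u) < e"
    using 1 2
  proof (eventually_elim, intro allI impI, elim conjE)
    fix l a \<delta>
    assume l: "p k (vec (U l) - vec u) < e / 2" "p k (vec (X l) - vec 1) < 1"
      and a: "0 \<le> a" "a \<le> \<epsilon>" "cmod \<delta> \<le> \<epsilon>"
    have X1: "p k (vec (X l)) \<le> A + 1"
      using p_triangle[of k "vec (X l) - vec 1" "vec 1"] l(2) by (simp add: A_def)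
    have "[:\<delta>:] = smult \<delta> 1" by (simp add: one_pCons)
    then have eq: "vec (U l + smult (of_real a) (X l) + [:\<delta>:]) - vec u
        = (vec (U l) - vec u) + (smul (of_real a) (vec (X l)) + smul \<delta> (vec 1))"
      by (simp only: vec_add vec_smult) (simp add: algebra_simps)
    have "p k (vec (U l + smult (of_real a) (X l) + [:\<delta>:]) - vec u)
        \<le> p k (vec (U l) - vec u) + (p k (smul (of_real a) (vec (X l))) + p k (smul \<delta> (vec 1)))"
      unfolding eq
      using p_triangle[of k "vec (U l) - vec u" "smul (of_real a) (vec (X l)) + smul \<delta> (vec 1)"]
        p_triangle[of k "smul (of_real a) (vec (X l))" "smul \<delta> (vec 1)"] by linarith
    also have "p k (smul (of_real a) (vec (X l))) \<le> \<epsilon> * (A + 1)"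
      using a X1 A by (simp add: mult_mono)
    also have "p k (smul \<delta> (vec 1)) \<le> \<epsilon> * (A + 1)"
      using a A by (simp add: A_def mult_mono)
    finally show "p k (vec (U l + smult (of_real a) (X l) + [:\<delta>:]) - vec u) < e"
      using l(1) \<epsilon>A by simp
  qed
qed

lemma connection_shift:
  "connection v w l a \<delta> \<circ>\<^sub>p [:horizon l, 1:]
     = connect v w l \<circ>\<^sub>p [:horizon l, 1:] + smult (of_real a) ((midfactor l)\<^sup>2 \<circ>\<^sub>p [:horizon l, 1:]) + [:\<delta>:]"
  unfolding connection_def pcompose_add pcompose_smult by (simp add: pcompose_const)

lemma vec_connection_close:
  assumes e: "e > 0"
  obtains \<epsilon> where "\<epsilon> > 0" "\<forall>\<^sub>F l in sequentially. \<forall>a \<delta>. 0 \<le> a \<and> a \<le> \<epsilon> \<and> cmod \<delta> \<le> \<epsilon> \<longrightarrow>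
    p k (vec (connection v w l a \<delta>) - vec v) < e \<and>
    p k (vec (connection v w l a \<delta> \<circ>\<^sub>p [:horizon l, 1:]) - vec w) < e"
proof -
  obtain \<epsilon>1 where 1: "\<epsilon>1 > 0" "\<forall>\<^sub>F l in sequentially. \<forall>a \<delta>. 0 \<le> a \<and> a \<le> \<epsilon>1 \<and> cmod \<delta> \<le> \<epsilon>1 \<longrightarrow>
      p k (vec (connection v w l a \<delta>) - vec v) < e"
    using vec_perturbation_close[OF connect_tendsto[of v w] midfactor_square_tendsto e, of k]
    unfolding connection_def by blast
  obtain \<epsilon>2 where 2: "\<epsilon>2 > 0" "\<forall>\<^sub>F l in sequentially. \<forall>a \<delta>. 0 \<le> a \<and> a \<le> \<epsilon>2 \<and> cmod \<delta> \<le> \<epsilon>2 \<longrightarrow>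
      p k (vec (connection v w l a \<delta> \<circ>\<^sub>p [:horizon l, 1:]) - vec w) < e"
    using vec_perturbation_close[OF connect_shift_tendsto[of v w] midfactor_square_shift_tendsto e, of k]
    unfolding connection_shift by blast
  show thesis
  proof (rule that[of "min \<epsilon>1 \<epsilon>2"])
    show "min \<epsilon>1 \<epsilon>2 > 0" using 1 2 by simp
    show "\<forall>\<^sub>F l in sequentially. \<forall>a \<delta>. 0 \<le> a \<and> a \<le> min \<epsilon>1 \<epsilon>2 \<and> cmod \<delta> \<le> min \<epsilon>1 \<epsilon>2 \<longrightarrow>
      p k (vec (connection v w l a \<delta>) - vec v) < e \<and>
      p k (vec (connection v w l a \<delta> \<circ>\<^sub>p [:horizon l, 1:]) - vec w) < e"
      using 1(2) 2(2) by eventually_elim simp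
  qed
qed

lemma Q_iter_connection:
  "(Q ^^ (2 * Suc l)) (vec (connection v w l a \<delta>)) =
     smul (orbit_coeff (nat_values (connection v w l a \<delta>)) (2 * Suc l))
       (vec (connection v w l a \<delta> \<circ>\<^sub>p [:horizon l, 1:]))"
  by (rule Q_iter_vec)

text \<open>Targets of arbitrarily large degree are needed because \<open>transition_escaping\<close> requires the
  degree to increase.\<close>

definition approachable :: "'a \<Rightarrow> nat \<Rightarrow> real \<Rightarrow> bool" where
  "approachable y k \<epsilon> \<longleftrightarrow> (\<forall>M. \<exists>w. escaping w \<and> M \<le> degree w \<and> p k (vec w - y) < \<epsilon>)"

text \<open>Topological transitivity within the escaping vectors. Since \<open>u\<close> escapes
  again, the Baire construction can continue from it.\<close>

lemma escaping_transitive: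
  assumes v: "escaping v" and y: "approachable y k r" and e: "e > 0"
  obtains u n where "escaping u" "p j (vec u - vec v) < e" "p k ((Q ^^ n) (vec u) - y) < r"
proof -
  obtain w where w: "escaping w" "Suc (degree v) \<le> degree w" "p k (vec w - y) < r"
    using y unfolding approachable_def by blast
  define s where "s = min e (r - p k (vec w - y))"
  have s: "s > 0" "s \<le> e" "s \<le> r - p k (vec w - y)" using e w(3) by (simp_all add: s_def)
  define m where "m = max j k"
  obtain \<epsilon> where \<epsilon>: "\<epsilon> > 0" and close: "\<forall>\<^sub>F l in sequentially. \<forall>a \<delta>. 0 \<le> a \<and> a \<le> \<epsilon> \<and> cmod \<delta> \<le> \<epsilon> \<longrightarrow>
    p m (vec (connection v w l a \<delta>) - vec v) < s \<and>
    p m (vec (connection v w l a \<delta> \<circ>\<^sub>p [:horizon l, 1:]) - vec w) < s"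
    using vec_connection_close[OF s(1), of m v w] by blast
  have "degree v < degree w" using w(2) by simp
  then have "\<forall>\<^sub>F l in sequentially. \<exists>a \<delta>. p m (vec (connection v w l a \<delta>) - vec v) < s \<and>
      p m (vec (connection v w l a \<delta> \<circ>\<^sub>p [:horizon l, 1:]) - vec w) < s \<and>
      orbit_coeff (nat_values (connection v w l a \<delta>)) (2 * Suc l) = 1 \<and> escaping (connection v w l a \<delta>)"
    using eventually_conj[OF close transition_escaping[OF v w(1) _ \<epsilon>]]
    by (auto elim!: eventually_mono)
  then obtain l where "\<exists>a \<delta>. p m (vec (connection v w l a \<delta>) - vec v) < s \<and>
      p m (vec (connection v w l a \<delta> \<circ>\<^sub>p [:horizon l, 1:]) - vec w) < s \<and>
      orbit_coeff (nat_values (connection v w l a \<delta>)) (2 * Suc l) = 1 \<and> escaping (connection v w l a \<delta>)"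
    using eventually_happens'[OF sequentially_bot] by blast
  then obtain a \<delta> where u: "p m (vec (connection v w l a \<delta>) - vec v) < s"
      "p m (vec (connection v w l a \<delta> \<circ>\<^sub>p [:horizon l, 1:]) - vec w) < s"
      "orbit_coeff (nat_values (connection v w l a \<delta>)) (2 * Suc l) = 1" "escaping (connection v w l a \<delta>)"
    by blast
  let ?u = "connection v w l a \<delta>"
  have "(Q ^^ (2 * Suc l)) (vec ?u) = vec (?u \<circ>\<^sub>p [:horizon l, 1:])"
    unfolding Q_iter_connection u(3) by simp
  then have "p k ((Q ^^ (2 * Suc l)) (vec ?u) - vec w) < s"
    using u(2) p_mono[of k m] by (metis m_def max.cobounded2 order_le_less_trans)
  then have "p k ((Q ^^ (2 * Suc l)) (vec ?u) - y) < r"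
    using p_diff_triangle[of k "(Q ^^ (2 * Suc l)) (vec ?u)" y "vec w"] s(3) by linarith
  moreover have "p j (vec ?u - vec v) < e"
    using u(1) s(2) p_mono[of j m "vec ?u - vec v"] by (simp add: m_def)
  ultimately show thesis using that u(4) by blast
qed

lemma escaping_const: "escaping [:2:]"
  unfolding escaping_def by (intro exI[of _ 2] conjI exI[of _ 0]) auto

text \<open>The window for the rational radius makes the \<open>\<epsilon>\<close>-ball about
  \<open>x\<close> lie in the ball about \<open>y i\<close> (as 1 + 1/4 = 5/4), and the latter in
  the \<open>2 * \<epsilon>\<close>-ball about \<open>x\<close> (as 7/4 + 1/4 = 2).\<close>

lemma countable_targets:
  obtains y :: "nat \<Rightarrow> 'a" and j :: "nat \<Rightarrow> nat" and r :: "nat \<Rightarrow> real"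
  where "\<And>x k \<epsilon>. \<epsilon> > 0 \<Longrightarrow> \<exists>i. j i = k \<and> p k (y i - x) < \<epsilon> / 4 \<and> 5/4 * \<epsilon> < r i \<and> r i < 7/4 * \<epsilon>"
proof -
  obtain z :: "nat \<Rightarrow> 'a" where z: "\<And>x k \<epsilon>. \<epsilon> > 0 \<Longrightarrow> \<exists>n. p k (z n - x) < \<epsilon>"
    using dense_sequence by blast
  define y where "y = (\<lambda>i. z (fst (prod_decode i)))"
  define j where "j = (\<lambda>i. fst (prod_decode (snd (prod_decode i))))"
  define r where "r = (\<lambda>i. real_of_rat (nat_to_rat_surj (snd (prod_decode (snd (prod_decode i))))))"
  have "\<exists>i. j i = k \<and> p k (y i - x) < \<epsilon> / 4 \<and> 5/4 * \<epsilon> < r i \<and> r i < 7/4 * \<epsilon>" if \<epsilon>: "\<epsilon> > 0" for x k \<epsilon>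
  proof -
    obtain a where a: "p k (z a - x) < \<epsilon> / 4" using z[of "\<epsilon> / 4"] \<epsilon> by auto
    obtain q where q: "5/4 * \<epsilon> < real_of_rat q" "real_of_rat q < 7/4 * \<epsilon>"
      using of_rat_dense[of "5/4 * \<epsilon>" "7/4 * \<epsilon>"] \<epsilon> by auto
    obtain c where c: "q = nat_to_rat_surj c" using surj_nat_to_rat_surj by (metis surjD)
    show ?thesis
      by (rule exI[of _ "prod_encode (a, prod_encode (k, c))"])
        (use a q c in \<open>simp add: y_def j_def r_def\<close>)
  qed
  then show thesis using that by blast
qed

text \<open>One orbit serves all approachable targets. Only countably many open conditions can be
  imposed, and passing to nearby centres and rational radii costs the factor 2.\<close>

lemma orbit_approximates:
  obtains x where "\<And>y k \<epsilon>. \<epsilon> > 0 \<Longrightarrow> approachable y k \<epsilon> \<Longrightarrow> \<exists>n. p k ((Q ^^ n) x - y) < 2 * \<epsilon>"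
proof (rule countable_targets)
  fix y :: "nat \<Rightarrow> 'a" and j :: "nat \<Rightarrow> nat" and r :: "nat \<Rightarrow> real"
  assume targets:
    "\<And>x k \<epsilon>. \<epsilon> > 0 \<Longrightarrow> \<exists>i. j i = k \<and> p k (y i - x) < \<epsilon> / 4 \<and> 5/4 * \<epsilon> < r i \<and> r i < 7/4 * \<epsilon>"
  define G where "G = (\<lambda>i. if approachable (y i) (j i) (r i)
    then \<Union>n. (Q ^^ n) -` {x. p (j i) (x - y i) < r i} else UNIV)"
  obtain x where x: "\<And>i. x \<in> G i"
  proof (rule baire[of "vec ` {u. escaping u}" G])
    show "vec ` {u. escaping u} \<noteq> {}" using escaping_const by blast
    show "open (G i)" for i
    proof (cases "approachable (y i) (j i) (r i)")
      case True
      have "open (\<Union>n. (Q ^^ n) -` {x. p (j i) (x - y i) < r i})"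
        by (intro open_UN ballI open_vimage open_p_ball continuous_Q_iter)
      then show ?thesis unfolding G_def using True by (simp only: if_True)
    qed (simp add: G_def)
    fix i v k and \<epsilon> :: real
    assume v: "v \<in> vec ` {u. escaping u}" and \<epsilon>: "\<epsilon> > 0"
    then obtain v' where v': "v = vec v'" "escaping v'" by blast
    show "\<exists>u\<in>vec ` {u. escaping u}. p k (u - v) < \<epsilon> \<and> u \<in> G i"
    proof (cases "approachable (y i) (j i) (r i)")
      case True
      obtain u n where "escaping u" "p k (vec u - vec v') < \<epsilon>" "p (j i) ((Q ^^ n) (vec u) - y i) < r i"
        using escaping_transitive[OF v'(2) True \<epsilon>] by blast
      then show ?thesis using True v' by (auto simp: G_def)
    next
      case False
      then show ?thesis using v \<epsilon> by (intro bexI[of _ v]) (auto simp: G_def)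
    qed
  qed (rule that)
  have "\<exists>n. p k ((Q ^^ n) x - z) < 2 * \<epsilon>" if \<epsilon>: "\<epsilon> > 0" and z: "approachable z k \<epsilon>" for z k \<epsilon>
  proof -
    obtain i where i: "j i = k" "p k (y i - z) < \<epsilon> / 4" "5/4 * \<epsilon> < r i" "r i < 7/4 * \<epsilon>"
      using targets[OF \<epsilon>] by blast
    have "approachable (y i) (j i) (r i)"
      unfolding approachable_def
    proof
      fix M
      obtain w where w: "escaping w" "M \<le> degree w" "p k (vec w - z) < \<epsilon>"
        using z unfolding approachable_def by blast
      have "p k (vec w - y i) < r i"
        using p_diff_triangle[of k "vec w" "y i" z] p_commute[of k z "y i"] w(3) i by linarith
      then show "\<exists>w. escaping w \<and> M \<le> degree w \<and> p (j i) (vec w - y i) < r i" using w i(1) by blast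
    qed
    then obtain n where "p k ((Q ^^ n) x - y i) < r i" using x[of i] i(1) by (auto simp: G_def)
    then have "p k ((Q ^^ n) x - z) < 2 * \<epsilon>"
      using p_diff_triangle[of k "(Q ^^ n) x" z "y i"] i by linarith
    then show ?thesis by blast
  qed
  then show thesis using that by blast
qed

text \<open>The Baire argument runs over all polynomial vectors, with no growth condition, since
  \<open>\<gamma>\<close> cancels the coefficient. The resulting \<open>x\<close> depends on
  \<open>\<Gamma>\<close>.\<close>

lemma supercyclic_unbounded:
  assumes \<Gamma>: "\<not> bounded \<Gamma>"
  shows "supercyclic smul \<Gamma> Q"
proof (rule countable_targets)
  fix y :: "nat \<Rightarrow> 'a" and j :: "nat \<Rightarrow> nat" and r :: "nat \<Rightarrow> real"
  assume targets:
    "\<And>x k \<epsilon>. \<epsilon> > 0 \<Longrightarrow> \<exists>i. j i = k \<and> p k (y i - x) < \<epsilon> / 4 \<and> 5/4 * \<epsilon> < r i \<and> r i < 7/4 * \<epsilon>"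
  \<comment> \<open>The enumerated radii run through all rationals; nonpositive ones impose no
    condition.\<close>
  define G where "G = (\<lambda>i. if 0 < r i
    then \<Union>n. \<Union>\<gamma>\<in>\<Gamma>. (\<lambda>x. smul \<gamma> ((Q ^^ n) x)) -` {x. p (j i) (x - y i) < r i} else UNIV)"
  obtain x where x: "\<And>i. x \<in> G i"
  proof (rule baire[of "range vec" G])
    show "range vec \<noteq> {}" by blast
    have "continuous_on UNIV (\<lambda>x. smul \<gamma> ((Q ^^ n) x))" for \<gamma> n
      by (intro continuous_on_smul continuous_Q_iter continuous_on_const)
    note cont = this
    show "open (G i)" for i
    proof (cases "0 < r i")
      case True
      have "open (\<Union>n. \<Union>\<gamma>\<in>\<Gamma>. (\<lambda>x. smul \<gamma> ((Q ^^ n) x)) -` {x. p (j i) (x - y i) < r i})"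
        by (intro open_UN ballI open_vimage open_p_ball cont)
      then show ?thesis unfolding G_def using True by (simp only: if_True)
    qed (simp add: G_def)
    fix i v' k and \<epsilon>' :: real
    assume v': "v' \<in> range vec" and \<epsilon>': "\<epsilon>' > 0"
    then obtain v where v: "v' = vec v" by blast
    show "\<exists>u\<in>range vec. p k (u - v') < \<epsilon>' \<and> u \<in> G i"
    proof (cases "0 < r i")
      case True
      then obtain w where w: "p (j i) (vec w - y i) < r i" using vec_dense by blast
      define s where "s = min \<epsilon>' (r i - p (j i) (vec w - y i))"
      have s: "s > 0" "s \<le> \<epsilon>'" "s \<le> r i - p (j i) (vec w - y i)" using \<epsilon>' w by (simp_all add: s_def)
      define m where "m = max k (j i)"
      obtain \<epsilon> where \<epsilon>: "\<epsilon> > 0" and close: "\<forall>\<^sub>F l in sequentially. \<forall>a \<delta>. 0 \<le> a \<and> a \<le> \<epsilon> \<and> cmod \<delta> \<le> \<epsilon> \<longrightarrow>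
        p m (vec (connection v w l a \<delta>) - vec v) < s \<and>
        p m (vec (connection v w l a \<delta> \<circ>\<^sub>p [:horizon l, 1:]) - vec w) < s"
        using vec_connection_close[OF s(1), of m v w] by blast
      obtain l where l: "\<And>a \<delta>. 0 \<le> a \<and> a \<le> \<epsilon> \<and> cmod \<delta> \<le> \<epsilon> \<Longrightarrow>
        p m (vec (connection v w l a \<delta>) - vec v) < s \<and>
        p m (vec (connection v w l a \<delta> \<circ>\<^sub>p [:horizon l, 1:]) - vec w) < s"
        using eventually_happens'[OF sequentially_bot close] by blast
      obtain a \<delta> \<gamma> where a: "0 \<le> a" "a \<le> \<epsilon>" "cmod \<delta> \<le> \<epsilon>" "\<gamma> \<in> \<Gamma>"
        "\<gamma> * orbit_coeff (nat_values (connection v w l a \<delta>)) (2 * Suc l) = 1"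
        using transition_unbounded[OF \<Gamma> \<epsilon>, of v w l] by blast
      let ?u = "connection v w l a \<delta>"
      have u: "p m (vec ?u - vec v) < s" "p m (vec (?u \<circ>\<^sub>p [:horizon l, 1:]) - vec w) < s"
        using l[of a \<delta>] a by auto
      have "smul \<gamma> ((Q ^^ (2 * Suc l)) (vec ?u)) = vec (?u \<circ>\<^sub>p [:horizon l, 1:])"
        unfolding Q_iter_connection scale_scale a(5) by simp
      then have "p (j i) (smul \<gamma> ((Q ^^ (2 * Suc l)) (vec ?u)) - vec w) < s"
        using u(2) p_mono[of "j i" m] by (metis m_def max.cobounded2 order_le_less_trans)
      then have "p (j i) (smul \<gamma> ((Q ^^ (2 * Suc l)) (vec ?u)) - y i) < r i"
        using p_diff_triangle[of "j i" "smul \<gamma> ((Q ^^ (2 * Suc l)) (vec ?u))" "y i" "vec w"] s(3) by linarith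
      then have "\<exists>n. \<exists>\<gamma>\<in>\<Gamma>. p (j i) (smul \<gamma> ((Q ^^ n) (vec ?u)) - y i) < r i"
        using a(4) by blast
      then have "vec ?u \<in> G i" unfolding G_def using True by simp
      moreover have "p k (vec ?u - vec v) < \<epsilon>'"
        using u(1) s(2) p_mono[of k m "vec ?u - vec v"] by (simp add: m_def)
      ultimately show ?thesis using v by blast
    next
      case False
      then show ?thesis using v' \<epsilon>' by (intro bexI[of _ v']) (auto simp: G_def)
    qed
  qed (rule that)
  have "z \<in> closure {smul \<gamma> y | \<gamma> y. \<gamma> \<in> \<Gamma> \<and> y \<in> Orb Q x}" for z
    unfolding closure_p_iff
  proof (intro allI impI)
    fix k and e :: real assume "e > 0"
    then obtain i where i: "j i = k" "p k (y i - z) < e / 8" "5/8 * e < r i" "r i < 7/8 * e"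
      using targets[of "e / 2" k z] by auto
    then have "0 < r i" using \<open>e > 0\<close> by linarith
    then obtain n \<gamma> where n: "\<gamma> \<in> \<Gamma>" "p k (smul \<gamma> ((Q ^^ n) x) - y i) < r i"
      using x[of i] i(1) by (auto simp: G_def)
    then have "p k (smul \<gamma> ((Q ^^ n) x) - z) < e"
      using p_diff_triangle[of k "smul \<gamma> ((Q ^^ n) x)" z "y i"] i by linarith
    then show "\<exists>x\<in>{smul \<gamma> y | \<gamma> y. \<gamma> \<in> \<Gamma> \<and> y \<in> Orb Q x}. p k (x - z) < e"
      using n(1) by (auto simp: Orb_def)
  qed
  then show ?thesis unfolding supercyclic_def by blast
qed

end

section \<open>Approachable targets and the three dynamical properties\<close>

context translation_model
begin

lemma vec_monom_shrink:
  assumes "\<theta> > 0"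
  obtains \<eta> :: real where "\<eta> > 0" "\<eta> * p k (vec (monom 1 M)) < \<theta>" "\<eta> * real j ^ M \<le> 1"
proof -
  define A where "A = p k (vec (monom 1 M)) + 1"
  define B where "B = real j ^ M + 1"
  have A: "A > 0" unfolding A_def using p_nonneg[of k "vec (monom 1 M)"] by linarith
  have B: "B > 0" unfolding B_def by (simp add: add_nonneg_pos)
  define \<eta> where "\<eta> = min (\<theta> / A) (1 / B)"
  have \<eta>: "\<eta> > 0" "\<eta> \<le> \<theta> / A" "\<eta> \<le> 1 / B" using assms A B by (simp_all add: \<eta>_def)
  have "\<eta> * A \<le> \<theta>" "\<eta> * B \<le> 1" using \<eta>(2,3) A B by (simp_all add: pos_le_divide_eq)
  then have "\<eta> * p k (vec (monom 1 M)) + \<eta> \<le> \<theta>" "\<eta> * real j ^ M + \<eta> \<le> 1"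
    by (simp_all add: A_def B_def distrib_left)
  then show thesis using that \<eta>(1) by force
qed

text \<open>A tiny high monomial raises the degree, and a constant in
  \<open>[0, 6 * \<sigma>]\<close> then moves all values at the naturals away from 0. The 6
  compensates the denominator in \<open>avoid_all\<close>.\<close>

lemma nonvanishing_perturbation:
  assumes \<sigma>: "\<sigma> > 0" and \<theta>: "\<theta> > 0"
  obtains w where "M \<le> degree w" "\<And>i. \<sigma> * (1/3) ^ i \<le> cmod (nat_values w i)"
    "p k (vec w - vec q) < \<theta> + 6 * \<sigma> * p k (vec 1)"
    "cmod (nat_values w j - nat_values q j) \<le> 1 + 6 * \<sigma>"
proof -
  define M' where "M' = M + degree q + 1"
  obtain \<eta> where \<eta>: "\<eta> > 0" "\<eta> * p k (vec (monom 1 M')) < \<theta>" "\<eta> * real j ^ M' \<le> 1"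
    using vec_monom_shrink[OF \<theta>] by blast
  define q' where "q' = q + smult (of_real \<eta>) (monom 1 M')"
  have deg: "degree q' = M'"
    unfolding q'_def using \<eta>(1) by (subst degree_add_eq_right) (auto simp: M'_def degree_monom_eq)
  obtain a where a: "a \<in> {0..6 * \<sigma>}" "\<And>i. 6 * \<sigma> / (6 * 3 ^ i) \<le> cmod (nat_values q' i + of_real a)"
    using avoid_all[of "6 * \<sigma>" "nat_values q'"] \<sigma> by auto
  define w where "w = q' + smult (of_real a) 1"
  have "degree w = M'"
    unfolding w_def using deg by (subst degree_add_eq_left) (auto simp: M'_def)
  then have 1: "M \<le> degree w" by (simp add: M'_def)
  have 2: "\<sigma> * (1/3) ^ i \<le> cmod (nat_values w i)" for i
    using a(2)[of i] by (simp add: w_def power_one_over)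
  have "vec w - vec q = smul (of_real \<eta>) (vec (monom 1 M')) + smul (of_real a) (vec 1)"
    by (simp only: w_def q'_def vec_add vec_smult) simp
  then have "p k (vec w - vec q) \<le> \<eta> * p k (vec (monom 1 M')) + a * p k (vec 1)"
    using p_triangle[of k "smul (of_real \<eta>) (vec (monom 1 M'))" "smul (of_real a) (vec 1)"] \<eta>(1) a(1)
    by simp
  moreover have "a * p k (vec 1) \<le> 6 * \<sigma> * p k (vec 1)" using a(1) by (intro mult_right_mono) auto
  ultimately have 3: "p k (vec w - vec q) < \<theta> + 6 * \<sigma> * p k (vec 1)" using \<eta>(2) by linarith
  have "nat_values w j - nat_values q j = of_real (\<eta> * real j ^ M' + a)"
    by (simp add: w_def q'_def poly_monom)
  then have "cmod (nat_values w j - nat_values q j) = \<bar>\<eta> * real j ^ M' + a\<bar>"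
    by (simp only: norm_of_real)
  also have "\<dots> \<le> 1 + 6 * \<sigma>" using \<eta>(1,3) a(1) by simp
  finally show thesis using that 1 2 3 by blast
qed

text \<open>With \<open>\<sigma> = 6\<close> the criterion \<open>escapingI\<close> already holds at
  \<open>J = 0\<close>, because 6/3 > 1. The price is \<open>6 * 6 * p k (vec 1)\<close>, plus two
  errors of 1/2.\<close>

lemma approachable_all:
  assumes "\<epsilon> = 36 * p k (vec 1) + 1"
  shows "approachable y k \<epsilon>"
  unfolding approachable_def
proof
  fix M
  obtain q where q: "p k (vec q - y) < 1/2" using vec_dense[of "1/2"] by auto
  obtain w where w: "M \<le> degree w" "\<And>i. 6 * (1/3) ^ i \<le> cmod (nat_values w i)"
    "p k (vec w - vec q) < 1/2 + 6 * 6 * p k (vec 1)"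
    using nonvanishing_perturbation[of 6 "1/2" M k q 0] by auto
  have "escaping w" by (rule escapingI[of 6 w 0]) (use w(2) in auto)
  moreover have "p k (vec w - y) < \<epsilon>"
    using p_diff_triangle[of k "vec w" y "vec q"] w(3) q assms by linarith
  ultimately show "\<exists>w. escaping w \<and> M \<le> degree w \<and> p k (vec w - y) < \<epsilon>" using w(1) by blast
qed

text \<open>Dividing by \<open>\<gamma>\<close> multiplies the lower bounds by
  \<open>1 / cmod \<gamma>\<close>; for \<open>cmod \<gamma> < \<sigma> / 3\<close> this yields
  escape at \<open>J = 0\<close>. The error grows by the same factor, which multiplication by
  \<open>\<gamma>\<close> later undoes.\<close>

lemma approachable_scaled:
  assumes e: "e > 0"
  obtains r where "r > 0" "\<And>\<gamma>. \<gamma> \<noteq> 0 \<Longrightarrow> cmod \<gamma> < r \<Longrightarrow> approachable (smul (1 / \<gamma>) y) k (e / cmod \<gamma>)"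
proof -
  define A where "A = p k (vec 1) + 1"
  have A: "A > 0" unfolding A_def using p_nonneg[of k "vec 1"] by linarith
  define \<sigma> where "\<sigma> = e / (24 * A)"
  have \<sigma>: "\<sigma> > 0" using e A by (simp add: \<sigma>_def)
  have "6 * \<sigma> * p k (vec 1) \<le> 6 * \<sigma> * A" using \<sigma> by (intro mult_left_mono) (auto simp: A_def)
  also have "\<dots> = e / 4" using A by (simp add: \<sigma>_def)
  finally have \<sigma>1: "6 * \<sigma> * p k (vec 1) \<le> e / 4" .
  obtain q where q: "p k (vec q - y) < e / 4" using vec_dense[of "e / 4"] e by auto
  have "approachable (smul (1 / \<gamma>) y) k (e / cmod \<gamma>)" if \<gamma>: "\<gamma> \<noteq> 0" "cmod \<gamma> < \<sigma> / 3" for \<gamma>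
    unfolding approachable_def
  proof
    fix M
    obtain w where w: "M \<le> degree w" "\<And>i. \<sigma> * (1/3) ^ i \<le> cmod (nat_values w i)"
      "p k (vec w - vec q) < e / 4 + 6 * \<sigma> * p k (vec 1)"
      using nonvanishing_perturbation[OF \<sigma>, of "e / 4" M k q 0] e by auto
    let ?w = "smult (1 / \<gamma>) w"
    have \<gamma>0: "cmod \<gamma> > 0" using \<gamma>(1) by simp
    have "escaping ?w"
    proof (rule escapingI[of "\<sigma> / cmod \<gamma>" ?w 0])
      show "\<sigma> / cmod \<gamma> > 0" using \<sigma> \<gamma>0 by simp
      show "\<sigma> / cmod \<gamma> * (1/3) ^ i \<le> cmod (nat_values ?w i)" for i
        using w(2)[of i] \<gamma>0 by (simp add: norm_mult norm_divide divide_right_mono)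
      show "1 < cmod (orbit_coeff (nat_values ?w) 0) * (\<sigma> / cmod \<gamma>) * (1/3) ^ (0 + 1)"
        using \<gamma>(2) \<gamma>0 by (simp add: field_simps)
    qed
    moreover have "degree ?w = degree w" using \<gamma>(1) by simp
    moreover have "p k (vec ?w - smul (1 / \<gamma>) y) < e / cmod \<gamma>"
    proof -
      have "vec ?w - smul (1 / \<gamma>) y = smul (1 / \<gamma>) (vec w - y)"
        by (simp add: vec_smult scale_right_diff_distrib)
      then have "p k (vec ?w - smul (1 / \<gamma>) y) = p k (vec w - y) / cmod \<gamma>"
        by (simp add: norm_divide)
      moreover have "p k (vec w - y) < e"
        using p_diff_triangle[of k "vec w" y "vec q"] w(3) q \<sigma>1 e by linarith
      ultimately show ?thesis using \<gamma>0 by (simp add: divide_strict_right_mono)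
    qed
    ultimately show "\<exists>w. escaping w \<and> M \<le> degree w \<and> p k (vec w - smul (1 / \<gamma>) y) < e / cmod \<gamma>"
      using w(1) by metis
  qed
  moreover have "\<sigma> / 3 > 0" using \<sigma> by simp
  ultimately show thesis using that by blast
qed

lemma orbit_coeff_norm_mono:
  assumes "\<And>j. j < n \<Longrightarrow> cmod (s j) \<le> cmod (z j)"
  shows "cmod (orbit_coeff s n) \<le> cmod (orbit_coeff z n)"
  using assms by (induction n) (auto simp: norm_mult norm_power intro!: mult_mono power_mono)

text \<open>A huge value at one natural number where \<open>h\<close> does not vanish is enough to
  start the growth. So any target becomes approachable, with arbitrarily small error, after moving
  it far along a direction \<open>vec h\<close>.\<close>

lemma approachable_along:
  assumes h: "h \<noteq> 0" and \<epsilon>: "\<epsilon> > 0"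
  obtains K :: real where "approachable (y + smul (of_real K) (vec h)) k \<epsilon>"
proof -
  define A where "A = p k (vec 1) + 1"
  have A: "A > 0" unfolding A_def using p_nonneg[of k "vec 1"] by linarith
  define \<sigma> where "\<sigma> = \<epsilon> / (24 * A)"
  have \<sigma>: "\<sigma> > 0" using \<epsilon> A by (simp add: \<sigma>_def)
  have "6 * \<sigma> * p k (vec 1) \<le> 6 * \<sigma> * A" using \<sigma> by (intro mult_left_mono) (auto simp: A_def)
  also have "\<dots> = \<epsilon> / 4" using A by (simp add: \<sigma>_def)
  finally have \<sigma>1: "6 * \<sigma> * p k (vec 1) \<le> \<epsilon> / 4" .
  obtain q where q: "p k (vec q - y) < \<epsilon> / 4" using vec_dense[of "\<epsilon> / 4"] \<epsilon> by auto
  have "\<exists>j. nat_values h j \<noteq> 0"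
  proof (rule ccontr)
    assume "\<not> ?thesis"
    then have "range (of_nat :: nat \<Rightarrow> complex) \<subseteq> {x. poly h x = 0}" by auto
    then have "finite (range (of_nat :: nat \<Rightarrow> complex))"
      using poly_roots_finite[OF h] finite_subset by blast
    then show False using finite_imageD[of "of_nat :: nat \<Rightarrow> complex" UNIV] by (simp add: inj_on_def)
  qed
  then obtain j where j: "nat_values h j \<noteq> 0" by blast
  \<comment> \<open>The least possible coefficient at \<open>j\<close> under the lower bounds.
    \<open>D\<close> is then the value at \<open>j\<close> for which the escape criterion at
    \<open>Suc j\<close> gives exactly 2.\<close>
  define L where "L = cmod (orbit_coeff (\<lambda>i. of_real (\<sigma> * (1/3) ^ i)) j)"
  have L: "L > 0" unfolding L_def using \<sigma> by (simp add: orbit_coeff_nonzero)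
  define D where "D = 2 * 3 ^ (j + 2) / (\<sigma> * L\<^sup>2)"
  \<comment> \<open>\<open>K\<close> leaves at least \<open>D\<close> at \<open>j\<close> after
    subtracting the value of \<open>q\<close> and the error \<open>1 + 6 * \<sigma>\<close>. It is
    fixed before the degree bound \<open>M\<close>.\<close>
  define K where "K = (D + cmod (nat_values q j) + 1 + 6 * \<sigma>) / cmod (nat_values h j)"
  have D: "D > 0" using \<sigma> L by (simp add: D_def)
  have K: "K * cmod (nat_values h j) = D + cmod (nat_values q j) + 1 + 6 * \<sigma>" "K \<ge> 0"
    using j D \<sigma> by (simp_all add: K_def)
  have "approachable (y + smul (of_real K) (vec h)) k \<epsilon>"
    unfolding approachable_def
  proof
    fix M
    define q' where "q' = q + smult (of_real K) h"
    obtain w where w: "M \<le> degree w" "\<And>i. \<sigma> * (1/3) ^ i \<le> cmod (nat_values w i)"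
      "p k (vec w - vec q') < \<epsilon> / 4 + 6 * \<sigma> * p k (vec 1)"
      "cmod (nat_values w j - nat_values q' j) \<le> 1 + 6 * \<sigma>"
      using nonvanishing_perturbation[OF \<sigma>, of "\<epsilon> / 4" M k q' j] \<epsilon> by auto
    have "D \<le> cmod (nat_values w j)"
    proof -
      have "cmod (of_real K * nat_values h j) \<le> cmod (nat_values q' j) + cmod (nat_values q j)"
        using norm_triangle_ineq4[of "nat_values q' j" "nat_values q j"] by (simp add: q'_def)
      moreover have "cmod (nat_values q' j) \<le> cmod (nat_values w j) + (1 + 6 * \<sigma>)"
        using norm_triangle_ineq2[of "nat_values q' j" "nat_values w j"] w(4)
        by (simp add: norm_minus_commute)
      ultimately show ?thesis using K by (simp add: norm_mult)
    qed
    moreover have "L \<le> cmod (orbit_coeff (nat_values w) j)"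
      unfolding L_def using w(2) \<sigma> by (intro orbit_coeff_norm_mono) (simp add: norm_mult norm_power norm_divide)
    ultimately have "L\<^sup>2 * D \<le> cmod (orbit_coeff (nat_values w) (Suc j))"
      using L D by (auto simp: norm_mult norm_power intro!: mult_mono power_mono)
    then have "L\<^sup>2 * D * \<sigma> * (1/3) ^ (Suc j + 1) \<le> cmod (orbit_coeff (nat_values w) (Suc j)) * \<sigma> * (1/3) ^ (Suc j + 1)"
      using \<sigma> by (intro mult_right_mono) auto
    moreover have "L\<^sup>2 * D * \<sigma> * (1/3) ^ (Suc j + 1) = 2"
      using L \<sigma> by (simp add: D_def power_one_over)
    ultimately have "escaping w" by (intro escapingI[OF \<sigma> w(2), of "Suc j"]) linarith
    moreover have "p k (vec w - (y + smul (of_real K) (vec h))) < \<epsilon>"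
    proof -
      have eq: "vec q' - (y + smul (of_real K) (vec h)) = vec q - y"
        by (simp add: q'_def vec_add vec_smult)
      have "p k (vec w - (y + smul (of_real K) (vec h))) \<le> p k (vec w - vec q') + p k (vec q - y)"
        using p_diff_triangle[of k "vec w" "y + smul (of_real K) (vec h)" "vec q'"] unfolding eq .
      then show ?thesis using w(3) q \<sigma>1 \<epsilon> by linarith
    qed
    ultimately show "\<exists>w. escaping w \<and> M \<le> degree w \<and> p k (vec w - (y + smul (of_real K) (vec h))) < \<epsilon>"
      using w(1) by blast
  qed
  then show thesis by (rule that)
qed

text \<open>The clause on low coefficients strengthens the induction: it provides a second solution
  starting above the degree of the first. A combination of the two kills one more functional and
  keeps the top coefficient of the second.\<close>

lemma common_kernel:
  assumes "finite F" "\<And>f. f \<in> F \<Longrightarrow> Vector_Spaces.linear smul (*) f"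
  shows "\<exists>h. h \<noteq> 0 \<and> (\<forall>f\<in>F. f (vec h) = 0) \<and> (\<forall>i<N. coeff h i = 0)"
  using assms
proof (induction F arbitrary: N rule: finite_induct)
  case empty
  show ?case by (intro exI[of _ "monom 1 N"]) auto
next
  case (insert f F)
  have f: "f (a + b) = f a + f b" "f (smul c a) = c * f a" for a b c
    using insert.prems[of f] by (simp_all add: linear_functional_iff)
  have F: "\<And>g. g \<in> F \<Longrightarrow> Vector_Spaces.linear smul (*) g" using insert.prems by blast
  obtain h1 where h1: "h1 \<noteq> 0" "\<And>g. g \<in> F \<Longrightarrow> g (vec h1) = 0" "\<And>i. i < N \<Longrightarrow> coeff h1 i = 0"
    using insert.IH[OF F, of N] by blast
  obtain h2 where h2: "h2 \<noteq> 0" "\<And>g. g \<in> F \<Longrightarrow> g (vec h2) = 0"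
      "\<And>i. i < N + degree h1 + 1 \<Longrightarrow> coeff h2 i = 0"
    using insert.IH[OF F, of "N + degree h1 + 1"] by blast
  show ?case
  proof (cases "f (vec h1) = 0")
    case True
    then show ?thesis using h1 by (intro exI[of _ h1]) auto
  next
    case False
    define c where "c = - f (vec h2) / f (vec h1)"
    define h where "h = h2 + smult c h1"
    have "h \<noteq> 0"
    proof
      assume "h = 0"
      then have "coeff h (degree h2) = 0" by simp
      moreover have "N + degree h1 + 1 \<le> degree h2"
        using h2(1,3) by (meson leading_coeff_0_iff not_le)
      then have "coeff h1 (degree h2) = 0" by (intro coeff_eq_0) simp
      ultimately show False using h2(1) by (simp add: h_def)
    qed
    moreover have "f (vec h) = 0"
    proof -
      have "f (vec h) = f (vec h2) + c * f (vec h1)" by (simp only: h_def vec_add vec_smult f)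
      then show ?thesis using False by (simp add: c_def)
    qed
    moreover have "g (vec h) = 0" if "g \<in> F" for g
      using h1(2)[OF that] h2(2)[OF that] F[OF that]
      by (simp add: h_def vec_add vec_smult linear_functional_iff)
    moreover have "coeff h i = 0" if "i < N" for i using that h1(3) h2(3) by (simp add: h_def)
    ultimately show ?thesis by blast
  qed
qed

lemma weak_neighbourhood:
  assumes "generate_topology_on
      {f -` U | (f :: 'a \<Rightarrow> complex) U. Vector_Spaces.linear smul (*) f \<and> continuous_on UNIV f \<and> open U} W"
    and "y \<in> W"
  shows "\<exists>F e. finite F \<and> (\<forall>f\<in>F. Vector_Spaces.linear smul (*) f \<and> continuous_on UNIV f) \<and> e > 0 \<and>
    (\<forall>x. (\<forall>f\<in>F. cmod (f x - f y) < e) \<longrightarrow> x \<in> W)"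
  using assms
proof (induction rule: generate_topology_on.induct)
  case Empty
  then show ?case by simp
next
  case (Int A B)
  then have y: "y \<in> A" "y \<in> B" by auto
  obtain F e where F: "finite F" "\<forall>f\<in>F. Vector_Spaces.linear smul (*) f \<and> continuous_on UNIV f" "e > 0"
    "\<forall>x. (\<forall>f\<in>F. cmod (f x - f y) < e) \<longrightarrow> x \<in> A" using Int.IH(1)[OF y(1)] by blast
  obtain F' e' where F': "finite F'" "\<forall>f\<in>F'. Vector_Spaces.linear smul (*) f \<and> continuous_on UNIV f" "e' > 0"
    "\<forall>x. (\<forall>f\<in>F'. cmod (f x - f y) < e') \<longrightarrow> x \<in> B" using Int.IH(2)[OF y(2)] by blast
  show ?case
    by (rule exI[of _ "F \<union> F'"], rule exI[of _ "min e e'"]) (use F F' in auto)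
next
  case (UN K)
  then obtain k where "k \<in> K" "y \<in> k" by blast
  with UN.IH[OF this] show ?case by blast
next
  case (Basis s)
  then obtain f U where f: "s = f -` U" "Vector_Spaces.linear smul (*) f" "continuous_on UNIV f" "open U"
    by blast
  then obtain e where e: "e > 0" "ball (f y) e \<subseteq> U" using Basis.prems openE by blast
  show ?case
  proof (rule exI[of _ "{f}"], rule exI[of _ e], intro conjI)
    show "\<forall>x. (\<forall>f\<in>{f}. cmod (f x - f y) < e) \<longrightarrow> x \<in> s"
      using e(2) f(1) by (auto simp: dist_norm norm_minus_commute subset_iff)
  qed (use f e in auto)
qed

text \<open>A weak neighbourhood tests finitely many functionals. Moving the target along
  \<open>vec h\<close> in their common kernel is invisible to them, and far enough along that line
  the target is approachable.\<close>

lemma weakly_dense_orbit: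
  assumes x: "\<And>y k \<epsilon>. \<epsilon> > 0 \<Longrightarrow> approachable y k \<epsilon> \<Longrightarrow> \<exists>n. p k ((Q ^^ n) x - y) < 2 * \<epsilon>"
  shows "weak_topology smul closure_of Orb Q x = UNIV"
proof -
  let ?S = "{f -` U | (f :: 'a \<Rightarrow> complex) U. Vector_Spaces.linear smul (*) f \<and> continuous_on UNIV f \<and> open U}"
  have "UNIV \<in> ?S"
    by (rule CollectI, rule exI[of _ "\<lambda>_. 0"], rule exI[of _ UNIV]) (simp add: linear_functional_iff)
  then have top: "topspace (weak_topology smul) = (UNIV :: 'a set)"
    unfolding weak_topology_def topology_generated_by_topspace by blast
  have "y \<in> weak_topology smul closure_of Orb Q x" for y
    unfolding in_closure_of top
  proof (intro conjI allI impI, simp, elim conjE)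
    fix W assume "y \<in> W" "openin (weak_topology smul) W"
    then have "generate_topology_on ?S W"
      by (simp add: weak_topology_def openin_topology_generated_by_iff)
    from weak_neighbourhood[OF this \<open>y \<in> W\<close>]
    obtain F e where Fe: "finite F \<and> (\<forall>f\<in>F. Vector_Spaces.linear smul (*) f \<and> continuous_on UNIV f) \<and>
      e > 0 \<and> (\<forall>x. (\<forall>f\<in>F. cmod (f x - f y) < e) \<longrightarrow> x \<in> W)"
      by (elim exE) (rule that)
    then have F: "finite F" "\<And>f. f \<in> F \<Longrightarrow> Vector_Spaces.linear smul (*) f"
      "\<And>f. f \<in> F \<Longrightarrow> continuous_on UNIV f" "e > 0" by simp_all
    have in_W: "x \<in> W" if "\<And>f. f \<in> F \<Longrightarrow> cmod (f x - f y) < e" for x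
      using Fe that by simp
    have "open (\<Inter>f\<in>F. f -` ball (f y) e)"
      using F(1,3) by (intro open_INT ballI open_vimage) auto
    moreover have "y \<in> (\<Inter>f\<in>F. f -` ball (f y) e)" using F(4) by auto
    ultimately obtain k \<epsilon> where \<epsilon>: "\<epsilon> > 0"
      "\<And>z. p k (z - y) < \<epsilon> \<Longrightarrow> z \<in> (\<Inter>f\<in>F. f -` ball (f y) e)"
      using open_contains_p_ball by metis
    obtain h where h: "h \<noteq> 0" "\<And>f. f \<in> F \<Longrightarrow> f (vec h) = 0"
      using common_kernel[OF F(1,2), of 0] by blast
    obtain K :: real where "approachable (y + smul (of_real K) (vec h)) k (\<epsilon> / 2)"
      using approachable_along[OF h(1), of "\<epsilon> / 2" y k] \<epsilon>(1) by auto
    then obtain n where n: "p k ((Q ^^ n) x - (y + smul (of_real K) (vec h))) < 2 * (\<epsilon> / 2)"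
      using x[of "\<epsilon> / 2"] \<epsilon>(1) by auto
    define z where "z = (Q ^^ n) x - smul (of_real K) (vec h)"
    have "p k (z - y) < \<epsilon>" using n by (simp add: z_def algebra_simps)
    then have z: "z \<in> (\<Inter>f\<in>F. f -` ball (f y) e)" by (rule \<epsilon>(2))
    have "(Q ^^ n) x \<in> W"
    proof (rule in_W)
      fix f assume f: "f \<in> F"
      have "(Q ^^ n) x = z + smul (of_real K) (vec h)" by (simp add: z_def)
      then have "f ((Q ^^ n) x) = f z"
        using F(2)[OF f] h(2)[OF f] by (simp add: linear_functional_iff)
      then show "cmod (f ((Q ^^ n) x) - f y) < e"
        using z f by (auto simp: dist_norm norm_minus_commute)
    qed
    then show "\<exists>z. z \<in> Orb Q x \<and> z \<in> W" by (auto simp: Orb_def)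
  qed
  then show ?thesis by blast
qed

text \<open>The orbit comes close to \<open>y / \<gamma>\<close> with error
  \<open>e / cmod \<gamma>\<close>, and multiplication by \<open>\<gamma>\<close> brings the error
  back to \<open>e\<close>. The same \<open>x\<close> serves every such
  \<open>\<Gamma>\<close>.\<close>

lemma supercyclic_accumulating:
  assumes x: "\<And>y k \<epsilon>. \<epsilon> > 0 \<Longrightarrow> approachable y k \<epsilon> \<Longrightarrow> \<exists>n. p k ((Q ^^ n) x - y) < 2 * \<epsilon>"
    and \<Gamma>: "0 islimpt \<Gamma>"
  shows "supercyclic smul \<Gamma> Q"
proof -
  have "y \<in> closure {smul \<gamma> y | \<gamma> y. \<gamma> \<in> \<Gamma> \<and> y \<in> Orb Q x}" for y
    unfolding closure_p_iff
  proof (intro allI impI)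
    fix k and e :: real assume e: "e > 0"
    obtain r where r: "r > 0" "\<And>\<gamma>. \<gamma> \<noteq> 0 \<Longrightarrow> cmod \<gamma> < r \<Longrightarrow>
        approachable (smul (1 / \<gamma>) y) k ((e / 2) / cmod \<gamma>)"
      using approachable_scaled[of "e / 2" y k] e by auto
    obtain \<gamma> where \<gamma>: "\<gamma> \<in> \<Gamma>" "\<gamma> \<noteq> 0" "cmod \<gamma> < r"
      using \<Gamma> r(1) unfolding islimpt_approachable by (auto simp: dist_norm)
    obtain n where n: "p k ((Q ^^ n) x - smul (1 / \<gamma>) y) < 2 * ((e / 2) / cmod \<gamma>)"
      using x[OF _ r(2)[OF \<gamma>(2,3)]] e \<gamma>(2) by auto
    have "smul \<gamma> ((Q ^^ n) x) - y = smul \<gamma> ((Q ^^ n) x - smul (1 / \<gamma>) y)"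
      using \<gamma>(2) by (simp add: scale_right_diff_distrib)
    then have "p k (smul \<gamma> ((Q ^^ n) x) - y) = cmod \<gamma> * p k ((Q ^^ n) x - smul (1 / \<gamma>) y)" by simp
    also have "\<dots> < cmod \<gamma> * (2 * ((e / 2) / cmod \<gamma>))"
      using n \<gamma>(2) by (intro mult_strict_left_mono) auto
    finally have "p k (smul \<gamma> ((Q ^^ n) x) - y) < e" using \<gamma>(2) by simp
    then show "\<exists>x\<in>{smul \<gamma> y | \<gamma> y. \<gamma> \<in> \<Gamma> \<and> y \<in> Orb Q x}. p k (x - y) < e"
      using \<gamma>(1) by (auto simp: Orb_def)
  qed
  then show ?thesis unfolding supercyclic_def by blast
qed

lemma Q_dynamics:
  assumes \<rho>: "\<And>n x. \<rho> n x \<le> p n x"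
  shows "weakly_hypercyclic smul Q \<and> (\<exists>d. (\<forall>n. d n > 0) \<and> d_hypercyclic \<rho> d Q) \<and>
    (\<forall>\<Gamma>. \<not> bounded \<Gamma> \<or> 0 islimpt \<Gamma> \<longrightarrow> supercyclic smul \<Gamma> Q)"
proof (rule orbit_approximates)
  fix x assume x: "\<And>y k \<epsilon>. \<epsilon> > 0 \<Longrightarrow> approachable y k \<epsilon> \<Longrightarrow> \<exists>n. p k ((Q ^^ n) x - y) < 2 * \<epsilon>"
  \<comment> \<open>Twice the radius from \<open>approachable_all\<close>, the 2 coming from the
    orbit approximation.\<close>
  define d where "d = (\<lambda>n. 2 * (36 * p n (vec 1) + 1))"
  have pos: "36 * p n (vec 1) + 1 > 0" for n by (simp add: add_nonneg_pos)
  have "\<exists>a\<in>Orb Q x. \<rho> n (y - a) < d n" for y n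
  proof -
    obtain m where "p n ((Q ^^ m) x - y) < 2 * (36 * p n (vec 1) + 1)"
      using x[OF pos approachable_all[OF refl]] by blast
    then have "\<rho> n (y - (Q ^^ m) x) < d n"
      using \<rho>[of n "y - (Q ^^ m) x"] p_commute[of n y] by (simp add: d_def)
    then show ?thesis by (auto simp: Orb_def)
  qed
  then have "d_hypercyclic \<rho> d Q" by (auto simp: d_hypercyclic_def d_dense_def)
  moreover have "d n > 0" for n unfolding d_def by (rule mult_pos_pos[OF zero_less_numeral pos])
  ultimately show ?thesis
    using weakly_dense_orbit[OF x] supercyclic_unbounded supercyclic_accumulating[OF x]
    unfolding weakly_hypercyclic_def by blast
qed

end

section \<open>Newton polynomials and existence of the model\<close>

definition forward_diff :: "complex poly \<Rightarrow> complex poly" where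
  "forward_diff u = u \<circ>\<^sub>p [:1, 1:] - u"

lemma forward_diff_add: "forward_diff (u + v) = forward_diff u + forward_diff v"
  by (simp add: forward_diff_def pcompose_add)

lemma forward_diff_smult: "forward_diff (smult c u) = smult c (forward_diff u)"
  by (simp add: forward_diff_def pcompose_smult smult_diff_right)

lemma forward_diff_iter_add: "(forward_diff ^^ i) (u + v) = (forward_diff ^^ i) u + (forward_diff ^^ i) v"
  by (induction i) (simp_all add: forward_diff_add)

lemma forward_diff_iter_smult: "(forward_diff ^^ i) (smult c u) = smult c ((forward_diff ^^ i) u)"
  by (induction i) (simp_all add: forward_diff_smult)

lemma forward_diff_iter_0: "(forward_diff ^^ i) 0 = 0"
  using forward_diff_iter_smult[of i 0 0] by simp

lemma degree_forward_diff: "forward_diff u = 0 \<or> degree (forward_diff u) < degree u"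
proof (rule eq_zero_or_degree_less)
  have deg: "degree (u \<circ>\<^sub>p [:1, 1:]) = degree u" by (simp add: degree_pcompose)
  show "degree (forward_diff u) \<le> degree u"
    unfolding forward_diff_def by (rule degree_diff_le) (simp_all add: deg)
  have "lead_coeff (u \<circ>\<^sub>p [:1, 1:]) = lead_coeff u" by (subst lead_coeff_comp) auto
  then show "coeff (forward_diff u) (degree u) = 0" by (simp add: forward_diff_def deg)
qed

lemma forward_diff_iter_eq_0:
  assumes "degree u < i"
  shows "(forward_diff ^^ i) u = 0"
  using assms
proof (induction i arbitrary: u)
  case (Suc i)
  have "(forward_diff ^^ Suc i) u = (forward_diff ^^ i) (forward_diff u)" by (simp add: funpow_swap1)
  also have "\<dots> = 0"
    using degree_forward_diff[of u] Suc by (cases "forward_diff u = 0") (auto simp: forward_diff_iter_0)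
  finally show ?case .
qed simp

primrec newton :: "nat \<Rightarrow> complex poly" where
  "newton 0 = 1"
| "newton (Suc n) = smult (1 / of_nat (Suc n)) (newton n * [:- of_nat n, 1:])"

text \<open>The absorption identity for binomial coefficients: (X+1 choose n+1) = (X+1)/(n+1) * (X
  choose n).\<close>

lemma newton_shift: "newton (Suc n) \<circ>\<^sub>p [:1, 1:] = smult (1 / of_nat (Suc n)) ([:1, 1:] * newton n)"
proof (induction n)
  case 0
  then show ?case by (simp add: pcompose_pCons one_pCons)
next
  case (Suc n)
  have "newton (Suc (Suc n)) \<circ>\<^sub>p [:1, 1:]
      = smult (1 / of_nat (Suc (Suc n))) ((newton (Suc n) \<circ>\<^sub>p [:1, 1:]) * ([:- of_nat (Suc n), 1:] \<circ>\<^sub>p [:1, 1:]))"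
    by (simp only: newton.simps(2)[of "Suc n"] pcompose_smult pcompose_mult)
  also have "[:- of_nat (Suc n), 1:] \<circ>\<^sub>p [:1, 1:] = [:- of_nat n, 1 :: complex:]"
    by (simp add: pcompose_pCons)
  also have "smult (1 / of_nat (Suc (Suc n))) ((newton (Suc n) \<circ>\<^sub>p [:1, 1:]) * [:- of_nat n, 1:])
      = smult (1 / of_nat (Suc (Suc n))) ([:1, 1:] * newton (Suc n))"
    unfolding Suc.IH unfolding newton.simps(2)[of n]
    by (simp only: mult_smult_left mult_smult_right mult_ac)
  finally show ?case .
qed

text \<open>Pascal's rule; it makes \<open>forward_diff\<close> a backward shift on the Newton
  polynomials.\<close>

lemma forward_diff_newton: "forward_diff (newton (Suc n)) = newton n"
proof -
  have ne: "of_nat (Suc n) \<noteq> (0::complex)" by (rule of_nat_neq_0)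
  have "forward_diff (newton (Suc n)) = smult (1 / of_nat (Suc n)) (newton n * ([:1, 1:] - [:- of_nat n, 1:]))"
    unfolding forward_diff_def newton_shift unfolding newton.simps(2) smult_diff_right[symmetric]
    by (simp only: right_diff_distrib mult.commute)
  also have "[:1, 1:] - [:- of_nat n, 1 :: complex:] = [:of_nat (Suc n):]" by simp
  finally show ?thesis using ne by (simp del: of_nat_Suc)
qed

text \<open>Iterated differences at 0 are the functionals dual to the Newton basis, that is, the
  coefficients of Newton's expansion.\<close>

lemma forward_diff_iter_newton: "poly ((forward_diff ^^ i) (newton n)) 0 = (if i = n then 1 else 0)"
proof (induction n arbitrary: i)
  case 0
  have "forward_diff 1 = 0" by (simp add: forward_diff_def pcompose_1)
  then show ?case by (cases i) (simp_all add: funpow_swap1 forward_diff_iter_0)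
next
  case (Suc n)
  have "poly (newton (Suc n)) 0 = 0"
  proof (induction n)
    case (Suc n)
    then show ?case by (subst newton.simps(2)) (simp del: newton.simps)
  qed simp
  then show ?case using Suc by (cases i) (simp_all add: funpow_swap1 forward_diff_newton del: newton.simps)
qed

context frechet_seminorms
begin

lemma translation_model_exists:
  assumes inf: "\<not> (\<exists>B. finite_dimensional_vector_space smul B)"
    and sep: "separable_space (euclidean :: 'a topology)"
  shows "\<exists>T \<alpha> vec. translation_model smul p T \<alpha> vec"
proof (rule backward_shift_exists[OF inf sep])
  fix e :: "nat \<Rightarrow> 'a" and \<alpha> :: "'a \<Rightarrow> complex" and B :: "'a \<Rightarrow> 'a"
  assume \<alpha>: "Vector_Spaces.linear smul (*) \<alpha>" "continuous_on UNIV \<alpha>"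
    and B: "Vector_Spaces.linear smul smul B" "continuous_on UNIV B"
    and \<alpha>e: "\<And>n. \<alpha> (e n) = (if n = 0 then 1 else 0)"
    and Be: "B (e 0) = 0" "\<And>n. B (e (Suc n)) = e n"
    and dense: "\<And>y k \<epsilon>. \<epsilon> > 0 \<Longrightarrow> \<exists>v\<in>span (range e). p k (v - y) < \<epsilon>"
  define T where "T = (\<lambda>x. x + B x)"
  \<comment> \<open>Newton's expansion with \<open>newton i\<close> replaced by \<open>e i\<close>.
    It carries \<open>forward_diff\<close> to \<open>B\<close>, hence translation to
    \<open>T\<close>, and evaluation at 0 to \<open>\<alpha>\<close>.\<close>
  define vec where "vec = (\<lambda>u. \<Sum>i\<le>degree u. smul (poly ((forward_diff ^^ i) u) 0) (e i))"
  have vec: "vec u = (\<Sum>i\<le>N. smul (poly ((forward_diff ^^ i) u) 0) (e i))" if "degree u \<le> N" for u N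
    unfolding vec_def using that by (intro sum.mono_neutral_left) (auto simp: forward_diff_iter_eq_0)
  have vec_add: "vec (u + v) = vec u + vec v" for u v
  proof -
    define N where "N = max (degree u) (degree v)"
    have "degree (u + v) \<le> N" "degree u \<le> N" "degree v \<le> N"
      by (auto simp: N_def intro: degree_add_le)
    then show ?thesis by (simp add: vec forward_diff_iter_add scale_left_distrib sum.distrib)
  qed
  have vec_smult: "vec (smult c u) = smul c (vec u)" for c u
    using vec[of "smult c u" "degree u"] degree_smult_le[of c u]
    by (simp add: vec_def forward_diff_iter_smult scale_sum_right)
  have B_add: "B (x + y) = B x + B y" and B_scale: "B (smul c x) = smul c (B x)" for x y c
    using B(1) by (simp_all add: linear_self_iff)
  have B_0: "B 0 = 0" using B_scale[of 0 0] by simp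
  have B_sum: "B (sum f A) = (\<Sum>i\<in>A. B (f i))" for f :: "nat \<Rightarrow> 'a" and A
    by (induction A rule: infinite_finite_induct) (simp_all add: B_0 B_add)
  have \<alpha>_add: "\<alpha> (x + y) = \<alpha> x + \<alpha> y" and \<alpha>_scale: "\<alpha> (smul c x) = c * \<alpha> x" for x y c
    using \<alpha>(1) by (simp_all add: linear_functional_iff)
  have \<alpha>_0: "\<alpha> 0 = 0" using \<alpha>_scale[of 0 0] by simp
  have \<alpha>_sum: "\<alpha> (sum f A) = (\<Sum>i\<in>A. \<alpha> (f i))" for f :: "nat \<Rightarrow> 'a" and A
    by (induction A rule: infinite_finite_induct) (simp_all add: \<alpha>_0 \<alpha>_add)
  have B_vec: "B (vec u) = vec (forward_diff u)" for u
  proof -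
    have "B (vec u) = (\<Sum>i\<le>Suc (degree u). smul (poly ((forward_diff ^^ i) u) 0) (B (e i)))"
      using vec[of u "Suc (degree u)"] by (simp only: B_sum B_scale)
    also have "\<dots> = (\<Sum>i\<le>degree u. smul (poly ((forward_diff ^^ Suc i) u) 0) (e i))"
      by (subst sum.atMost_Suc_shift) (simp add: Be)
    also have "\<dots> = (\<Sum>i\<le>degree u. smul (poly ((forward_diff ^^ i) (forward_diff u)) 0) (e i))"
      by (simp add: funpow_swap1)
    also have "\<dots> = vec (forward_diff u)"
      using degree_forward_diff[of u] by (intro vec[symmetric]) auto
    finally show ?thesis .
  qed
  have "translation_model smul p T \<alpha> vec"
  proof (intro translation_model.intro translation_model_axioms.intro)
    show "frechet_seminorms smul p" by (rule frechet_seminorms_axioms)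
    show "Vector_Spaces.linear smul smul T"
      by (simp add: T_def linear_self_iff B_add B_scale scale_right_distrib)
    show "continuous_on UNIV T"
      unfolding T_def by (intro continuous_intros B)
    show "T (vec u) = vec (u \<circ>\<^sub>p [:1, 1:])" for u
    proof -
      have "T (vec u) = vec (u + forward_diff u)" by (simp add: T_def B_vec vec_add)
      then show ?thesis by (simp add: forward_diff_def)
    qed
    show "\<alpha> (vec u) = poly u 0" for u
    proof -
      have "\<alpha> (vec u) = (\<Sum>i\<le>degree u. if i = 0 then poly u 0 else 0)"
        unfolding vec_def \<alpha>_sum by (intro sum.cong) (auto simp: \<alpha>_scale \<alpha>e)
      then show ?thesis by simp
    qed
    have "e n \<in> range vec" for n
    proof -
      define m where "m = max n (degree (newton n))"
      have "vec (newton n) = (\<Sum>i\<le>m. smul (poly ((forward_diff ^^ i) (newton n)) 0) (e i))"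
        by (rule vec) (simp add: m_def)
      also have "\<dots> = (\<Sum>i\<le>m. if i = n then e n else 0)"
        by (intro sum.cong) (auto simp: forward_diff_iter_newton)
      also have "\<dots> = e n" by (simp add: m_def)
      finally show ?thesis by (metis rangeI)
    qed
    moreover have "subspace (range vec)"
      unfolding subspace_def
    proof (intro conjI ballI allI)
      show "0 \<in> range vec" using vec_smult[of 0 0] by (metis rangeI scale_zero_left)
    qed (auto simp: vec_add[symmetric] vec_smult[symmetric])
    ultimately have span: "span (range e) \<subseteq> range vec" by (intro span_minimal) auto
    show "\<exists>u. p k (vec u - y) < \<epsilon>" if "\<epsilon> > 0" for k y \<epsilon>
      using dense[OF that, of k y] span by blast
    show "\<exists>y :: nat \<Rightarrow> 'a. \<forall>x k \<epsilon>. \<epsilon> > 0 \<longrightarrow> (\<exists>n. p k (y n - x) < \<epsilon>)"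
      using ex_dense_sequence[OF sep] by metis
  qed (fact vec_add vec_smult \<alpha>)+
  then show ?thesis by blast
qed

end

section \<open>Reduction to an increasing system of seminorms\<close>

lemma seminorm_sum:
  assumes "\<And>i. i \<in> A \<Longrightarrow> seminorm smul (\<rho> i)"
  shows "seminorm smul (\<lambda>x. \<Sum>i\<in>A. \<rho> i x)"
  using assms
  by (auto simp: seminorm_def sum_nonneg sum.distrib[symmetric] sum_distrib_left intro!: sum_mono)

text \<open>Partial sums form an increasing system generating the same neighbourhoods of 0. They
  dominate the given seminorms index by index, so bounds for the sums give d-density for
  \<open>\<rho>\<close>.\<close>

lemma frechet_seminorms_partial_sums:
  assumes frechet: "complex_frechet_space smul" and \<rho>: "fundamental_seminorms smul \<rho>"
  shows "frechet_seminorms smul (\<lambda>k x. \<Sum>i\<le>k. \<rho> i x)"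
proof -
  interpret complex_frechet_space smul by (rule frechet)
  have sn: "seminorm smul (\<rho> n)" and cont: "continuous_on UNIV (\<rho> n)" for n
    using \<rho> by (auto simp: fundamental_seminorms_def)
  have nonneg: "0 \<le> \<rho> n x" for n x by (rule seminorm_nonneg[OF sn])
  show ?thesis
  proof
    show "seminorm smul (\<lambda>x. \<Sum>i\<le>k. \<rho> i x)" for k by (intro seminorm_sum sn)
    show "continuous_on UNIV (\<lambda>x. \<Sum>i\<le>k. \<rho> i x)" for k by (intro continuous_on_sum cont)
    show "(\<Sum>i\<le>j. \<rho> i x) \<le> (\<Sum>i\<le>k. \<rho> i x)" if "j \<le> k" for j k x
      using that nonneg by (intro sum_mono2) auto
    show "\<exists>k. \<exists>e>0. {x. (\<Sum>i\<le>k. \<rho> i x) < e} \<subseteq> U" if "open U" "0 \<in> U" for U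
    proof -
      obtain n e where ne: "e > 0" "{x. \<rho> n x < e} \<subseteq> U"
        using \<rho> \<open>open U\<close> \<open>0 \<in> U\<close> unfolding fundamental_seminorms_def by blast
      have "\<rho> n x \<le> (\<Sum>i\<le>n. \<rho> i x)" for x
        using nonneg by (intro member_le_sum) auto
      then have "{x. (\<Sum>i\<le>n. \<rho> i x) < e} \<subseteq> U" using ne(2) by (force intro: order_le_less_trans)
      then show ?thesis using ne(1) by blast
    qed
  qed
qed

theorem theorem4p5:
  fixes smul :: "complex \<Rightarrow> 'a::{topological_ab_group_add, t2_space} \<Rightarrow> 'a"
    and \<rho> :: "nat \<Rightarrow> 'a \<Rightarrow> real"
  assumes frechet: "complex_frechet_space smul"
    and infinite_dim: "\<not> (\<exists>B. finite_dimensional_vector_space smul B)"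
    and separable: "separable_space (euclidean :: 'a topology)"
    and seminorms: "fundamental_seminorms smul \<rho>"
  shows "\<exists>m\<ge>2. \<exists>Q::'a \<Rightarrow> 'a.
           homogeneous_polynomial smul m Q \<and> continuous_on UNIV Q \<and>
           weakly_hypercyclic smul Q \<and>
           (\<exists>d::nat \<Rightarrow> real. (\<forall>n. d n > 0) \<and> d_hypercyclic \<rho> d Q) \<and>
           (\<forall>\<Gamma>::complex set. \<not> bounded \<Gamma> \<or> 0 islimpt \<Gamma> \<longrightarrow> supercyclic smul \<Gamma> Q)"
proof -
  let ?p = "\<lambda>k x. \<Sum>i\<le>k. \<rho> i x"
  interpret frechet_seminorms smul ?p
    by (rule frechet_seminorms_partial_sums[OF frechet seminorms])
  obtain T \<alpha> vec where "translation_model smul ?p T \<alpha> vec"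
    using translation_model_exists[OF infinite_dim separable] by blast
  then interpret translation_model smul ?p T \<alpha> vec .
  have "\<rho> n x \<le> ?p n x" for n x
  proof (rule member_le_sum)
    show "0 \<le> \<rho> i x" for i
      using seminorms seminorm_nonneg unfolding fundamental_seminorms_def by blast
  qed auto
  from Q_dynamics[OF this] homogeneous_Q continuous_Q show ?thesis by blast
qed

end
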